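(* Let $\Sigma$ be a finite set of dependencies that is either linear or full. Then repair checking for $\Sigma$ (deciding, given databases $\mathcal{D}$ and $\mathcal{D}'$, whether $\mathcal{D}'$ is a repair of $\langle\Sigma,\mathcal{D}\rangle$) is in PTIME with respect to data complexity.
   Context: A signature is a set of predicate symbols with arities, always containing a special 0-ary predicate $\bot$. A term is a constant or a variable; a (predicate) atom is $p(t_1,\dots,t_n)$; an inequality is $t\neq t'$. A database is a finite set of ground atoms (facts) not containing $\bot$. A conjunction with inequalities is a conjunction of at least one predicate atom or inequality. A CQ is $\exists\vec y\,\gamma$ with $\gamma$ a conjunction with inequalities; a UCQ is a finite disjunction of CQs. A dependency is a first-order sentence $\forall\vec x\,(\gamma\rightarrow Q)$ where $\gamma$ (the body) is a conjunction with inequalities whose variables are in $\vec x$, each occurring in some predicate atom of $\gamma$, and $Q$ (the head) is a UCQ whose free variables are among $\vec x$ and in which every existentially quantified variable of each disjunct occurs in a predicate atom of that disjunct. $\mathcal{D}$ is consistent with a finite set $\Sigma$ of dependencies if $\mathcal{D}$ satisfies every dependency of $\Sigma$. A repair of $\langle\Sigma,\mathcal{D}\rangle$ is an inclusion-maximal subset of $\mathcal{D}$ consistent with $\Sigma$. Data complexity: $\Sigma$ fixed, databases are the input. A dependency is linear if its body contains exactly one predicate atom; it is full if its head is a single CQ (no disjunction) all of whose variables occur in the body. *)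

theory Defs
  imports Main
begin

datatype trm = Const nat | Var nat

datatype lit = Atom nat "trm list" | Neq trm trm

type_synonym conj = "lit list"
type_synonym cq = "nat list \<times> conj"     \<comment> \<open>existentially quantified variables, conjunction\<close>
type_synonym ucq = "cq list"

record dep =
  body :: conj
  head :: ucq

definition bot :: nat where "bot = 0"

definition signature :: "nat set \<Rightarrow> (nat \<Rightarrow> nat) \<Rightarrow> bool" where
  "signature S ar \<longleftrightarrow> bot \<in> S \<and> ar bot = 0"

fun tvars :: "trm \<Rightarrow> nat set" where
  "tvars (Const c) = {}"
| "tvars (Var x) = {x}"

fun lvars :: "lit \<Rightarrow> nat set" where
  "lvars (Atom p ts) = \<Union> (tvars ` set ts)"
| "lvars (Neq t t') = tvars t \<union> tvars t'"

definition cvars :: "conj \<Rightarrow> nat set" where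
  "cvars \<gamma> = \<Union> (lvars ` set \<gamma>)"

fun is_atom :: "lit \<Rightarrow> bool" where
  "is_atom (Atom p ts) = True"
| "is_atom (Neq t t') = False"

definition atom_vars :: "conj \<Rightarrow> nat set" where
  "atom_vars \<gamma> = \<Union> (lvars ` {l \<in> set \<gamma>. is_atom l})"

fun lit_wt :: "nat set \<Rightarrow> (nat \<Rightarrow> nat) \<Rightarrow> lit \<Rightarrow> bool" where
  "lit_wt S ar (Atom p ts) \<longleftrightarrow> p \<in> S \<and> length ts = ar p"
| "lit_wt S ar (Neq t t') \<longleftrightarrow> True"

definition conj_wf :: "nat set \<Rightarrow> (nat \<Rightarrow> nat) \<Rightarrow> conj \<Rightarrow> bool" where
  "conj_wf S ar \<gamma> \<longleftrightarrow> \<gamma> \<noteq> [] \<and> (\<forall>l \<in> set \<gamma>. lit_wt S ar l)"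

definition cq_wf :: "nat set \<Rightarrow> (nat \<Rightarrow> nat) \<Rightarrow> cq \<Rightarrow> bool" where
  "cq_wf S ar q \<longleftrightarrow> conj_wf S ar (snd q) \<and> set (fst q) \<subseteq> atom_vars (snd q)"

definition cq_free_vars :: "cq \<Rightarrow> nat set" where
  "cq_free_vars q = cvars (snd q) - set (fst q)"

text \<open>A dependency: the universally quantified variables are exactly the
  variables of the body.\<close>
definition dep_wf :: "nat set \<Rightarrow> (nat \<Rightarrow> nat) \<Rightarrow> dep \<Rightarrow> bool" where
  "dep_wf S ar d \<longleftrightarrow>
     conj_wf S ar (body d) \<and> cvars (body d) \<subseteq> atom_vars (body d) \<and>
     head d \<noteq> [] \<and>
     (\<forall>q \<in> set (head d). cq_wf S ar q \<and> cq_free_vars q \<subseteq> cvars (body d))"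

definition linear :: "dep \<Rightarrow> bool" where
  "linear d \<longleftrightarrow> length (filter is_atom (body d)) = 1"

definition full :: "dep \<Rightarrow> bool" where
  "full d \<longleftrightarrow> (\<exists>\<gamma>. head d = [([], \<gamma>)] \<and> cvars \<gamma> \<subseteq> cvars (body d))"

type_synonym fact = "nat \<times> nat list"
type_synonym db = "fact set"

fun teval :: "(nat \<Rightarrow> nat) \<Rightarrow> trm \<Rightarrow> nat" where
  "teval \<nu> (Const c) = c"
| "teval \<nu> (Var x) = \<nu> x"

fun lit_holds :: "db \<Rightarrow> (nat \<Rightarrow> nat) \<Rightarrow> lit \<Rightarrow> bool" where
  "lit_holds D \<nu> (Atom p ts) \<longleftrightarrow> (p, map (teval \<nu>) ts) \<in> D"
| "lit_holds D \<nu> (Neq t t') \<longleftrightarrow> teval \<nu> t \<noteq> teval \<nu> t'"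

definition conj_holds :: "db \<Rightarrow> (nat \<Rightarrow> nat) \<Rightarrow> conj \<Rightarrow> bool" where
  "conj_holds D \<nu> \<gamma> \<longleftrightarrow> (\<forall>l \<in> set \<gamma>. lit_holds D \<nu> l)"

definition cq_holds :: "db \<Rightarrow> (nat \<Rightarrow> nat) \<Rightarrow> cq \<Rightarrow> bool" where
  "cq_holds D \<nu> q \<longleftrightarrow>
     (\<exists>\<mu>. (\<forall>x. x \<notin> set (fst q) \<longrightarrow> \<mu> x = \<nu> x) \<and> conj_holds D \<mu> (snd q))"

definition satisfies :: "db \<Rightarrow> dep \<Rightarrow> bool" where
  "satisfies D d \<longleftrightarrow>
     (\<forall>\<nu>. conj_holds D \<nu> (body d) \<longrightarrow> (\<exists>q \<in> set (head d). cq_holds D \<nu> q))"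

definition consistent :: "dep set \<Rightarrow> db \<Rightarrow> bool" where
  "consistent \<Sigma> D \<longleftrightarrow> (\<forall>d \<in> \<Sigma>. satisfies D d)"

definition is_fact :: "nat set \<Rightarrow> (nat \<Rightarrow> nat) \<Rightarrow> fact \<Rightarrow> bool" where
  "is_fact S ar f \<longleftrightarrow> fst f \<in> S \<and> fst f \<noteq> bot \<and> length (snd f) = ar (fst f)"

definition is_db :: "nat set \<Rightarrow> (nat \<Rightarrow> nat) \<Rightarrow> db \<Rightarrow> bool" where
  "is_db S ar D \<longleftrightarrow> finite D \<and> (\<forall>f \<in> D. is_fact S ar f)"

definition is_repair :: "dep set \<Rightarrow> db \<Rightarrow> db \<Rightarrow> bool" where
  "is_repair \<Sigma> D D' \<longleftrightarrow>
     D' \<subseteq> D \<and> consistent \<Sigma> D' \<and>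
     (\<forall>E. D' \<subset> E \<and> E \<subseteq> D \<longrightarrow> \<not> consistent \<Sigma> E)"

text \<open>States and tape symbols are natural numbers. Start state 0, accepting
  state 1, rejecting state 2; blank symbol 0; head moves -1, 0, 1.\<close>

record tm =
  tm_states :: nat
  tm_syms :: nat
  tm_delta :: "nat \<Rightarrow> nat \<Rightarrow> nat \<times> nat \<times> int"

type_synonym config = "nat \<times> (int \<Rightarrow> nat) \<times> int"

text \<open>Input alphabet {1,...,5} (see the encoding below).\<close>
definition wf_tm :: "tm \<Rightarrow> bool" where
  "wf_tm M \<longleftrightarrow> 3 \<le> tm_states M \<and> 6 \<le> tm_syms M \<and>
     (\<forall>q < tm_states M. \<forall>a < tm_syms M.
        case tm_delta M q a of (q', b, m) \<Rightarrow>
          q' < tm_states M \<and> b < tm_syms M \<and> m \<in> {-1, 0, 1})"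

fun tm_step :: "tm \<Rightarrow> config \<Rightarrow> config" where
  "tm_step M (q, tp, h) =
     (if q = 1 \<or> q = 2 then (q, tp, h)
      else case tm_delta M q (tp h) of (q', b, m) \<Rightarrow> (q', tp(h := b), h + m))"

definition tm_init :: "nat list \<Rightarrow> config" where
  "tm_init w = (0, \<lambda>i. if 0 \<le> i \<and> i < int (length w) then w ! nat i else 0, 0)"

definition tm_run :: "tm \<Rightarrow> nat \<Rightarrow> nat list \<Rightarrow> config" where
  "tm_run M t w = (tm_step M ^^ t) (tm_init w)"

definition tm_accepts :: "tm \<Rightarrow> nat list \<Rightarrow> bool" where
  "tm_accepts M w \<longleftrightarrow> (\<exists>t. fst (tm_run M t w) = 1)"

fun bin :: "nat \<Rightarrow> nat list" where
  "bin n = (if n = 0 then [] else (n mod 2 + 1) # bin (n div 2))"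

definition enc_fact :: "fact \<Rightarrow> nat list" where
  "enc_fact f = bin (fst f) @ concat (map (\<lambda>c. 3 # bin c) (snd f)) @ [4]"

definition enc_db :: "fact list \<Rightarrow> nat list" where
  "enc_db xs = concat (map enc_fact xs)"

definition enc_input :: "fact list \<Rightarrow> fact list \<Rightarrow> nat list" where
  "enc_input xs ys = enc_db xs @ [5] @ enc_db ys"

definition repair_checking_in_ptime ::
    "nat set \<Rightarrow> (nat \<Rightarrow> nat) \<Rightarrow> dep set \<Rightarrow> bool" where
  "repair_checking_in_ptime S ar \<Sigma> \<longleftrightarrow>
     (\<exists>M c k. wf_tm M \<and>
        (\<forall>w. set w \<subseteq> {1..5} \<longrightarrow>
           (\<exists>t \<le> c * (length w + 1) ^ k. fst (tm_run M t w) \<in> {1, 2})) \<and>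
        (\<forall>xs ys. is_db S ar (set xs) \<and> is_db S ar (set ys) \<longrightarrow>
           (tm_accepts M (enc_input xs ys) \<longleftrightarrow> is_repair \<Sigma> (set xs) (set ys))))"

end

theory Submission
  imports Defs
begin

text \<open>A linear dependency is preserved under unions, so the consistent subsets of a database have a
  greatest element, obtained by repeatedly discarding facts that match a body whose head fails; the
  second database is a repair iff it is this greatest subset. If all dependencies are full, a
  consistent subset is maximal iff for every further fact \<open>f\<close> the closure of the subset and \<open>f\<close> under
  derivation is inconsistent or leaves the database. Both tests use first-order conditions on
  positions of the input word, equality of constants, and inflationary fixed points of position sets.

  Such conditions are decided without extra space: the tape carries, besides the input symbols,
  finitely many tracks of marks. Quantified positions are tracks with a single mark, fixed points are
  tracks that receive one mark per round, and all loops are bounded by the length of the word.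
  Such a program is turned into a Turing machine by taking its finitely
  many residual programs as states.\<close>

subsection \<open>Tape programs and Turing machines\<close>

text \<open>Inputs contain arbitrarily large constants, so no value can be kept in a state or on a
  track. Values therefore occur only as references: a pointer to a listed fact together with a field
  number, and the finitely many field numbers come from the atoms of \<Sigma>. A valuation becomes a
  tuple of pointers, one for each atom. This loses nothing because every body variable and every
  existentially quantified variable occurs in an atom. The machine must halt in polynomial time on
  every word over the input alphabet, whereas a correct verdict is claimed for encodings only. Hence
  there are two notions of decidability: \<open>tdec\<close> concerns all words, and
  \<open>dec\<close> allows a condition to be replaced by one that agrees with it on encodings. The
  lists in the input may repeat a fact. Tracks mark positions, while databases are the images of
  position sets under \<open>fat w\<close>, and all statements about consistency and inclusion are
  made about these images.\<close>

type_synonym tst = "nat \<Rightarrow> (nat \<Rightarrow> bool) \<Rightarrow> bool"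

datatype cmd = Skip | MvL | MvR | Put nat | Clr nat | Seq cmd cmd | If tst cmd cmd | While tst cmd

datatype act = Stay | Lft | Rgt | On nat | Off nat

type_synonym tracks = "nat \<Rightarrow> int set"

definition base :: "nat list \<Rightarrow> int \<Rightarrow> nat" where
  "base w i = (if 0 \<le> i \<and> i < int (length w) then w ! nat i else 0)"

text \<open>A step depends only on the scanned input symbol and the marks of the scanned cell, as a
  machine transition must. The effect is returned as an \<open>act\<close>, so the same function
  drives both \<open>cmd_step\<close> and the machine.\<close>

fun next_cmd :: "nat \<Rightarrow> (nat \<Rightarrow> bool) \<Rightarrow> cmd \<Rightarrow> cmd \<times> act" where
  "next_cmd a B Skip = (Skip, Stay)"
| "next_cmd a B MvL = (Skip, Lft)"
| "next_cmd a B MvR = (Skip, Rgt)"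
| "next_cmd a B (Put i) = (Skip, On i)"
| "next_cmd a B (Clr i) = (Skip, Off i)"
| "next_cmd a B (Seq c d) =
     (if c = Skip then (d, Stay) else (Seq (fst (next_cmd a B c)) d, snd (next_cmd a B c)))"
| "next_cmd a B (If T c d) = (if T a B then c else d, Stay)"
| "next_cmd a B (While T c) = (if T a B then Seq c (While T c) else Skip, Stay)"

fun do_act :: "act \<Rightarrow> tracks \<times> int \<Rightarrow> tracks \<times> int" where
  "do_act Stay (\<sigma>, h) = (\<sigma>, h)"
| "do_act Lft (\<sigma>, h) = (\<sigma>, h - 1)"
| "do_act Rgt (\<sigma>, h) = (\<sigma>, h + 1)"
| "do_act (On i) (\<sigma>, h) = (\<sigma>(i := insert h (\<sigma> i)), h)"
| "do_act (Off i) (\<sigma>, h) = (\<sigma>(i := \<sigma> i - {h}), h)"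

fun cmd_step :: "nat list \<Rightarrow> cmd \<times> tracks \<times> int \<Rightarrow> cmd \<times> tracks \<times> int" where
  "cmd_step w (c, \<sigma>, h) =
     (let n = next_cmd (base w h) (\<lambda>i. h \<in> \<sigma> i) c in (fst n, do_act (snd n) (\<sigma>, h)))"

text \<open>Since \<^const>\<open>Skip\<close> idles, \<open>t\<close> only bounds the running time from above.\<close>
definition exec :: "nat list \<Rightarrow> cmd \<Rightarrow> tracks \<times> int \<Rightarrow> nat \<Rightarrow> tracks \<times> int \<Rightarrow> bool" where
  "exec w c s t s' \<longleftrightarrow> (cmd_step w ^^ t) (c, s) = (Skip, s')"

lemma cmd_step_Skip: "(cmd_step w ^^ t) (Skip, s) = (Skip, s)"
  by (induction t; cases s) auto

lemma exec_mono: "exec w c s t s' \<Longrightarrow> t \<le> t' \<Longrightarrow> exec w c s t' s'"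
proof -
  assume a: "exec w c s t s'" "t \<le> t'"
  then obtain d where "t' = d + t" by (metis add.commute le_iff_add)
  with a show ?thesis by (simp add: exec_def funpow_add cmd_step_Skip)
qed

lemma exec_step: "cmd_step w (c, s) = (c', s') \<Longrightarrow> exec w c' s' t s'' \<Longrightarrow> exec w c s (Suc t) s''"
  by (simp add: exec_def funpow_swap1 del: cmd_step.simps)

lemma exec_Skip: "exec w Skip s t s"
  by (simp add: exec_def cmd_step_Skip)

lemma exec_SkipD: "exec w Skip s t s' \<Longrightarrow> s' = s"
  by (simp add: exec_def cmd_step_Skip)

lemma exec_prim:
  "exec w MvL (\<sigma>, h) 1 (\<sigma>, h - 1)"
  "exec w MvR (\<sigma>, h) 1 (\<sigma>, h + 1)"
  "exec w (Put i) (\<sigma>, h) 1 (\<sigma>(i := insert h (\<sigma> i)), h)"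
  "exec w (Clr i) (\<sigma>, h) 1 (\<sigma>(i := \<sigma> i - {h}), h)"
  by (simp_all add: exec_def)

text \<open>The extra step turns \<open>Seq Skip d\<close> into \<open>d\<close>. Time bounds may
  overshoot, so \<open>c\<close> can be \<open>Skip\<close> with steps left, which is why the
  induction step distinguishes this case.\<close>

lemma exec_Seq:
  "exec w c s t s' \<Longrightarrow> exec w d s' t' s'' \<Longrightarrow> exec w (Seq c d) s (t + t' + 1) s''"
proof (induction t arbitrary: c s)
  case 0
  then have "c = Skip" "s' = s" by (auto simp: exec_def)
  moreover have "cmd_step w (Seq Skip d, s) = (d, s)" by (cases s) (simp add: Let_def)
  ultimately show ?case using exec_step[of w "Seq Skip d" s d s t' s''] 0 by simp
next
  case (Suc t)
  show ?case
  proof (cases "c = Skip")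
    case True
    then have "s' = s" using Suc.prems(1) exec_SkipD by simp
    moreover have "cmd_step w (Seq Skip d, s) = (d, s)" by (cases s) (simp add: Let_def)
    ultimately have "exec w (Seq c d) s (Suc t') s''"
      using Suc.prems(2) True exec_step[of w "Seq Skip d" s d s t' s''] by simp
    then show ?thesis by (rule exec_mono) simp
  next
    case False
    obtain c1 s1 where st: "cmd_step w (c, s) = (c1, s1)" by (rule prod.exhaust)
    then have "exec w c1 s1 t s'" using Suc.prems(1)
      by (simp add: exec_def funpow_swap1 del: cmd_step.simps)
    then have "exec w (Seq c1 d) s1 (t + t' + 1) s''" using Suc.IH Suc.prems(2) by blast
    moreover have "cmd_step w (Seq c d, s) = (Seq c1 d, s1)"
      using st False by (cases s) (auto simp: Let_def)
    ultimately show ?thesis using exec_step by fastforce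
  qed
qed

lemma exec_If:
  assumes "T (base w h) (\<lambda>i. h \<in> \<sigma> i) \<Longrightarrow> exec w c (\<sigma>, h) t s'"
    and "\<not> T (base w h) (\<lambda>i. h \<in> \<sigma> i) \<Longrightarrow> exec w d (\<sigma>, h) t s'"
  shows "exec w (If T c d) (\<sigma>, h) (t + 1) s'"
  using assms exec_step[of w "If T c d" "(\<sigma>, h)" _ "(\<sigma>, h)" t s']
  by (cases "T (base w h) (\<lambda>i. h \<in> \<sigma> i)") (auto simp: Let_def)

lemma exec_While_False:
  "\<not> T (base w h) (\<lambda>i. h \<in> \<sigma> i) \<Longrightarrow> exec w (While T c) (\<sigma>, h) 1 (\<sigma>, h)"
  by (simp add: exec_def)

lemma exec_While_True:
  assumes "T (base w h) (\<lambda>i. h \<in> \<sigma> i)" "exec w c (\<sigma>, h) t s'" "exec w (While T c) s' t' s''"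
  shows "exec w (While T c) (\<sigma>, h) (t + t' + 2) s''"
proof -
  have "exec w (Seq c (While T c)) (\<sigma>, h) (t + t' + 1) s''"
    using assms exec_Seq by blast
  then show ?thesis using assms(1)
      exec_step[of w "While T c" "(\<sigma>, h)" "Seq c (While T c)" "(\<sigma>, h)" "t + t' + 1" s'']
    by (simp add: Let_def)
qed

section \<open>Compilation of programs into Turing machines\<close>

fun resid :: "cmd \<Rightarrow> cmd set" where
  "resid (Seq c d) = (\<lambda>c'. Seq c' d) ` resid c \<union> resid d"
| "resid (If T c d) = insert (If T c d) (resid c \<union> resid d)"
| "resid (While T c) = {While T c, Skip} \<union> (\<lambda>c'. Seq c' (While T c)) ` resid c"
| "resid c = {c, Skip}"

lemma finite_resid: "finite (resid c)"
  by (induction c) auto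

lemma resid_self: "c \<in> resid c"
  by (induction c) auto

text \<open>This closure makes the finite set \<open>resid c\<close> usable as a state set. Loops
  cause no growth: the unfolding of a loop ends with the same loop again.\<close>

lemma resid_next: "d \<in> resid c \<Longrightarrow> fst (next_cmd a B d) \<in> resid c"
  by (induction c arbitrary: d) (auto simp: resid_self split: if_splits)

text \<open>Bounds the number of bits that a tape symbol needs. Tracks that are tested but never
  changed stay empty from the start.\<close>

fun uses :: "cmd \<Rightarrow> nat set" where
  "uses (Put i) = {i}"
| "uses (Clr i) = {i}"
| "uses (Seq c d) = uses c \<union> uses d"
| "uses (If T c d) = uses c \<union> uses d"
| "uses (While T c) = uses c"
| "uses _ = {}"

lemma finite_uses: "finite (uses c)"
  by (induction c) auto

lemma uses_resid: "d \<in> resid c \<Longrightarrow> uses d \<subseteq> uses c"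
  by (induction c arbitrary: d) fastforce+

lemma next_uses: "snd (next_cmd a B c) = On i \<or> snd (next_cmd a B c) = Off i \<Longrightarrow> i \<in> uses c"
  by (induction c) (auto split: if_splits)

fun sym_of :: "act \<Rightarrow> nat \<Rightarrow> nat" where
  "sym_of (On i) a = set_bit (i + 3) a"
| "sym_of (Off i) a = unset_bit (i + 3) a"
| "sym_of _ a = a"

fun move_of :: "act \<Rightarrow> int" where
  "move_of Lft = -1"
| "move_of Rgt = 1"
| "move_of _ = 0"

text \<open>A tape symbol carries the input symbol in its lowest three bits and the tracks above;
  the states of the machine are the residual commands of the program.\<close>
definition tm_of :: "cmd \<Rightarrow> (cmd \<Rightarrow> nat) \<Rightarrow> nat \<Rightarrow> tm" where
  "tm_of c e K = \<lparr>
     tm_states = 3 + card (resid c),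
     tm_syms = 2 ^ (K + 3),
     tm_delta = (\<lambda>q a.
       let d = (if q < 3 then c else inv_into (resid c) e (q - 3));
           n = next_cmd (take_bit 3 a) (\<lambda>i. bit a (i + 3)) d
       in if d = Skip then (if bit a 3 then 1 else 2, a, 0)
          else (if fst n = c then 0 else e (fst n) + 3, sym_of (snd n) a, move_of (snd n))) \<rparr>"

lemma less_pow_iff_bits: "(a::nat) < 2 ^ n \<longleftrightarrow> (\<forall>i\<ge>n. \<not> bit a i)"
  by (metis bit_take_bit_iff bit_eq_iff linorder_not_le take_bit_nat_eq_self_iff)

lemma sym_of_less:
  assumes "a < 2 ^ (K + 3)" "\<And>i. act = On i \<or> act = Off i \<Longrightarrow> i < K"
  shows "sym_of act a < 2 ^ (K + 3)"
  using assms unfolding less_pow_iff_bits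
  by (cases act) (auto simp: bit_set_bit_iff bit_unset_bit_iff)

lemma wf_tm_of:
  assumes "bij_betw e (resid c) {..<card (resid c)}" "\<And>i. i \<in> uses c \<Longrightarrow> i < K"
  shows "wf_tm (tm_of c e K)"
proof -
  have inR: "inv_into (resid c) e (q - 3) \<in> resid c" if "q < 3 + card (resid c)" "\<not> q < 3" for q
    using that assms(1) by (intro inv_into_into) (auto simp: bij_betw_def)
  have eR: "e d < card (resid c)" if "d \<in> resid c" for d
    using that assms(1) by (auto simp: bij_betw_def)
  have "6 \<le> (2::nat) ^ (K + 3)" by (simp add: power_add)
       (use one_le_power[of "2::nat" K] in linarith)
  moreover have "(let (q', b, m) = tm_delta (tm_of c e K) q a in
      q' < 3 + card (resid c) \<and> b < 2 ^ (K + 3) \<and> m \<in> {-1, 0, 1})"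
    if q: "q < 3 + card (resid c)" and a: "a < 2 ^ (K + 3)" for q a
  proof -
    define d where "d = (if q < 3 then c else inv_into (resid c) e (q - 3))"
    have d: "d \<in> resid c" using inR q resid_self by (auto simp: d_def)
    define n where "n = next_cmd (take_bit 3 a) (\<lambda>i. bit a (i + 3)) d"
    have n: "fst n \<in> resid c" using d resid_next by (simp add: n_def)
    have "snd n = On i \<or> snd n = Off i \<Longrightarrow> i < K" for i
      using next_uses uses_resid[OF d] assms(2) by (fastforce simp: n_def)
    then have "sym_of (snd n) a < 2 ^ (K + 3)" using sym_of_less a by blast
    moreover have "move_of (snd n) \<in> {-1, 0, 1}" by (cases "snd n") auto
    ultimately show ?thesis using a eR[OF n]
      by (auto simp: tm_of_def Let_def d_def[symmetric] n_def[symmetric])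
  qed
  ultimately show ?thesis by (simp add: wf_tm_def tm_of_def)
qed

text \<open>The simulation invariant. The low bits keep showing the original input because
  \<open>sym_of\<close> changes only bits from 3 on. As \<open>j\<close> is unrestricted, the size
  bound forces the tracks from \<open>K\<close> on to be empty.\<close>

definition represents :: "nat list \<Rightarrow> nat \<Rightarrow> (int \<Rightarrow> nat) \<Rightarrow> tracks \<Rightarrow> bool" where
  "represents w K tp \<sigma> \<longleftrightarrow> (\<forall>i. tp i < 2 ^ (K + 3) \<and> take_bit 3 (tp i) = base w i \<and>
     (\<forall>j. bit (tp i) (j + 3) \<longleftrightarrow> i \<in> \<sigma> j))"

lemma represents_sym_of:
  assumes "represents w K tp \<sigma>" "\<And>i. act = On i \<or> act = Off i \<Longrightarrow> i < K"
  shows "represents w K (tp(h := sym_of act (tp h))) (fst (do_act act (\<sigma>, h)))"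
proof -
  have "take_bit 3 (sym_of act (tp h)) = take_bit 3 (tp h)"
    by (cases act) (auto intro!: bit_eqI simp: bit_set_bit_iff bit_unset_bit_iff bit_take_bit_iff)
  moreover have "sym_of act (tp h) < 2 ^ (K + 3)"
    using assms by (intro sym_of_less) (auto simp: represents_def)
  moreover have "bit (sym_of act (tp h)) (j + 3) \<longleftrightarrow> h \<in> fst (do_act act (\<sigma>, h)) j" for j
    using assms(1) by (cases act) (auto simp: represents_def bit_set_bit_iff bit_unset_bit_iff)
  moreover have "i \<noteq> h \<Longrightarrow> i \<in> fst (do_act act (\<sigma>, h)) j \<longleftrightarrow> i \<in> \<sigma> j" for i j
    by (cases act) auto
  ultimately show ?thesis using assms(1) by (auto simp: represents_def)
qed

lemma do_act_head: "snd (do_act act (\<sigma>, h)) = h + move_of act"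
  by (cases act) auto

text \<open>One machine step for each command step, plus one that turns the residual program
  \<open>Skip\<close> into a halting state. The start state has to be 0, so \<open>c\<close> itself
  is coded by 0 and any other residual \<open>d\<close> by \<open>e d + 3\<close>, clear of the
  halting states 1 and 2.\<close>

lemma tm_of_run:
  assumes bij: "bij_betw e (resid c) {..<card (resid c)}" and K: "\<And>i. i \<in> uses c \<Longrightarrow> i < K"
    and "exec w d (\<sigma>, h) t (\<sigma>', h')" "d \<in> resid c" "represents w K tp \<sigma>"
    and "q = (if d = c then 0 else e d + 3)"
  shows "\<exists>t' \<le> t + 1. fst ((tm_step (tm_of c e K) ^^ t') (q, tp, h)) = (if h' \<in> \<sigma>' 0 then 1 else 2)"
  using assms(3-6)
proof (induction t arbitrary: d \<sigma> h tp q)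
  case (0 d \<sigma> h)
  have inv: "inv_into (resid c) e (e d) = d"
    using bij \<open>d \<in> resid c\<close> by (simp add: bij_betw_def)
  have "d = Skip" "\<sigma>' = \<sigma>" "h' = h" using 0 by (auto simp: exec_def)
  moreover have "bit (tp h) 3 \<longleftrightarrow> h \<in> \<sigma> 0"
    using 0(3) unfolding represents_def by (metis add_0)
  ultimately show ?case using 0 inv
    by (auto intro!: exI[of _ 1] simp: tm_of_def)
next
  case (Suc t d \<sigma> h tp q)
  have inv: "inv_into (resid c) e (e d) = d"
    using bij \<open>d \<in> resid c\<close> by (simp add: bij_betw_def)
  have q: "q \<noteq> 1 \<and> q \<noteq> 2 \<and> (if q < 3 then c else inv_into (resid c) e (q - 3)) = d"
    using Suc.prems(4) inv by auto
  show ?case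
  proof (cases "d = Skip")
    case True
    then have "\<sigma>' = \<sigma>" "h' = h" using Suc.prems(1) exec_SkipD by auto
    moreover have "bit (tp h) 3 \<longleftrightarrow> h \<in> \<sigma> 0"
      using Suc.prems(3) unfolding represents_def by (metis add_0)
    ultimately show ?thesis using q True
      by (auto intro!: exI[of _ 1] simp: tm_of_def)
  next
    case False
    define n where "n = next_cmd (base w h) (\<lambda>i. h \<in> \<sigma> i) d"
    have n': "next_cmd (take_bit 3 (tp h)) (\<lambda>i. bit (tp h) (i + 3)) d = n"
      using Suc.prems(3) by (simp add: n_def represents_def)
    obtain \<sigma>1 h1 where s1: "do_act (snd n) (\<sigma>, h) = (\<sigma>1, h1)" by fastforce
    have R: "fst n \<in> resid c" using resid_next Suc.prems(2) by (simp add: n_def)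
    have "snd n = On i \<or> snd n = Off i \<Longrightarrow> i < K" for i
      using next_uses uses_resid[OF Suc.prems(2)] K by (fastforce simp: n_def)
    then have rep: "represents w K (tp(h := sym_of (snd n) (tp h))) \<sigma>1"
      using represents_sym_of[OF Suc.prems(3), of "snd n" h] s1 by auto
    have "exec w (fst n) (\<sigma>1, h1) t (\<sigma>', h')"
      using Suc.prems(1) s1 by (simp add: exec_def funpow_swap1 Let_def n_def[symmetric])
    from Suc.IH[OF this R rep refl] obtain t' where t': "t' \<le> t + 1"
      "fst ((tm_step (tm_of c e K) ^^ t')
        (if fst n = c then 0 else e (fst n) + 3, tp(h := sym_of (snd n) (tp h)), h1)) =
       (if h' \<in> \<sigma>' 0 then 1 else 2)" by blast
    have "tm_step (tm_of c e K) (q, tp, h) =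
      (if fst n = c then 0 else e (fst n) + 3, tp(h := sym_of (snd n) (tp h)), h1)"
      using q False do_act_head[of "snd n" \<sigma> h] s1 n' by (simp add: tm_of_def Let_def)
    then show ?thesis using t' by (intro exI[of _ "Suc t'"]) (simp add: funpow_swap1 del: tm_step.simps)
  qed
qed

lemma represents_init:
  assumes "set w \<subseteq> {1..5}"
  shows "represents w K (fst (snd (tm_init w))) (\<lambda>_. {})"
proof -
  have lt: "base w i < 2 ^ 3" for i
    using assms nth_mem[of "nat i" w] by (fastforce simp: base_def)
  then have "\<not> bit (base w i) (j + 3)" for i j
    unfolding less_pow_iff_bits by (meson le_add2)
  moreover have "base w i < 2 ^ (K + 3)" for i
    using lt[of i] power_increasing[of 3 "K + 3" "2::nat"] by simp
  moreover have "take_bit 3 (base w i) = base w i" for i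
    using lt[of i] by (simp add: take_bit_nat_eq_self_iff)
  moreover have "fst (snd (tm_init w)) = base w" by (auto simp: tm_init_def base_def)
  ultimately show ?thesis by (auto simp: represents_def)
qed

lemma tm_run_halted:
  "fst (tm_run M t w) \<in> {1, 2} \<Longrightarrow> fst (tm_run M (t + n) w) = fst (tm_run M t w)"
proof (induction n)
  case (Suc n)
  have "tm_run M (t + Suc n) w = tm_step M (tm_run M (t + n) w)" by (simp add: tm_run_def)
  moreover have "fst (tm_step M s) = fst s" if "fst s \<in> {1, 2}" for s
    using that by (cases s) auto
  ultimately show ?case using Suc by metis
qed simp

lemma program_to_tm:
  assumes ex: "\<And>w. set w \<subseteq> {1..5} \<Longrightarrow> \<exists>\<sigma>' h'. exec w c (\<lambda>_. {}, 0) (b (length w)) (\<sigma>', h') \<and> (h' \<in> \<sigma>' 0 \<longleftrightarrow> P w)"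
  shows "\<exists>M. wf_tm M \<and> (\<forall>w. set w \<subseteq> {1..5} \<longrightarrow>
           (\<exists>t \<le> b (length w) + 1. fst (tm_run M t w) \<in> {1, 2}) \<and> (tm_accepts M w \<longleftrightarrow> P w))"
proof -
  obtain e where e: "bij_betw e (resid c) {..<card (resid c)}"
    using finite_resid ex_bij_betw_finite_nat[of "resid c"] by (auto simp: atLeast0LessThan)
  obtain K where K: "\<And>i. i \<in> uses c \<Longrightarrow> i < K"
    using finite_uses[of c] by (auto simp: finite_nat_set_iff_bounded)
  let ?M = "tm_of c e K"
  have *: "\<exists>t \<le> b (length w) + 1. fst (tm_run ?M t w) = (if P w then 1 else 2)"
    if w: "set w \<subseteq> {1..5}" for w
  proof -
    obtain \<sigma>' h' where x: "exec w c (\<lambda>_. {}, 0) (b (length w)) (\<sigma>', h')" "h' \<in> \<sigma>' 0 \<longleftrightarrow> P w"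
      using ex[OF w] by blast
    obtain tp where i: "tm_init w = (0, tp, 0)" by (simp add: tm_init_def)
    show ?thesis
      using tm_of_run[OF e K x(1) resid_self represents_init[OF w], of 0] x(2)
      by (simp add: tm_run_def i)
  qed
  have acc: "tm_accepts ?M w \<longleftrightarrow> P w" if w: "set w \<subseteq> {1..5}" for w
  proof -
    obtain t where t: "fst (tm_run ?M t w) = (if P w then 1 else 2)" using *[OF w] by blast
    show ?thesis
    proof
      assume "tm_accepts ?M w"
      then obtain t' where t': "fst (tm_run ?M t' w) = 1" by (auto simp: tm_accepts_def)
      \<comment> \<open>Halted states persist, so two halting times can be compared at their
        sum.\<close>
      have "fst (tm_run ?M (t + t') w) = fst (tm_run ?M t w)"
        using t by (intro tm_run_halted) auto
      moreover have "fst (tm_run ?M (t' + t) w) = fst (tm_run ?M t' w)"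
        using t' by (intro tm_run_halted) auto
      ultimately have "fst (tm_run ?M t w) = 1" using t' by (metis add.commute)
      then show "P w" using t by (cases "P w") auto
    next
      assume "P w" then show "tm_accepts ?M w" using t by (auto simp: tm_accepts_def)
    qed
  qed
  have halts: "\<exists>t \<le> b (length w) + 1. fst (tm_run ?M t w) \<in> {1, 2}" if w: "set w \<subseteq> {1..5}" for w
  proof -
    obtain t where "t \<le> b (length w) + 1" "fst (tm_run ?M t w) = (if P w then 1 else 2)"
      using *[OF w] by blast
    then show ?thesis by (intro exI[of _ t]) (cases "P w"; simp)
  qed
  show ?thesis
  proof (intro exI[of _ ?M] conjI allI impI)
    show "wf_tm ?M" using e K by (rule wf_tm_of)
  qed (rule halts acc, assumption)+
qed

subsection \<open>Polynomial bounds and sweeps\<close>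

text \<open>The shape of the bound in \<open>repair_checking_in_ptime\<close>. The summand 1 keeps
  the base positive, so that powers are monotone in the exponent, as closure under addition
  requires.\<close>

definition polyb :: "(nat \<Rightarrow> nat) \<Rightarrow> bool" where
  "polyb f \<longleftrightarrow> (\<exists>c k. \<forall>n. f n \<le> c * (n + 1) ^ k)"

lemma polyb_const: "polyb (\<lambda>n. c)"
  unfolding polyb_def by (rule exI[of _ c], rule exI[of _ 0]) simp

lemma polyb_id: "polyb (\<lambda>n. n)"
  unfolding polyb_def by (rule exI[of _ 1], rule exI[of _ 1]) simp

lemma polyb_add: "polyb f \<Longrightarrow> polyb g \<Longrightarrow> polyb (\<lambda>n. f n + g n)"
proof -
  assume "polyb f" "polyb g"
  then obtain c k c' k' where *: "\<And>n. f n \<le> c * (n + 1) ^ k" "\<And>n. g n \<le> c' * (n + 1) ^ k'"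
    unfolding polyb_def by blast
  have "f n + g n \<le> (c + c') * (n + 1) ^ (k + k')" for n
  proof -
    have "c * (n + 1) ^ k \<le> c * (n + 1) ^ (k + k')" "c' * (n + 1) ^ k' \<le> c' * (n + 1) ^ (k + k')"
      by (intro mult_left_mono power_increasing; simp)+
    then show ?thesis using *[of n] unfolding add_mult_distrib by linarith
  qed
  then show ?thesis unfolding polyb_def by blast
qed

lemma polyb_mult: "polyb f \<Longrightarrow> polyb g \<Longrightarrow> polyb (\<lambda>n. f n * g n)"
proof -
  assume "polyb f" "polyb g"
  then obtain c k c' k' where *: "\<And>n. f n \<le> c * (n + 1) ^ k" "\<And>n. g n \<le> c' * (n + 1) ^ k'"
    unfolding polyb_def by blast
  have "f n * g n \<le> (c * c') * (n + 1) ^ (k + k')" for n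
    using mult_mono[OF *(1)[of n] *(2)[of n]] by (simp add: power_add algebra_simps)
  then show ?thesis unfolding polyb_def by blast
qed

lemmas polyb_intros = polyb_const polyb_id polyb_add polyb_mult

definition inp :: "nat list \<Rightarrow> bool" where "inp w \<longleftrightarrow> set w \<subseteq> {1..5}"
abbreviation len :: "nat list \<Rightarrow> int" where "len w \<equiv> int (length w)"

text \<open>Input symbols are positive, so a blank detects both ends of the word. Head positions
  range from 0 to the first blank cell \<open>len w\<close>, which later doubles as the result of a
  failed navigation.\<close>

lemma base_eq_0: "inp w \<Longrightarrow> base w i = 0 \<longleftrightarrow> i < 0 \<or> len w \<le> i"
proof -
  assume w: "inp w"
  have "w ! nat i \<noteq> 0" if "nat i < length w" using nth_mem[OF that] w by (fastforce simp: inp_def)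
  then show ?thesis by (auto simp: base_def)
qed

text \<open>The blank always counts as a stopping condition; hence for starts inside the word the
  minimum exists and the result is at most \<open>len w\<close>.\<close>

definition sweep :: "nat list \<Rightarrow> (int \<Rightarrow> bool) \<Rightarrow> int \<Rightarrow> int" where
  "sweep w st h = h + int (LEAST n. st (h + int n) \<or> base w (h + int n) = 0)"

lemma sweep_eqI:
  assumes "h \<le> p" "st p \<or> base w p = 0" "\<And>i. h \<le> i \<Longrightarrow> i < p \<Longrightarrow> \<not> st i \<and> base w i \<noteq> 0"
  shows "sweep w st h = p"
proof -
  have "(LEAST n. st (h + int n) \<or> base w (h + int n) = 0) = nat (p - h)"
  proof (rule Least_equality)
    show "st (h + int (nat (p - h))) \<or> base w (h + int (nat (p - h))) = 0" using assms by simp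
    fix n assume "st (h + int n) \<or> base w (h + int n) = 0"
    then have "\<not> h + int n < p" using assms(3)[of "h + int n"] by auto
    then show "nat (p - h) \<le> n" by simp
  qed
  then show ?thesis using assms(1) by (simp add: sweep_def)
qed

lemma sweep_cases:
  assumes "inp w" "0 \<le> h" "h \<le> len w"
  obtains p where "sweep w st h = p" "h \<le> p" "p \<le> len w" "st p \<or> base w p = 0"
    "\<And>i. h \<le> i \<Longrightarrow> i < p \<Longrightarrow> \<not> st i \<and> base w i \<noteq> 0"
proof -
  let ?Q = "\<lambda>n. st (h + int n) \<or> base w (h + int n) = 0"
  have N: "?Q (nat (len w - h))" using assms by (simp add: base_eq_0)
  have "?Q (LEAST n. ?Q n)" using N by (rule LeastI)
  moreover have "(LEAST n. ?Q n) \<le> nat (len w - h)" using N by (rule Least_le)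
  moreover have "\<not> st i \<and> base w i \<noteq> 0" if "h \<le> i" "i < sweep w st h" for i
  proof -
    have "nat (i - h) < (LEAST n. ?Q n)" using that unfolding sweep_def by linarith
    then have "\<not> ?Q (nat (i - h))" by (rule not_less_Least)
    then show ?thesis using that(1) by simp
  qed
  moreover have "sweep w st h \<le> len w"
    using \<open>(LEAST n. ?Q n) \<le> nat (len w - h)\<close> assms(3) unfolding sweep_def by linarith
  moreover have "h \<le> sweep w st h" by (simp add: sweep_def)
  ultimately show ?thesis by (intro that[of "sweep w st h"] refl) (unfold sweep_def)
qed

lemma sweep_here: "st h \<or> base w h = 0 \<Longrightarrow> sweep w st h = h"
  by (rule sweep_eqI) auto

lemma sweep_next:
  assumes "inp w" "0 \<le> h" "\<not> st h" "base w h \<noteq> 0"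
  shows "sweep w st h = sweep w st (h + 1)"
proof -
  have "h + 1 \<le> len w" using assms base_eq_0[of w h] by auto
  then obtain p where p: "sweep w st (h + 1) = p" "h + 1 \<le> p" "st p \<or> base w p = 0"
    "\<And>i. h + 1 \<le> i \<Longrightarrow> i < p \<Longrightarrow> \<not> st i \<and> base w i \<noteq> 0"
    using sweep_cases[OF assms(1), of "h + 1" st] assms(2) by (metis add_increasing zero_le_one)
  have "sweep w st h = p"
  proof (rule sweep_eqI)
    fix i assume i: "h \<le> i" "i < p"
    show "\<not> st i \<and> base w i \<noteq> 0" using assms(3,4) p(4)[of i] i by (cases "i = h") auto
  qed (use p in auto)
  then show ?thesis using p by simp
qed

definition goR :: "tst \<Rightarrow> cmd" where
  "goR T = While (\<lambda>a B. a \<noteq> 0 \<and> \<not> T a B) MvR"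

text \<open>Each cell costs three steps, one for the move and two for unfolding the loop; the
  remaining step is the failing test.\<close>

lemma exec_goR:
  assumes "inp w" "0 \<le> h" "h \<le> len w"
  shows "exec w (goR T) (\<sigma>, h) (3 * length w + 1)
           (\<sigma>, sweep w (\<lambda>i. T (base w i) (\<lambda>j. i \<in> \<sigma> j)) h)"
proof -
  let ?st = "\<lambda>i. T (base w i) (\<lambda>j. i \<in> \<sigma> j)"
  have "exec w (goR T) (\<sigma>, h) (3 * n + 1) (\<sigma>, sweep w ?st h)"
    if "n = nat (len w - h)" "0 \<le> h" "h \<le> len w" for n h
    using that
  proof (induction n arbitrary: h)
    case 0
    then have "h = len w" by simp
    then have "base w h = 0" using assms by (simp add: base_eq_0)
    then show ?case
      using sweep_here[of ?st h w] exec_While_False[of "\<lambda>a B. a \<noteq> 0 \<and> \<not> T a B" w h \<sigma> MvR]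
      by (simp add: goR_def)
  next
    case (Suc n)
    show ?case
    proof (cases "?st h \<or> base w h = 0")
      case True
      then have "exec w (goR T) (\<sigma>, h) 1 (\<sigma>, sweep w ?st h)"
        using exec_While_False[of "\<lambda>a B. a \<noteq> 0 \<and> \<not> T a B" w h \<sigma> MvR] sweep_here[of ?st h w]
        by (auto simp: goR_def)
      then show ?thesis by (rule exec_mono) simp
    next
      case False
      have "exec w (goR T) (\<sigma>, h + 1) (3 * n + 1) (\<sigma>, sweep w ?st (h + 1))"
        using Suc by (intro Suc.IH) auto
      then have "exec w (goR T) (\<sigma>, h) (1 + (3 * n + 1) + 2) (\<sigma>, sweep w ?st (h + 1))"
        unfolding goR_def using False by (intro exec_While_True[OF _ exec_prim(2)]) auto
      then show ?thesis using sweep_next[OF assms(1) Suc.prems(2), of ?st] False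
        by (auto elim!: exec_mono)
    qed
  qed
  from exec_mono[OF this[OF refl assms(2,3)]] show ?thesis using assms(2) by simp
qed

text \<open>The cell just right of the nearest symbol of \<open>S\<close> that lies strictly before
  \<open>h\<close>. Cell \<open>h\<close> itself is not inspected, so from the terminator of a fact
  this leads to the beginning of that same fact.\<close>

definition lsweep :: "nat list \<Rightarrow> nat set \<Rightarrow> int \<Rightarrow> int" where
  "lsweep w S h = h - int (LEAST n. base w (h - 1 - int n) \<in> S)"

lemma lsweep_eqI:
  assumes "p \<le> h" "base w (p - 1) \<in> S" "\<And>i. p \<le> i \<Longrightarrow> i < h \<Longrightarrow> base w i \<notin> S"
  shows "lsweep w S h = p"
proof -
  have "(LEAST n. base w (h - 1 - int n) \<in> S) = nat (h - p)"
  proof (rule Least_equality)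
    show "base w (h - 1 - int (nat (h - p))) \<in> S" using assms by simp
    fix n assume "base w (h - 1 - int n) \<in> S"
    then have "\<not> p \<le> h - 1 - int n" using assms(3)[of "h - 1 - int n"] by auto
    then show "nat (h - p) \<le> n" by simp
  qed
  then show ?thesis using assms(1) by (simp add: lsweep_def)
qed

lemma lsweep_here: "base w (h - 1) \<in> S \<Longrightarrow> lsweep w S h = h"
  by (rule lsweep_eqI) auto

lemma lsweep_next:
  assumes "0 \<in> S" "0 \<le> h" "base w (h - 1) \<notin> S"
  shows "lsweep w S h = lsweep w S (h - 1)"
proof -
  let ?Q = "\<lambda>n. base w (h - 2 - int n) \<in> S"
  have "?Q (nat h)" using assms by (simp add: base_def)
  then have L: "?Q (LEAST n. ?Q n)" by (rule LeastI)
  define p where "p = h - 1 - int (LEAST n. ?Q n)"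
  have np: "base w i \<notin> S" if "p \<le> i" "i < h - 1" for i
  proof -
    have "nat (h - 2 - i) < (LEAST n. ?Q n)" using that unfolding p_def by linarith
    then have "\<not> ?Q (nat (h - 2 - i))" by (rule not_less_Least)
    then show ?thesis using that(2) by simp
  qed
  have pS: "base w (p - 1) \<in> S" "p \<le> h - 1" using L by (simp_all add: p_def algebra_simps)
  have "lsweep w S (h - 1) = p" using pS np by (intro lsweep_eqI)
  moreover have "lsweep w S h = p"
  proof (rule lsweep_eqI)
    fix i assume "p \<le> i" "i < h"
    then show "base w i \<notin> S" using np[of i] assms(3) by (cases "i = h - 1") auto
  qed (use pS in auto)
  ultimately show ?thesis by simp
qed

definition goL :: "nat set \<Rightarrow> cmd" where
  "goL S = Seq MvL (Seq (While (\<lambda>a B. a \<notin> S) MvL) MvR)"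

lemma exec_goL:
  assumes "0 \<in> S" "0 \<le> h" "h \<le> len w"
  shows "exec w (goL S) (\<sigma>, h) (3 * length w + 5) (\<sigma>, lsweep w S h) \<and> 0 \<le> lsweep w S h \<and> lsweep w S h \<le> h"
proof -
  let ?T = "\<lambda>a (B :: nat \<Rightarrow> bool). a \<notin> S"
  have *: "exec w (While ?T MvL) (\<sigma>, h - 1) (3 * n + 1) (\<sigma>, lsweep w S h - 1) \<and>
      0 \<le> lsweep w S h \<and> lsweep w S h \<le> h"
    if "n = nat h" "0 \<le> h" for n h
    using that
  proof (induction n arbitrary: h)
    case 0
    then have "base w (h - 1) \<in> S" using assms by (simp add: base_def)
    then show ?case using 0 exec_While_False[of ?T w "h - 1" \<sigma> MvL] lsweep_here[of w h S] by simp
  next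
    case (Suc n)
    show ?case
    proof (cases "base w (h - 1) \<in> S")
      case True
      then have "exec w (While ?T MvL) (\<sigma>, h - 1) 1 (\<sigma>, lsweep w S h - 1)"
        using exec_While_False[of ?T w "h - 1" \<sigma> MvL] lsweep_here[of w h S] by simp
      then show ?thesis using exec_mono[of w _ _ 1] Suc.prems lsweep_here[OF True] by simp
    next
      case False
      have IH: "exec w (While ?T MvL) (\<sigma>, h - 1 - 1) (3 * n + 1) (\<sigma>, lsweep w S (h - 1) - 1) \<and>
        0 \<le> lsweep w S (h - 1) \<and> lsweep w S (h - 1) \<le> h - 1"
        using Suc.prems by (intro Suc.IH) auto
      have "exec w (While ?T MvL) (\<sigma>, h - 1) (1 + (3 * n + 1) + 2) (\<sigma>, lsweep w S (h - 1) - 1)"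
        using False IH by (intro exec_While_True[OF _ exec_prim(1)]) auto
      then show ?thesis using lsweep_next[OF assms(1) Suc.prems(2) False] IH
        by (auto elim!: exec_mono)
    qed
  qed
  note * = *[OF refl assms(2)]
  have "exec w (goL S) (\<sigma>, h) (1 + ((3 * nat h + 1) + 1 + 1) + 1) (\<sigma>, lsweep w S h)"
    unfolding goL_def using * exec_prim(2)[of w \<sigma> "lsweep w S h - 1"]
    by (intro exec_Seq[OF exec_prim(1)] exec_Seq[of w _ _ _ "(\<sigma>, lsweep w S h - 1)"]) auto
  from exec_mono[OF this] show ?thesis using * assms(3) by auto
qed

definition home :: cmd where "home = goL {0}"

lemma exec_home:
  assumes "inp w" "0 \<le> h" "h \<le> len w"
  shows "exec w home (\<sigma>, h) (3 * length w + 5) (\<sigma>, 0)"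
proof -
  have "lsweep w {0} h = 0" using assms by (intro lsweep_eqI) (auto simp: base_eq_0)
  then show ?thesis using exec_goL[of "{0}" h w \<sigma>] assms by (simp add: home_def)
qed

text \<open>Head movements that leave the tracks unchanged. The target may depend on the tracks, so
  pointers can steer the head; the range condition makes such movements composable.\<close>

definition nav :: "cmd \<Rightarrow> (nat list \<Rightarrow> tracks \<Rightarrow> int \<Rightarrow> int) \<Rightarrow> bool" where
  "nav c f \<longleftrightarrow> (\<exists>b. polyb b \<and> (\<forall>w \<sigma> h. inp w \<longrightarrow> 0 \<le> h \<longrightarrow> h \<le> len w \<longrightarrow>
     exec w c (\<sigma>, h) (b (length w)) (\<sigma>, f w \<sigma> h) \<and> 0 \<le> f w \<sigma> h \<and> f w \<sigma> h \<le> len w))"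

lemma nav_goR: "nav (goR T) (\<lambda>w \<sigma>. sweep w (\<lambda>i. T (base w i) (\<lambda>j. i \<in> \<sigma> j)))"
  unfolding nav_def
proof (intro exI conjI allI impI)
  show "polyb (\<lambda>n. 3 * n + 1)" by (intro polyb_intros)
qed (use exec_goR in blast, (metis sweep_cases order_trans)+)

lemma nav_goL: "0 \<in> S \<Longrightarrow> nav (goL S) (\<lambda>w \<sigma>. lsweep w S)"
  unfolding nav_def
proof (intro exI conjI allI impI)
  show "polyb (\<lambda>n. 3 * n + 5)" by (intro polyb_intros)
  fix w :: "nat list" and \<sigma> h
  assume "0 \<in> S" "inp w" "0 \<le> h" "h \<le> len w"
  then show "exec w (goL S) (\<sigma>, h) (3 * length w + 5) (\<sigma>, lsweep w S h)" "0 \<le> lsweep w S h"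
    "lsweep w S h \<le> len w"
    using exec_goL[of S h w \<sigma>] by auto
qed

lemma nav_Seq:
  assumes "nav c f" "nav d g"
  shows "nav (Seq c d) (\<lambda>w \<sigma> h. g w \<sigma> (f w \<sigma> h))"
proof -
  obtain b b' where *: "polyb b" "polyb b'"
    "\<And>w \<sigma> h. inp w \<Longrightarrow> 0 \<le> h \<Longrightarrow> h \<le> len w \<Longrightarrow>
     exec w c (\<sigma>, h) (b (length w)) (\<sigma>, f w \<sigma> h) \<and> 0 \<le> f w \<sigma> h \<and> f w \<sigma> h \<le> len w"
    "\<And>w \<sigma> h. inp w \<Longrightarrow> 0 \<le> h \<Longrightarrow> h \<le> len w \<Longrightarrow>
     exec w d (\<sigma>, h) (b' (length w)) (\<sigma>, g w \<sigma> h) \<and> 0 \<le> g w \<sigma> h \<and> g w \<sigma> h \<le> len w"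
    using assms unfolding nav_def by metis
  have "polyb (\<lambda>n. b n + b' n + 1)" by (intro polyb_intros *)
  moreover have "exec w (Seq c d) (\<sigma>, h) (b (length w) + b' (length w) + 1) (\<sigma>, g w \<sigma> (f w \<sigma> h)) \<and>
      0 \<le> g w \<sigma> (f w \<sigma> h) \<and> g w \<sigma> (f w \<sigma> h) \<le> len w"
    if "inp w" "0 \<le> h" "h \<le> len w" for w \<sigma> h
    using *(3)[OF that, of \<sigma>] *(4)[OF that(1), of "f w \<sigma> h" \<sigma>] exec_Seq by blast
  ultimately show ?thesis unfolding nav_def by (intro exI[of _ "\<lambda>n. b n + b' n + 1"]) auto
qed

text \<open>Failure is a jump to \<open>len w\<close>. The blank there lets every later check for a
  nonzero symbol fail too, so a chain of checks needs no error flag.\<close>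

definition chk :: "nat \<Rightarrow> cmd" where
  "chk s = If (\<lambda>a B. a = s) MvR (goR (\<lambda>a B. False))"

lemma nav_chk:
  assumes "s \<noteq> 0"
  shows "nav (chk s) (\<lambda>w \<sigma> h. if base w h = s then h + 1 else len w)"
  unfolding nav_def
proof (intro exI conjI allI impI)
  show "polyb (\<lambda>n. (3 * n + 1) + 1)" by (intro polyb_intros)
  fix w :: "nat list" and \<sigma> h assume h: "inp w" "0 \<le> h" "h \<le> len w"
  have "sweep w (\<lambda>i. False) h = len w" using h by (intro sweep_eqI) (auto simp: base_eq_0)
  then have g: "exec w (goR (\<lambda>a B. False)) (\<sigma>, h) (3 * length w + 1) (\<sigma>, len w)"
    using exec_goR[OF h, of "\<lambda>a B. False" \<sigma>] by simp
  have m: "exec w MvR (\<sigma>, h) (3 * length w + 1) (\<sigma>, h + 1)"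
    using exec_prim(2) by (rule exec_mono) simp
  show "exec w (chk s) (\<sigma>, h) (3 * length w + 1 + 1) (\<sigma>, if base w h = s then h + 1 else len w)"
    unfolding chk_def using g m by (intro exec_If) auto
  show "(if base w h = s then h + 1 else len w) \<le> len w"
    using assms h base_eq_0[of w h] by auto
qed auto

subsection \<open>Decidable properties of marked words\<close>

definition marked :: "nat list \<Rightarrow> nat \<Rightarrow> tracks \<Rightarrow> bool" where
  "marked w k \<sigma> \<longleftrightarrow> (\<forall>i\<ge>k. \<sigma> i = {}) \<and> (\<forall>i. \<sigma> i \<subseteq> {0..len w})"

definition flag :: "bool \<Rightarrow> int set" where "flag b = (if b then {0} else {})"

lemma flag_simps [simp]: "flag True = {0}" "flag False = {}" "0 \<in> flag b \<longleftrightarrow> b" "flag b - {0} = {}"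
  by (auto simp: flag_def)

lemma marked_upd: "marked w k \<sigma> \<Longrightarrow> X \<subseteq> {0..len w} \<Longrightarrow> marked w (Suc k) (\<sigma>(k := X))"
  by (auto simp: marked_def)

lemma marked_triv: "marked w k \<sigma> \<Longrightarrow> k \<le> i \<Longrightarrow> \<sigma> i = {}"
  by (simp add: marked_def)

text \<open>Tracks below \<open>k\<close> are parameters and tracks from \<open>k\<close> on are empty scratch space; the answer is
  left as a mark of the home cell on track \<open>k\<close>.\<close>
definition solves :: "nat \<Rightarrow> cmd \<Rightarrow> (nat \<Rightarrow> nat) \<Rightarrow> (nat list \<Rightarrow> tracks \<Rightarrow> bool) \<Rightarrow> bool" where
  "solves k c b P \<longleftrightarrow> polyb b \<and> (\<forall>w \<sigma>. inp w \<longrightarrow> marked w k \<sigma> \<longrightarrow>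
     exec w c (\<sigma>, 0) (b (length w)) (\<sigma>(k := flag (P w \<sigma>)), 0))"

definition tdec :: "nat \<Rightarrow> (nat list \<Rightarrow> tracks \<Rightarrow> bool) \<Rightarrow> bool" where
  "tdec k P \<longleftrightarrow> (\<exists>c b. solves k c b P)"

lemma tdecI:
  assumes "polyb b"
    "\<And>w \<sigma>. inp w \<Longrightarrow> marked w k \<sigma> \<Longrightarrow> exec w c (\<sigma>, 0) (b (length w)) (\<sigma>(k := flag (P w \<sigma>)), 0)"
  shows "tdec k P"
  using assms unfolding tdec_def solves_def by blast

lemma solvesD:
  assumes "solves k c b P"
  shows "polyb b"
    "inp w \<Longrightarrow> marked w k \<sigma> \<Longrightarrow> exec w c (\<sigma>, 0) (b (length w)) (\<sigma>(k := flag (P w \<sigma>)), 0)"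
  using assms unfolding solves_def by blast+

lemma exec_home_Put:
  assumes "inp w" "0 \<le> h" "h \<le> len w"
  shows "exec w (Seq home (Put k)) (\<sigma>, h) (3 * length w + 7) (\<sigma>(k := insert 0 (\<sigma> k)), 0)"
  by (rule exec_mono[OF exec_Seq[OF exec_home[OF assms] exec_prim(3)]]) simp

lemma tdec_nav:
  assumes "nav c f"
  shows "tdec k (\<lambda>w \<sigma>. T (base w (f w \<sigma> 0)) (\<lambda>i. f w \<sigma> 0 \<in> \<sigma> i))"
proof -
  obtain b where b: "polyb b" "\<And>w \<sigma> h. inp w \<Longrightarrow> 0 \<le> h \<Longrightarrow> h \<le> len w \<Longrightarrow>
     exec w c (\<sigma>, h) (b (length w)) (\<sigma>, f w \<sigma> h) \<and> 0 \<le> f w \<sigma> h \<and> f w \<sigma> h \<le> len w"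
    using assms unfolding nav_def by blast
  show ?thesis
  proof (rule tdecI)
    show "polyb (\<lambda>n. b n + ((3 * n + 7) + 1) + 1)" by (intro polyb_intros b)
    fix w :: "nat list" and \<sigma> assume w: "inp w" "marked w k \<sigma>"
    note c = b(2)[OF w(1), of 0 \<sigma>]
    have k: "\<sigma> k = {}" using w marked_triv by blast
    have "exec w home (\<sigma>, f w \<sigma> 0) (3 * length w + 7) (\<sigma>, 0)"
      by (rule exec_mono[OF exec_home]) (use w c in auto)
    then show "exec w (Seq c (If T (Seq home (Put k)) home)) (\<sigma>, 0) (b (length w) + ((3 * length w + 7) + 1) + 1)
      (\<sigma>(k := flag (T (base w (f w \<sigma> 0)) (\<lambda>i. f w \<sigma> 0 \<in> \<sigma> i))), 0)"
      using c k exec_home_Put[OF w(1), of "f w \<sigma> 0" k \<sigma>]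
      by (intro exec_Seq[of w c _ _ "(\<sigma>, f w \<sigma> 0)"] exec_If) (auto simp: fun_upd_idem)
  qed
qed

lemma tdec_not:
  assumes "tdec k P"
  shows "tdec k (\<lambda>w \<sigma>. \<not> P w \<sigma>)"
proof -
  obtain c b where c0: "solves k c b P"
    using assms unfolding tdec_def by blast
  note c = solvesD[OF c0]
  show ?thesis
  proof (rule tdecI)
    show "polyb (\<lambda>n. b n + (1 + 1) + 1)" by (intro polyb_intros c)
    fix w :: "nat list" and \<sigma> assume w: "inp w" "marked w k \<sigma>"
    show "exec w (Seq c (If (\<lambda>a B. B k) (Clr k) (Put k))) (\<sigma>, 0) (b (length w) + (1 + 1) + 1)
      (\<sigma>(k := flag (\<not> P w \<sigma>)), 0)"
      using exec_prim(3)[of w k "\<sigma>(k := flag (P w \<sigma>))" 0] exec_prim(4)[of w k "\<sigma>(k := flag (P w \<sigma>))" 0]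
      by (intro exec_Seq[OF c(2)[OF w]] exec_If) auto
  qed
qed

text \<open>The second program requires empty scratch tracks, so a raised flag of the first is
  erased before. If the first condition fails, its empty flag is already the answer.\<close>

lemma tdec_and:
  assumes "tdec k P" "tdec k Q"
  shows "tdec k (\<lambda>w \<sigma>. P w \<sigma> \<and> Q w \<sigma>)"
proof -
  obtain c b where c0: "solves k c b P"
    using assms(1) unfolding tdec_def by blast
  note c = solvesD[OF c0]
  obtain d b' where d: "polyb b'"
    "\<And>w \<sigma>. inp w \<Longrightarrow> marked w k \<sigma> \<Longrightarrow> exec w d (\<sigma>, 0) (b' (length w)) (\<sigma>(k := flag (Q w \<sigma>)), 0)"
    using assms(2) unfolding tdec_def solves_def by blast
  show ?thesis
  proof (rule tdecI)
    show "polyb (\<lambda>n. b n + ((1 + b' n + 1) + 1) + 1)" by (intro polyb_intros c d)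
    fix w :: "nat list" and \<sigma> assume w: "inp w" "marked w k \<sigma>"
    have k: "\<sigma>(k := {}) = \<sigma>" using w marked_triv by (simp add: fun_upd_idem)
    have "exec w (Clr k) (\<sigma>(k := flag (P w \<sigma>)), 0) 1 (\<sigma>, 0)"
      using exec_prim(4)[of w k "\<sigma>(k := flag (P w \<sigma>))" 0] k by simp
    from exec_Seq[OF this d(2)[OF w]]
    have "exec w (Seq (Clr k) d) (\<sigma>(k := flag (P w \<sigma>)), 0) (1 + b' (length w) + 1) (\<sigma>(k := flag (Q w \<sigma>)), 0)" .
    then show "exec w (Seq c (If (\<lambda>a B. B k) (Seq (Clr k) d) Skip)) (\<sigma>, 0)
      (b (length w) + ((1 + b' (length w) + 1) + 1) + 1) (\<sigma>(k := flag (P w \<sigma> \<and> Q w \<sigma>)), 0)"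
      by (intro exec_Seq[OF c(2)[OF w]] exec_If) (auto intro: exec_Skip)
  qed
qed

section \<open>Bounded search and existential quantification\<close>

definition first :: "nat list \<Rightarrow> (int \<Rightarrow> bool) \<Rightarrow> int set" where
  "first w Q = {p. 0 \<le> p \<and> p \<le> len w \<and> Q p \<and> (\<forall>q. 0 \<le> q \<longrightarrow> q < p \<longrightarrow> \<not> Q q)}"

lemma first_eqI:
  assumes "0 \<le> p" "p \<le> len w" "Q p" "\<And>q. 0 \<le> q \<Longrightarrow> q < p \<Longrightarrow> \<not> Q q"
  shows "first w Q = {p}"
proof -
  have "q = p" if "q \<in> first w Q" for q
    using that assms by (cases q p rule: linorder_cases) (auto simp: first_def)
  moreover have "p \<in> first w Q" using assms by (simp add: first_def)
  ultimately show ?thesis by blast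
qed

lemma first_cases:
  obtains "first w Q = {}" "\<And>p. 0 \<le> p \<Longrightarrow> p \<le> len w \<Longrightarrow> \<not> Q p"
  | p where "first w Q = {p}" "0 \<le> p" "p \<le> len w" "Q p"
proof (cases "\<exists>p. 0 \<le> p \<and> p \<le> len w \<and> Q p")
  case True
  then obtain p where "0 \<le> p" "p \<le> len w" "Q p" by blast
  then have ex: "Q (int (nat p))" "nat p \<le> length w" by auto
  define m where "m = (LEAST n. Q (int n))"
  have m: "Q (int m)" "m \<le> length w"
    using LeastI[of "\<lambda>n. Q (int n)", OF ex(1)] Least_le[of "\<lambda>n. Q (int n)", OF ex(1)] ex(2)
    by (auto simp: m_def)
  have less: "\<not> Q q" if "0 \<le> q" "q < int m" for q
  proof -
    have "nat q < (LEAST n. Q (int n))" using that unfolding m_def by linarith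
    then have "\<not> Q (int (nat q))" by (rule not_less_Least)
    then show ?thesis using that(1) by simp
  qed
  have "first w Q = {int m}" using m less by (intro first_eqI) auto
  then show ?thesis using that(2) m by simp
next
  case False
  then show ?thesis using that(1) by (auto simp: first_def)
qed

lemma first_subset: "first w Q \<subseteq> {0..len w}"
  by (auto simp: first_def)

text \<open>The flag that \<open>c\<close> leaves on track \<open>Suc k\<close> of the home cell also ends the loop, so that the
  pointer on track \<open>k\<close> stays at the position found.\<close>
definition search :: "nat \<Rightarrow> cmd \<Rightarrow> cmd" where
  "search k c = Seq (Put k) (Seq c (Seq
     (While (\<lambda>a B. \<not> B (Suc k))
       (Seq (goR (\<lambda>a B. B k))
         (If (\<lambda>a B. a = 0)
           (Seq (Clr k) (Seq home (Put (Suc k))))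
           (Seq (Clr k) (Seq MvR (Seq (Put k) (Seq home c)))))))
     (Clr (Suc k))))"

lemma sweep_single:
  assumes "inp w" "0 \<le> p" "p \<le> len w"
  shows "sweep w (\<lambda>i. i \<in> {p}) 0 = p"
  using assms by (intro sweep_eqI) (auto simp: base_eq_0)

lemma exec_goto:
  assumes "inp w" "0 \<le> p" "p \<le> len w" "\<sigma> k = {p}"
  shows "exec w (goR (\<lambda>a B. B k)) (\<sigma>, 0) (3 * length w + 1) (\<sigma>, p)"
  using exec_goR[OF assms(1), of 0 "\<lambda>a B. B k" \<sigma>] sweep_single[OF assms(1-3)] assms(4) by simp

lemma exec_goto_If:
  assumes "inp w" "0 \<le> p" "p \<le> len w" "\<sigma> k = {p}"
    and "T (base w p) (\<lambda>i. p \<in> \<sigma> i) \<Longrightarrow> exec w c (\<sigma>, p) t s"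
    and "\<not> T (base w p) (\<lambda>i. p \<in> \<sigma> i) \<Longrightarrow> exec w d (\<sigma>, p) t s"
  shows "exec w (Seq (goR (\<lambda>a B. B k)) (If T c d)) (\<sigma>, 0) ((3 * length w + 1) + (t + 1) + 1) s"
  using exec_goto[of w p \<sigma> k] assms(1-4) exec_If[of T w p \<sigma> c t s d, OF assms(5,6)]
  by (intro exec_Seq[of w "goR (\<lambda>a B. B k)" _ _ "(\<sigma>, p)"])

lemma exec_search:
  assumes c: "\<And>\<sigma>. marked w (Suc k) \<sigma> \<Longrightarrow> exec w c (\<sigma>, 0) t (\<sigma>(Suc k := flag (P \<sigma>)), 0)"
    and w: "inp w" "marked w k \<sigma>"
  shows "exec w (search k c) (\<sigma>, 0) ((length w + 2) * (t + 6 * length w + 30))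
    (\<sigma>(k := first w (\<lambda>p. P (\<sigma>(k := {p})))), 0)"
proof -
  let ?N = "length w"
  let ?T = "\<lambda>a B. \<not> B (Suc k)"
  let ?X = "first w (\<lambda>p. P (\<sigma>(k := {p})))"
  let ?body = "Seq (goR (\<lambda>a B. B k)) (If (\<lambda>a B. a = 0)
           (Seq (Clr k) (Seq home (Put (Suc k))))
           (Seq (Clr k) (Seq MvR (Seq (Put k) (Seq home c)))))"
  let ?L = "While ?T ?body"
  let ?m = "t + 6 * ?N + 30"
  let ?s = "\<lambda>p. \<sigma>(k := {p}, Suc k := flag (P (\<sigma>(k := {p}))))"
  have em: "\<sigma> k = {}" "\<sigma> (Suc k) = {}" by (simp_all add: marked_triv[OF w(2)])
  \<comment> \<open>Invariant: the pointer is at \<open>p\<close>, the flag tells whether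
    \<open>p\<close> succeeds, and no earlier position does. The number \<open>n\<close> counts the
    positions still to be tried.\<close>
  have loop: "exec w ?L (?s p, 0) ((n + 1) * ?m) (\<sigma>(k := ?X, Suc k := {0}), 0)"
    if "n = nat (len w - p)" "0 \<le> p" "p \<le> len w" "\<And>q. 0 \<le> q \<Longrightarrow> q < p \<Longrightarrow> \<not> P (\<sigma>(k := {q}))" for n p
    using that
  proof (induction n arbitrary: p)
    case (0 p)
    then have p: "p = len w" by simp
    show ?case
    proof (cases "P (\<sigma>(k := {p}))")
      case True
      then have "?X = {p}" using 0 by (intro first_eqI)
      then have "exec w ?L (?s p, 0) 1 (\<sigma>(k := ?X, Suc k := {0}), 0)"
        using exec_While_False[of ?T w 0 "?s p" ?body] True by simp
      then show ?thesis by (rule exec_mono) simp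
    next
      case False
      \<comment> \<open>Even the last position \<open>len w\<close> has failed. The pointer is
        erased, and the flag is raised only to leave the loop.\<close>
      have X: "?X = {}"
      proof -
        have "\<not> P (\<sigma>(k := {q}))" if "0 \<le> q" "q \<le> len w" for q
        proof (cases "q = p")
          case True
          then show ?thesis using False by (simp only: not_False_eq_True)
        next
          case False
          then have "q < p" using that p by linarith
          then show ?thesis by (rule 0(4)[OF that(1)])
        qed
        then show ?thesis by (auto simp: first_def)
      qed
      have z: "base w p = 0" using w p by (simp add: base_eq_0)
      have s: "?s p = \<sigma>(k := {p})" using False em by (simp add: fun_upd_idem)
      have "exec w (Seq (Clr k) (Seq home (Put (Suc k)))) (?s p, p) (1 + (3 * ?N + 7) + 1)
        (\<sigma>(k := {}, Suc k := {0}), 0)"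
        using exec_prim(4)[of w k "?s p" p] exec_home_Put[OF w(1), of p "Suc k" "\<sigma>(k := {})"] 0 em s
        by (intro exec_Seq) auto
      then have "exec w ?body (?s p, 0) ((3 * ?N + 1) + ((1 + (3 * ?N + 7) + 1) + 1) + 1)
        (\<sigma>(k := {}, Suc k := {0}), 0)"
        using 0 w z p by (intro exec_goto_If) auto
      then have "exec w ?L (?s p, 0)
         (((3 * ?N + 1) + ((1 + (3 * ?N + 7) + 1) + 1) + 1) + 1 + 2)
         (\<sigma>(k := {}, Suc k := {0}), 0)"
        using False exec_While_False[of ?T w 0 "\<sigma>(k := {}, Suc k := {0})" ?body]
        by (intro exec_While_True) auto
      then show ?thesis unfolding X by (rule exec_mono) simp
    qed
  next
    case (Suc n p)
    show ?case
    proof (cases "P (\<sigma>(k := {p}))")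
      case True
      then have "?X = {p}" using Suc.prems by (intro first_eqI)
      then have "exec w ?L (?s p, 0) 1 (\<sigma>(k := ?X, Suc k := {0}), 0)"
        using exec_While_False[of ?T w 0 "?s p" ?body] True by simp
      then show ?thesis by (rule exec_mono) simp
    next
      case False
      have z: "base w p \<noteq> 0" using w Suc.prems by (simp add: base_eq_0)
      have s: "?s p = \<sigma>(k := {p})" using False em by (simp add: fun_upd_idem)
      have c': "exec w c (\<sigma>(k := {p + 1}), 0) t (?s (p + 1), 0)"
        using Suc.prems by (intro c marked_upd w) auto
      have IH: "exec w ?L (?s (p + 1), 0) ((n + 1) * ?m) (\<sigma>(k := ?X, Suc k := {0}), 0)"
      proof (rule Suc.IH)
        fix q assume "0 \<le> q" "q < p + 1"
        then have "0 \<le> q \<and> q < p \<or> q = p" by linarith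
        then show "\<not> P (\<sigma>(k := {q}))" using Suc.prems(4) False by blast
      qed (use Suc.prems in auto)
      have "exec w (Seq (Clr k) (Seq MvR (Seq (Put k) (Seq home c)))) (?s p, p)
        (1 + (1 + (1 + ((3 * ?N + 5) + t + 1) + 1) + 1) + 1) (?s (p + 1), 0)"
        using exec_prim(4)[of w k "?s p" p] exec_prim(2)[of w "\<sigma>(k := {})" p]
          exec_prim(3)[of w k "\<sigma>(k := {})" "p + 1"] s c' exec_home[OF w(1), of "p + 1" "\<sigma>(k := {p + 1})"]
          Suc.prems
        by (intro exec_Seq) auto
      then have "exec w ?body (?s p, 0)
         ((3 * ?N + 1) + ((1 + (1 + (1 + ((3 * ?N + 5) + t + 1) + 1) + 1) + 1) + 1) + 1) (?s (p + 1), 0)"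
        using Suc.prems w z by (intro exec_goto_If) auto
      then have "exec w ?L (?s p, 0)
         (((3 * ?N + 1) + ((1 + (1 + (1 + ((3 * ?N + 5) + t + 1) + 1) + 1) + 1) + 1) + 1) + (n + 1) * ?m + 2)
         (\<sigma>(k := ?X, Suc k := {0}), 0)"
        using False IH by (intro exec_While_True) auto
      then show ?thesis by (rule exec_mono) (simp add: algebra_simps)
    qed
  qed
  have "exec w c (\<sigma>(k := {0}), 0) t (?s 0, 0)" by (intro c marked_upd w) auto
  moreover have "exec w ?L (?s 0, 0) ((?N + 1) * ?m) (\<sigma>(k := ?X, Suc k := {0}), 0)"
    using loop[OF refl, of 0] by simp
  moreover have "exec w (Put k) (\<sigma>, 0) 1 (\<sigma>(k := {0}), 0)" using exec_prim(3)[of w k \<sigma> 0] em by simp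
  moreover have "exec w (Clr (Suc k)) (\<sigma>(k := ?X, Suc k := {0}), 0) 1 (\<sigma>(k := ?X), 0)"
    using exec_prim(4)[of w "Suc k" "\<sigma>(k := ?X, Suc k := {0})" 0] em
    by (simp add: fun_upd_idem)
  ultimately have "exec w (search k c) (\<sigma>, 0) (1 + (t + ((?N + 1) * ?m + 1 + 1) + 1) + 1) (\<sigma>(k := ?X), 0)"
    unfolding search_def by (intro exec_Seq)
  then show ?thesis by (rule exec_mono) (simp add: algebra_simps)
qed

lemma exec_goto_none:
  assumes "inp w" "\<sigma> k = {}"
  shows "exec w (goR (\<lambda>a B. B k)) (\<sigma>, 0) (3 * length w + 1) (\<sigma>, len w)"
proof -
  have "sweep w (\<lambda>i. False) 0 = len w" using assms by (intro sweep_eqI) (auto simp: base_eq_0)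
  then show ?thesis using exec_goR[OF assms(1), of 0 "\<lambda>a B. B k" \<sigma>] assms(2) by simp
qed

lemma exec_goto_none_If:
  assumes "inp w" "\<sigma> k = {}"
    and "T 0 (\<lambda>i. len w \<in> \<sigma> i) \<Longrightarrow> exec w c (\<sigma>, len w) t s"
    and "\<not> T 0 (\<lambda>i. len w \<in> \<sigma> i) \<Longrightarrow> exec w d (\<sigma>, len w) t s"
  shows "exec w (Seq (goR (\<lambda>a B. B k)) (If T c d)) (\<sigma>, 0) ((3 * length w + 1) + (t + 1) + 1) s"
proof -
  have "base w (len w) = 0" using assms(1) by (simp add: base_eq_0)
  then show ?thesis
    using exec_goto_none[of w \<sigma> k] assms(1,2) exec_If[of T w "len w" \<sigma> c t s d] assms(3,4)
    by (intro exec_Seq[of w "goR (\<lambda>a B. B k)" _ _ "(\<sigma>, len w)"]) simp_all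
qed

text \<open>After the search the pointer itself is the verdict. A sweep towards it ends at
  \<open>len w\<close> both if there is no pointer and if \<open>len w\<close> is the witness, so
  the mark is tested again where the head stops.\<close>

lemma tdec_ex:
  assumes "tdec (Suc k) P"
  shows "tdec k (\<lambda>w \<sigma>. \<exists>p. 0 \<le> p \<and> p \<le> len w \<and> P w (\<sigma>(k := {p})))"
proof -
  obtain c b where c0: "solves (Suc k) c b P"
    using assms unfolding tdec_def by blast
  note c = solvesD[OF c0]
  let ?b = "\<lambda>n. (n + 2) * (b n + 6 * n + 30)"
  show ?thesis
  proof (rule tdecI)
    show "polyb (\<lambda>n. ?b n + ((3 * n + 1) + ((1 + (3 * n + 7) + 1) + 1) + 1) + 1)" by (intro polyb_intros c)
    fix w :: "nat list" and \<sigma> assume w: "inp w" "marked w k \<sigma>"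
    let ?N = "length w"
    let ?Q = "\<lambda>p. P w (\<sigma>(k := {p}))"
    let ?X = "first w ?Q"
    have s: "exec w (search k c) (\<sigma>, 0) (?b (?N)) (\<sigma>(k := ?X), 0)"
      using exec_search[of w k c "b (?N)" "P w", OF c(2) w] w(1) by blast
    have k: "\<sigma>(k := {}) = \<sigma>" using w marked_triv by (simp add: fun_upd_idem)
    have "exec w (Seq (goR (\<lambda>a B. B k)) (If (\<lambda>a B. B k) (Seq (Clr k) (Seq home (Put k))) home))
      (\<sigma>(k := ?X), 0) ((3 * ?N + 1) + ((1 + (3 * ?N + 7) + 1) + 1) + 1)
      (\<sigma>(k := flag (\<exists>p. 0 \<le> p \<and> p \<le> len w \<and> ?Q p)), 0)"
    proof (cases rule: first_cases[of w ?Q])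
      case 1
      have "exec w home (\<sigma>, len w) (1 + (3 * ?N + 7) + 1) (\<sigma>, 0)"
        by (rule exec_mono[OF exec_home]) (use w in auto)
      moreover have "flag (\<exists>p. 0 \<le> p \<and> p \<le> len w \<and> ?Q p) = {}" using 1 by (auto simp: flag_def)
      moreover have "\<sigma> k = {}" using w marked_triv by blast
      ultimately show ?thesis unfolding 1(1) using w k
        by (intro exec_goto_none_If) (auto simp: k)
    next
      case (2 p)
      then have "flag (\<exists>p. 0 \<le> p \<and> p \<le> len w \<and> ?Q p) = {0}" by (auto simp: flag_def)
      moreover have "exec w (Seq (Clr k) (Seq home (Put k))) (\<sigma>(k := {p}), p) (1 + (3 * ?N + 7) + 1) (\<sigma>(k := {0}), 0)"
        using exec_prim(4)[of w k "\<sigma>(k := {p})" p] exec_home_Put[OF w(1), of p k \<sigma>] 2 k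
        by (intro exec_Seq) (auto simp: marked_triv[OF w(2)])
      ultimately show ?thesis unfolding 2(1) using 2 w
        by (intro exec_goto_If) auto
    qed
    from exec_Seq[OF s this]
    show "exec w (Seq (search k c) (Seq (goR (\<lambda>a B. B k)) (If (\<lambda>a B. B k) (Seq (Clr k) (Seq home (Put k))) home)))
      (\<sigma>, 0) (?b (?N) + ((3 * ?N + 1) + ((1 + (3 * ?N + 7) + 1) + 1) + 1) + 1)
      (\<sigma>(k := flag (\<exists>p. 0 \<le> p \<and> p \<le> len w \<and> ?Q p)), 0)" .
  qed
qed

section \<open>Inflationary fixed points of position sets\<close>

definition grow :: "nat list \<Rightarrow> (int set \<Rightarrow> int \<Rightarrow> bool) \<Rightarrow> int set \<Rightarrow> int set" where
  "grow w R X = X \<union> first w (\<lambda>p. p \<notin> X \<and> R X p)"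

text \<open>The first stationary iterate from the empty set. Rules are not assumed monotone, so this
  is an inflationary fixed point rather than a least one; for \<open>grow\<close> the minimum exists
  by \<open>grow_stabilises\<close>.\<close>

definition stab :: "('a set \<Rightarrow> 'a set) \<Rightarrow> 'a set" where
  "stab f = (f ^^ (LEAST m. f ((f ^^ m) {}) = (f ^^ m) {})) {}"

lemma grow_iter_subset: "(grow w R ^^ m) {} \<subseteq> {0..len w}"
  by (induction m) (use first_subset in \<open>auto simp: grow_def\<close>)

text \<open>Every round that is not stationary adds a position, and only \<open>length w + 1\<close>
  positions are available.\<close>

lemma grow_stabilises:
  "\<exists>m \<le> length w + 1. grow w R ((grow w R ^^ m) {}) = (grow w R ^^ m) {}"
proof (rule ccontr)
  let ?g = "grow w R"
  assume a: "\<not> ?thesis"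
  have fin: "finite ((?g ^^ m) {})" for m
    using finite_subset[OF grow_iter_subset] by blast
  have "m \<le> card ((?g ^^ m) {})" if "m \<le> length w + 2" for m
    using that
  proof (induction m)
    case (Suc m)
    have "?g ((?g ^^ m) {}) \<noteq> (?g ^^ m) {}" using a Suc.prems by auto
    then have "(?g ^^ m) {} \<subset> (?g ^^ Suc m) {}" by (auto simp: grow_def)
    from psubset_card_mono[OF fin this] have "card ((?g ^^ m) {}) < card ((?g ^^ Suc m) {})" .
    moreover have "m \<le> card ((?g ^^ m) {})" using Suc.IH Suc.prems by linarith
    ultimately show ?case by linarith
  qed simp
  moreover have "card ((?g ^^ m) {}) \<le> length w + 1" for m
    using card_mono[OF _ grow_iter_subset[of m w R]] by simp
  ultimately have "length w + 2 \<le> length w + 1" using order_trans by blast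
  then show False by simp
qed

lemma stab_grow:
  obtains m where "m \<le> length w + 1" "stab (grow w R) = (grow w R ^^ m) {}"
    "grow w R (stab (grow w R)) = stab (grow w R)"
proof -
  let ?Q = "\<lambda>m. grow w R ((grow w R ^^ m) {}) = (grow w R ^^ m) {}"
  obtain n where n: "n \<le> length w + 1" "?Q n" using grow_stabilises by blast
  have "?Q (LEAST m. ?Q m)" using n(2) by (rule LeastI)
  moreover have "(LEAST m. ?Q m) \<le> length w + 1" using n Least_le[of ?Q n] by linarith
  ultimately show ?thesis by (intro that[of "LEAST m. ?Q m"]) (simp_all add: stab_def)
qed

lemma exec_home_Put':
  assumes "inp w" "0 \<le> h" "h \<le> len w" "\<sigma> k = {}"
  shows "exec w (Seq home (Put k)) (\<sigma>, h) (3 * length w + 7) (\<sigma>(k := {0}), 0)"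
  using exec_home_Put[OF assms(1-3), of k \<sigma>] assms(4) by simp

text \<open>One round on track \<open>k\<close>. Track \<open>Suc k\<close> first carries the
  pointer to the new element and afterwards the flag that the set has changed, which controls the
  fixed point loop.\<close>

definition add_next :: "nat \<Rightarrow> cmd \<Rightarrow> cmd" where
  "add_next k c = Seq (search (Suc k) c) (Seq (goR (\<lambda>a B. B (Suc k)))
     (If (\<lambda>a B. B (Suc k)) (Seq (Clr (Suc k)) (Seq (Put k) (Seq home (Put (Suc k))))) home))"

lemma exec_add_next:
  assumes c: "\<And>\<sigma>. marked w (Suc (Suc k)) \<sigma> \<Longrightarrow> exec w c (\<sigma>, 0) t (\<sigma>(Suc (Suc k) := flag (P \<sigma>)), 0)"
    and w: "inp w" "marked w k \<sigma>" "X \<subseteq> {0..len w}"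
    and P: "\<And>\<sigma> p. \<sigma> k \<subseteq> {0..len w} \<Longrightarrow> p \<in> \<sigma> k \<Longrightarrow> \<not> P (\<sigma>(Suc k := {p}))"
    and g: "g = grow w (\<lambda>X p. P (\<sigma>(k := X, Suc k := {p})))"
  shows "exec w (add_next k c) (\<sigma>(k := X), 0) ((length w + 3) * (t + 6 * length w + 30))
    (\<sigma>(k := g X, Suc k := flag (g X \<noteq> X)), 0)"
proof -
  let ?N = "length w"
  let ?Q = "\<lambda>p. P (\<sigma>(k := X, Suc k := {p}))"
  have Suc_k: "\<sigma> (Suc k) = {}" using w(2) by (simp add: marked_triv)
  then have upd: "\<sigma>(k := Y, Suc k := {}) = \<sigma>(k := Y)" for Y by (simp add: fun_upd_idem)
  \<comment> \<open>The program searches for \<open>P\<close> alone; elements already in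
    \<open>X\<close> are ruled out by the hypothesis on \<open>P\<close>.\<close>
  have gX: "g X = X \<union> first w ?Q"
  proof -
    have "p \<notin> X \<and> ?Q p \<longleftrightarrow> ?Q p" for p using P[of "\<sigma>(k := X)" p] w(3) by auto
    then show ?thesis by (simp add: g grow_def)
  qed
  have 1: "exec w (search (Suc k) c) (\<sigma>(k := X), 0) ((?N + 2) * (t + 6 * ?N + 30))
     (\<sigma>(k := X, Suc k := first w ?Q), 0)"
    using c by (intro exec_search marked_upd w)
  have 2: "exec w (Seq (goR (\<lambda>a B. B (Suc k)))
     (If (\<lambda>a B. B (Suc k)) (Seq (Clr (Suc k)) (Seq (Put k) (Seq home (Put (Suc k))))) home))
     (\<sigma>(k := X, Suc k := first w ?Q), 0)
     ((3 * ?N + 1) + ((1 + (1 + (3 * ?N + 7) + 1) + 1) + 1) + 1)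
     (\<sigma>(k := g X, Suc k := flag (g X \<noteq> X)), 0)"
  proof (cases rule: first_cases[of w ?Q])
    case 1
    have "exec w home (\<sigma>(k := X), len w) (1 + (1 + (3 * ?N + 7) + 1) + 1) (\<sigma>(k := X), 0)"
      by (rule exec_mono[OF exec_home]) (use w in auto)
    then show ?thesis unfolding gX 1(1) using w Suc_k
      by (intro exec_goto_none_If) (auto simp: upd)
  next
    case (2 p)
    have "p \<notin> X" using 2(4) P[of "\<sigma>(k := X)" p] w(3) by auto
    then have "insert p X \<noteq> X" by blast
    then have gX': "g X = insert p X" "flag (g X \<noteq> X) = {0}" using 2(1) gX by (auto simp: flag_def)
    have "exec w (Clr (Suc k)) (\<sigma>(k := X, Suc k := {p}), p) 1 (\<sigma>(k := X), p)"
      using exec_prim(4)[of w "Suc k" "\<sigma>(k := X, Suc k := {p})" p] by (simp add: upd)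
    moreover have "exec w (Put k) (\<sigma>(k := X), p) 1 (\<sigma>(k := g X), p)"
      using exec_prim(3)[of w k "\<sigma>(k := X)" p] by (simp add: gX')
    moreover have "exec w (Seq home (Put (Suc k))) (\<sigma>(k := g X), p) (3 * ?N + 7)
       (\<sigma>(k := g X, Suc k := {0}), 0)"
      using w 2 Suc_k by (intro exec_home_Put') auto
    ultimately have "exec w (Seq (Clr (Suc k)) (Seq (Put k) (Seq home (Put (Suc k)))))
       (\<sigma>(k := X, Suc k := {p}), p) (1 + (1 + (3 * ?N + 7) + 1) + 1) (\<sigma>(k := g X, Suc k := {0}), 0)"
      by (blast intro: exec_Seq)
    then show ?thesis unfolding gX'(2) 2(1) using 2 w by (intro exec_goto_If[of w p]) auto
  qed
  show ?thesis unfolding add_next_def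
    by (rule exec_mono[OF exec_Seq[OF 1 2]]) (simp add: algebra_simps)
qed

text \<open>The loop stops at the first blank without clearing it, but cell \<open>len w\<close> may
  carry a mark as well; the second \<open>Clr k\<close> takes care of it.\<close>

definition erase :: "nat \<Rightarrow> cmd" where
  "erase k = Seq (While (\<lambda>a B. a \<noteq> 0) (Seq (Clr k) MvR)) (Seq (Clr k) home)"

lemma exec_erase:
  assumes "inp w" "X \<subseteq> {0..len w}"
  shows "exec w (erase k) (\<sigma>(k := X), 0) (8 * length w + 20) (\<sigma>(k := {}), 0)"
proof -
  let ?T = "\<lambda>a (B :: nat \<Rightarrow> bool). a \<noteq> 0"
  have "exec w (While ?T (Seq (Clr k) MvR)) (\<sigma>(k := Y), h) (5 * n + 1) (\<sigma>(k := Y \<inter> {len w}), len w)"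
    if "n = nat (len w - h)" "0 \<le> h" "h \<le> len w" "Y \<subseteq> {h..len w}" for n h Y
    using that
  proof (induction n arbitrary: h Y)
    case 0
    then have h: "h = len w" and Y: "Y \<inter> {len w} = Y" by auto
    have "\<not> base w h \<noteq> 0" using assms h by (simp add: base_eq_0)
    from exec_While_False[of ?T w h "\<sigma>(k := Y)", OF this]
    show ?case unfolding Y h by (simp only: mult_0_right add_0)
  next
    case (Suc n)
    have b: "base w h \<noteq> 0" using Suc.prems assms by (simp add: base_eq_0)
    have "exec w (Clr k) (\<sigma>(k := Y), h) 1 (\<sigma>(k := Y - {h}), h)"
      using exec_prim(4)[of w k "\<sigma>(k := Y)" h] by simp
    then have s: "exec w (Seq (Clr k) MvR) (\<sigma>(k := Y), h) (1 + 1 + 1) (\<sigma>(k := Y - {h}), h + 1)"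
      using exec_prim(2) by (rule exec_Seq)
    have "exec w (While ?T (Seq (Clr k) MvR)) (\<sigma>(k := Y - {h}), h + 1) (5 * n + 1)
       (\<sigma>(k := (Y - {h}) \<inter> {len w}), len w)"
      using Suc.prems by (intro Suc.IH) fastforce+
    moreover have "(Y - {h}) \<inter> {len w} = Y \<inter> {len w}" using Suc.prems by auto
    ultimately have "exec w (While ?T (Seq (Clr k) MvR)) (\<sigma>(k := Y), h) (1 + 1 + 1 + (5 * n + 1) + 2)
       (\<sigma>(k := Y \<inter> {len w}), len w)"
      using b s by (intro exec_While_True) auto
    then show ?case by (rule exec_mono) simp
  qed
  from this[OF refl, of 0 X] assms(2)
  have 1: "exec w (While ?T (Seq (Clr k) MvR)) (\<sigma>(k := X), 0) (5 * length w + 1) (\<sigma>(k := X \<inter> {len w}), len w)"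
    by simp
  have 2: "exec w (Clr k) (\<sigma>(k := X \<inter> {len w}), len w) 1 (\<sigma>(k := {}), len w)"
  proof -
    have "X \<inter> {len w} - {len w} = {}" by blast
    with exec_prim(4)[of w k "\<sigma>(k := X \<inter> {len w})" "len w"] show ?thesis
      by (simp only: fun_upd_same fun_upd_upd)
  qed
  have 3: "exec w home (\<sigma>(k := {}), len w) (3 * length w + 5) (\<sigma>(k := {}), 0)"
    using assms by (intro exec_home) auto
  show ?thesis unfolding erase_def
    by (rule exec_mono[OF exec_Seq[OF 1 exec_Seq[OF 2 3]]]) simp
qed

definition move_flag :: "nat \<Rightarrow> nat \<Rightarrow> cmd" where
  "move_flag j k = If (\<lambda>a B. B j) (Seq (Clr j) (Put k)) Skip"

lemma exec_move_flag:
  assumes "\<sigma> j = {}" "\<sigma> k = {}" "j \<noteq> k"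
  shows "exec w (move_flag j k) (\<sigma>(j := flag b), 0) 4 (\<sigma>(k := flag b), 0)"
proof -
  have s: "\<sigma>(j := {}) = \<sigma>" "\<sigma>(k := {}) = \<sigma>" using assms by (simp_all add: fun_upd_idem)
  have "exec w (Clr j) (\<sigma>(j := {0}), 0) 1 (\<sigma>, 0)"
    using exec_prim(4)[of w j "\<sigma>(j := {0})" 0] s by simp
  moreover have "exec w (Put k) (\<sigma>, 0) 1 (\<sigma>(k := {0}), 0)"
    using exec_prim(3)[of w k \<sigma> 0] assms by simp
  ultimately have "exec w (Seq (Clr j) (Put k)) (\<sigma>(j := {0}), 0) (1 + 1 + 1) (\<sigma>(k := {0}), 0)"
    by (rule exec_Seq)
  then have "exec w (move_flag j k) (\<sigma>(j := flag b), 0) ((1 + 1 + 1) + 1) (\<sigma>(k := flag b), 0)"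
    unfolding move_flag_def using s assms by (cases b; intro exec_If) (auto intro: exec_Skip)
  then show ?thesis by (rule exec_mono) simp
qed

text \<open>Track \<open>k\<close> holds the growing set and track \<open>Suc k\<close> the
  candidate. The condition \<open>Q\<close> is evaluated on the final set, which is then erased to
  make room for the verdict on track \<open>k\<close>.\<close>

lemma tdec_fix:
  assumes "tdec (Suc (Suc k)) P" "tdec (Suc k) Q"
    and notin: "\<And>w \<sigma> p. inp w \<Longrightarrow> \<sigma> k \<subseteq> {0..len w} \<Longrightarrow> p \<in> \<sigma> k \<Longrightarrow> \<not> P w (\<sigma>(Suc k := {p}))"
  shows "tdec k (\<lambda>w \<sigma>. Q w (\<sigma>(k := stab (grow w (\<lambda>X p. P w (\<sigma>(k := X, Suc k := {p})))))))"
proof -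
  obtain c b where c0: "solves (Suc (Suc k)) c b P"
    using assms(1) unfolding tdec_def by blast
  note c = solvesD[OF c0]
  obtain d b' where d: "polyb b'" "\<And>w \<sigma>. inp w \<Longrightarrow> marked w (Suc k) \<sigma> \<Longrightarrow>
      exec w d (\<sigma>, 0) (b' (length w)) (\<sigma>(Suc k := flag (Q w \<sigma>)), 0)"
    using assms(2) unfolding tdec_def solves_def by blast
  let ?T = "\<lambda>a B. B (Suc k)"
  let ?body = "Seq (Clr (Suc k)) (add_next k c)"
  let ?L = "While ?T ?body"
  let ?t = "\<lambda>n. (n + 3) * (b n + 6 * n + 30)"
  show ?thesis
  proof (rule tdecI)
    show "polyb (\<lambda>n. ?t n + (((n + 1) * (?t n + 4) + 1) + (b' n + ((8 * n + 20) + 4 + 1) + 1) + 1) + 1)"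
      by (intro polyb_intros c d)
    fix w :: "nat list" and \<sigma> assume w: "inp w" "marked w k \<sigma>"
    let ?N = "length w"
    define g where "g = grow w (\<lambda>X p. P w (\<sigma>(k := X, Suc k := {p})))"
    let ?s = "\<lambda>X. \<sigma>(k := g X, Suc k := flag (g X \<noteq> X))"
    have em: "\<sigma> k = {}" "\<sigma> (Suc k) = {}" by (simp_all add: marked_triv[OF w(2)])
    have upd: "\<sigma>(k := Y, Suc k := {}) = \<sigma>(k := Y)" for Y using em by (auto simp: fun_eq_iff)
    have upd0: "\<sigma>(k := {}) = \<sigma>" using em by (auto simp: fun_eq_iff)
    have an: "exec w (add_next k c) (\<sigma>(k := X), 0) (?t (?N)) (\<sigma>(k := g X, Suc k := flag (g X \<noteq> X)), 0)"
      if "X \<subseteq> {0..len w}" for X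
      using exec_add_next[of w k c "b (?N)" "P w" \<sigma> X g, OF c(2)[OF w(1)] w that] notin[OF w(1)] g_def by blast
    have g_sub: "g X \<subseteq> {0..len w}" if "X \<subseteq> {0..len w}" for X
      using that first_subset by (auto simp: g_def grow_def)
    \<comment> \<open>Here \<open>m\<close> is any stationary index. The loop may stop earlier, but
      then with the same set.\<close>
    have loop: "exec w ?L (?s X, 0)
        (m * (?t (?N) + 4) + 1) (\<sigma>(k := (g ^^ m) X), 0)"
      if "X \<subseteq> {0..len w}" "g ((g ^^ m) X) = (g ^^ m) X" for m X
      using that
    proof (induction m arbitrary: X)
      case 0
      then have gX: "g X = X" by simp
      have "exec w ?L (\<sigma>(k := X), 0) 1 (\<sigma>(k := X), 0)"
        by (rule exec_While_False) (simp add: em)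
      then have "exec w ?L (?s X, 0) 1 (\<sigma>(k := (g ^^ 0) X), 0)"
        by (simp only: funpow_0 gX simp_thms flag_simps upd)
      then show ?case by (simp only: mult_0 add_0)
    next
      case (Suc m)
      show ?case
      proof (cases "g X = X")
        case True
        then have "(g ^^ n) X = X" for n by (induction n) auto
        then have "(g ^^ Suc m) X = X" .
        moreover have "exec w ?L (?s X, 0) 1 (\<sigma>(k := X), 0)"
          by (simp only: True simp_thms flag_simps upd) (rule exec_While_False, simp add: em)
        ultimately have "exec w ?L (?s X, 0) 1 (\<sigma>(k := (g ^^ Suc m) X), 0)"
          by (simp only:)
        then show ?thesis by (rule exec_mono) simp
      next
        case False
        have "exec w (Clr (Suc k)) (?s X, 0) 1 (\<sigma>(k := g X), 0)"
          using exec_prim(4)[of w "Suc k" "\<sigma>(k := g X, Suc k := flag (g X \<noteq> X))" 0] em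
          by (simp add: upd)
        from exec_Seq[OF this an[OF g_sub[OF Suc.prems(1)]]]
        have s: "exec w ?body (?s X, 0) (1 + ?t (?N) + 1)
           (?s (g X), 0)" .
        have gm: "(g ^^ m) (g X) = (g ^^ Suc m) X" by (simp add: funpow_swap1)
        have l: "exec w ?L (?s (g X), 0)
           (m * (?t (?N) + 4) + 1) (\<sigma>(k := (g ^^ m) (g X)), 0)"
          using Suc.prems gm by (intro Suc.IH g_sub) simp_all
        have "exec w ?L (?s X, 0)
           ((1 + ?t (?N) + 1) + (m * (?t (?N) + 4) + 1) + 2) (\<sigma>(k := (g ^^ m) (g X)), 0)"
          by (rule exec_While_True[OF _ s l]) (use False in simp)
        then show ?thesis unfolding gm by (rule exec_mono) simp
      qed
    qed
    obtain m where m: "m \<le> ?N + 1" "stab g = (g ^^ m) {}" "g (stab g) = stab g"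
      using stab_grow unfolding g_def by blast
    have 1: "exec w (add_next k c) (\<sigma>, 0) (?t (?N)) (?s {}, 0)"
      using an[of "{}"] by (simp only: upd0 empty_subsetI)
    have "exec w ?L (?s {}, 0)
        (m * (?t (?N) + 4) + 1) (\<sigma>(k := stab g), 0)"
      using loop[of "{}" m] m by simp
    then have 2: "exec w ?L (?s {}, 0)
        ((?N + 1) * (?t (?N) + 4) + 1) (\<sigma>(k := stab g), 0)"
      by (rule exec_mono) (use m in \<open>simp only: add_le_cancel_right mult_le_mono1\<close>)
    have sub: "stab g \<subseteq> {0..len w}" using m grow_iter_subset unfolding g_def by metis
    have 3: "exec w d (\<sigma>(k := stab g), 0) (b' (?N))
        (\<sigma>(k := stab g, Suc k := flag (Q w (\<sigma>(k := stab g)))), 0)"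
      using d(2)[OF w(1) marked_upd[OF w(2) sub]] .
    let ?r = "flag (Q w (\<sigma>(k := stab g)))"
    have "exec w (erase k) (\<sigma>(Suc k := ?r, k := stab g), 0) (8 * ?N + 20) (\<sigma>(Suc k := ?r, k := {}), 0)"
      using w sub by (intro exec_erase) auto
    moreover have "\<sigma>(Suc k := ?r, k := stab g) = \<sigma>(k := stab g, Suc k := ?r)" "\<sigma>(Suc k := ?r, k := {}) = \<sigma>(Suc k := ?r)"
      using em by (auto simp: fun_eq_iff)
    ultimately have 4: "exec w (erase k) (\<sigma>(k := stab g, Suc k := ?r), 0) (8 * ?N + 20) (\<sigma>(Suc k := ?r), 0)"
      by simp
    have 5: "exec w (move_flag (Suc k) k) (\<sigma>(Suc k := ?r), 0) 4 (\<sigma>(k := ?r), 0)"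
      using em by (intro exec_move_flag) auto
    show "exec w (Seq (add_next k c) (Seq ?L (Seq d (Seq (erase k) (move_flag (Suc k) k))))) (\<sigma>, 0)
      (?t (?N) + (((?N + 1) * (?t (?N) + 4) + 1) +
         (b' (?N) + ((8 * ?N + 20) + 4 + 1) + 1) + 1) + 1)
      (\<sigma>(k := flag (Q w (\<sigma>(k := stab (grow w (\<lambda>X p. P w (\<sigma>(k := X, Suc k := {p})))))))), 0)"
      unfolding g_def[symmetric]
      by (rule exec_Seq[OF 1 exec_Seq[OF 2 exec_Seq[OF 3 exec_Seq[OF 4 5]]]])
  qed
qed

section \<open>Pointers and the comparison of tokens\<close>

definition pt :: "nat list \<Rightarrow> tracks \<Rightarrow> nat \<Rightarrow> int" where
  "pt w \<sigma> x = sweep w (\<lambda>i. i \<in> \<sigma> x) 0"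

lemma nav_goto: "nav (goR (\<lambda>a B. B x)) (\<lambda>w \<sigma>. sweep w (\<lambda>i. i \<in> \<sigma> x))"
  using nav_goR[of "\<lambda>a B. B x"] .

lemma tdec_False: "tdec k (\<lambda>w \<sigma>. False)"
  using tdec_nav[OF nav_goto, of k "\<lambda>a B. False"] .

lemma tdec_or:
  assumes "tdec k P" "tdec k Q"
  shows "tdec k (\<lambda>w \<sigma>. P w \<sigma> \<or> Q w \<sigma>)"
  using tdec_not[OF tdec_and[OF tdec_not[OF assms(1)] tdec_not[OF assms(2)]]] by simp

lemma tdec_bex:
  "finite A \<Longrightarrow> (\<And>a. a \<in> A \<Longrightarrow> tdec k (P a)) \<Longrightarrow> tdec k (\<lambda>w \<sigma>. \<exists>a\<in>A. P a w \<sigma>)"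
proof (induction rule: finite_induct)
  case (insert a A)
  then show ?case using tdec_or[of k "P a" "\<lambda>w \<sigma>. \<exists>a\<in>A. P a w \<sigma>"] by simp
qed (simp add: tdec_False)

lemma tdec_sym: "tdec k (\<lambda>w \<sigma>. base w (pt w \<sigma> x) \<in> A)"
  unfolding pt_def using tdec_nav[OF nav_goto, of k "\<lambda>a B. a \<in> A"] .

lemma tdec_track: "tdec k (\<lambda>w \<sigma>. pt w \<sigma> x \<in> \<sigma> y)"
  unfolding pt_def using tdec_nav[OF nav_goto, of k "\<lambda>a B. B y"] .

lemma pt_single:
  "inp w \<Longrightarrow> 0 \<le> p \<Longrightarrow> p \<le> len w \<Longrightarrow> \<sigma> x = {p} \<Longrightarrow> pt w \<sigma> x = p"
  unfolding pt_def using sweep_single[of w p] by simp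

definition suf :: "nat list \<Rightarrow> int \<Rightarrow> nat list" where "suf w p = drop (nat p) w"

lemma suf_Cons: "0 \<le> p \<Longrightarrow> p < len w \<Longrightarrow> suf w p = base w p # suf w (p + 1)"
  using Cons_nth_drop_Suc[of "nat p" w] by (simp add: suf_def base_def nat_add_distrib)

lemma suf_end: "suf w (len w) = []"
  by (simp add: suf_def)

definition token :: "nat set \<Rightarrow> nat list \<Rightarrow> int \<Rightarrow> nat list" where
  "token E w p = takeWhile (\<lambda>a. a \<notin> E) (suf w p)"

lemma token_end: "inp w \<Longrightarrow> 0 \<in> E \<Longrightarrow> 0 \<le> p \<Longrightarrow> p \<le> len w \<Longrightarrow> base w p \<in> E \<longleftrightarrow> token E w p = []"
  using suf_Cons[of p w] base_eq_0[of w p] suf_end[of w]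
  by (cases "p = len w") (auto simp: token_def)

lemma token_Cons: "inp w \<Longrightarrow> 0 \<in> E \<Longrightarrow> 0 \<le> p \<Longrightarrow> p \<le> len w \<Longrightarrow> base w p \<notin> E \<Longrightarrow>
    p < len w \<and> token E w p = base w p # token E w (p + 1)"
  using suf_Cons[of p w] base_eq_0[of w p]
  by (cases "p = len w") (auto simp: token_def)

definition advance :: "nat \<Rightarrow> cmd" where
  "advance k = Seq (goR (\<lambda>a B. B k)) (Seq (Clr k) (Seq MvR (Seq (Put k) home)))"

lemma exec_advance:
  assumes "inp w" "0 \<le> p" "p < len w" "\<sigma> k = {p}"
  shows "exec w (advance k) (\<sigma>, 0) (6 * length w + 20) (\<sigma>(k := {p + 1}), 0)"
proof -
  have 1: "exec w (goR (\<lambda>a B. B k)) (\<sigma>, 0) (3 * length w + 1) (\<sigma>, p)"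
    using assms by (intro exec_goto) auto
  have 2: "exec w (Clr k) (\<sigma>, p) 1 (\<sigma>(k := {}), p)" using exec_prim(4)[of w k \<sigma> p] assms(4) by simp
  note 3 = exec_prim(2)[of w "\<sigma>(k := {})" p]
  have 4: "exec w (Put k) (\<sigma>(k := {}), p + 1) 1 (\<sigma>(k := {p + 1}), p + 1)"
    using exec_prim(3)[of w k "\<sigma>(k := {})" "p + 1"] by simp
  have 5: "exec w home (\<sigma>(k := {p + 1}), p + 1) (3 * length w + 5) (\<sigma>(k := {p + 1}), 0)"
    using assms by (intro exec_home) auto
  show ?thesis unfolding advance_def
    by (rule exec_mono[OF exec_Seq[OF 1 exec_Seq[OF 2 exec_Seq[OF 3 exec_Seq[OF 4 5]]]]]) simp
qed

definition discard :: "nat \<Rightarrow> cmd" where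
  "discard k = Seq (goR (\<lambda>a B. B k)) (Seq (Clr k) home)"

lemma exec_discard:
  assumes "inp w" "0 \<le> p" "p \<le> len w" "\<sigma> k = {p}"
  shows "exec w (discard k) (\<sigma>, 0) (6 * length w + 20) (\<sigma>(k := {}), 0)"
proof -
  have 1: "exec w (goR (\<lambda>a B. B k)) (\<sigma>, 0) (3 * length w + 1) (\<sigma>, p)"
    using assms by (intro exec_goto) auto
  have 2: "exec w (Clr k) (\<sigma>, p) 1 (\<sigma>(k := {}), p)" using exec_prim(4)[of w k \<sigma> p] assms(4) by simp
  have 3: "exec w home (\<sigma>(k := {}), p) (3 * length w + 5) (\<sigma>(k := {}), 0)"
    using assms by (intro exec_home) auto
  show ?thesis unfolding discard_def
    by (rule exec_mono[OF exec_Seq[OF 1 exec_Seq[OF 2 3]]]) simp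
qed

lemma exec_drop_pointer:
  assumes "nav c f"
  obtains b where "polyb b" "\<And>w \<sigma> k. inp w \<Longrightarrow> \<sigma> k = {} \<Longrightarrow>
    exec w (Seq c (Seq (Put k) home)) (\<sigma>, 0) (b (length w)) (\<sigma>(k := {f w \<sigma> 0}), 0) \<and>
    0 \<le> f w \<sigma> 0 \<and> f w \<sigma> 0 \<le> len w"
proof -
  obtain b where b: "polyb b" "\<And>w \<sigma> h. inp w \<Longrightarrow> 0 \<le> h \<Longrightarrow> h \<le> len w \<Longrightarrow>
     exec w c (\<sigma>, h) (b (length w)) (\<sigma>, f w \<sigma> h) \<and> 0 \<le> f w \<sigma> h \<and> f w \<sigma> h \<le> len w"
    using assms unfolding nav_def by blast
  show ?thesis
  proof (rule that)
    show "polyb (\<lambda>n. b n + (1 + (3 * n + 5) + 1) + 1)" by (intro polyb_intros b)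
    fix w :: "nat list" and \<sigma> :: tracks and k assume w: "inp w" "\<sigma> k = {}"
    have f: "exec w c (\<sigma>, 0) (b (length w)) (\<sigma>, f w \<sigma> 0)" "0 \<le> f w \<sigma> 0" "f w \<sigma> 0 \<le> len w"
      using b(2)[OF w(1), of 0] by auto
    have 1: "exec w (Put k) (\<sigma>, f w \<sigma> 0) 1 (\<sigma>(k := {f w \<sigma> 0}), f w \<sigma> 0)"
      using exec_prim(3)[of w k \<sigma>] w by simp
    have 2: "exec w home (\<sigma>(k := {f w \<sigma> 0}), f w \<sigma> 0) (3 * length w + 5) (\<sigma>(k := {f w \<sigma> 0}), 0)"
      using w f by (intro exec_home)
    show "exec w (Seq c (Seq (Put k) home)) (\<sigma>, 0) (b (length w) + (1 + (3 * length w + 5) + 1) + 1)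
      (\<sigma>(k := {f w \<sigma> 0}), 0) \<and> 0 \<le> f w \<sigma> 0 \<and> f w \<sigma> 0 \<le> len w"
      using exec_Seq[OF f(1) exec_Seq[OF 1 2]] f by blast
  qed
qed

text \<open>The two tokens are compared by moving two pointers in lockstep.\<close>
lemma tdec_token_eq:
  assumes "nav c f" "nav d g" "0 \<in> E" and g: "\<And>w \<sigma> X h. g w (\<sigma>(k := X)) h = g w \<sigma> h"
  shows "tdec k (\<lambda>w \<sigma>. token E w (f w \<sigma> 0) = token E w (g w \<sigma> 0))"
proof -
  define k1 k2 where "k1 = Suc k" and "k2 = Suc k1"
  \<comment> \<open>A test sees one cell only, so equality of the symbols under two pointers is
    spelled out over the finite alphabet.\<close>
  define P where "P w \<sigma> \<longleftrightarrow> (\<exists>s\<in>{1..5} - E. base w (pt w \<sigma> k) \<in> {s} \<and> base w (pt w \<sigma> k1) \<in> {s})" for w \<sigma>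
  define Q where "Q w \<sigma> \<longleftrightarrow> base w (pt w \<sigma> k) \<in> E \<and> base w (pt w \<sigma> k1) \<in> E" for w \<sigma>
  have "tdec k2 P" unfolding P_def by (intro tdec_bex tdec_and tdec_sym) auto
  then obtain cP bP where cP0: "solves k2 cP bP P"
 unfolding tdec_def by blast
  note cP = solvesD[OF cP0]
  have "tdec k2 Q" unfolding Q_def by (intro tdec_and tdec_sym)
  then obtain cQ bQ where cQ0: "solves k2 cQ bQ Q"
 unfolding tdec_def by blast
  note cQ = solvesD[OF cQ0]
  obtain b1 where b1: "polyb b1" "\<And>w \<sigma> k. inp w \<Longrightarrow> \<sigma> k = {} \<Longrightarrow>
    exec w (Seq c (Seq (Put k) home)) (\<sigma>, 0) (b1 (length w)) (\<sigma>(k := {f w \<sigma> 0}), 0) \<and>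
    0 \<le> f w \<sigma> 0 \<and> f w \<sigma> 0 \<le> len w"
    using exec_drop_pointer[OF assms(1)] by blast
  obtain b2 where b2: "polyb b2" "\<And>w \<sigma> k. inp w \<Longrightarrow> \<sigma> k = {} \<Longrightarrow>
    exec w (Seq d (Seq (Put k) home)) (\<sigma>, 0) (b2 (length w)) (\<sigma>(k := {g w \<sigma> 0}), 0) \<and>
    0 \<le> g w \<sigma> 0 \<and> g w \<sigma> 0 \<le> len w"
    using exec_drop_pointer[OF assms(2)] by blast
  let ?T = "\<lambda>a B. B k2"
  let ?body = "Seq (Clr k2) (Seq (advance k) (Seq (advance k1) cP))"
  let ?L = "While ?T ?body"
  let ?t = "\<lambda>n. 1 + ((6 * n + 20) + ((6 * n + 20) + bP n + 1) + 1) + 1"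
  show ?thesis
  proof (rule tdecI)
    show "polyb (\<lambda>n. b1 n + (b2 n + (bP n + (((n + 1) * (?t n + 2) + 1) + (bQ n +
       ((6 * n + 20) + ((6 * n + 20) + 4 + 1) + 1) + 1) + 1) + 1) + 1) + 1)"
      by (intro polyb_intros b1 b2 cP cQ)
    fix w :: "nat list" and \<sigma> assume w: "inp w" "marked w k \<sigma>"
    let ?N = "length w"
    let ?s = "\<lambda>p q. \<sigma>(k := {p}, k1 := {q})"
    have ne: "k \<noteq> k1" "k1 \<noteq> k2" "k \<noteq> k2" by (simp_all add: k1_def k2_def)
    have em: "\<sigma> k = {}" "\<sigma> k1 = {}" "\<sigma> k2 = {}"
      using w(2) by (simp_all add: marked_triv k1_def k2_def)
    have upd: "(?s p q)(k2 := {}) = ?s p q" for p q using ne em by (auto simp: fun_eq_iff)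
    have mk: "marked w k2 (?s p q)" if "0 \<le> p" "p \<le> len w" "0 \<le> q" "q \<le> len w" for p q
      unfolding k2_def using that k1_def w(2) by (auto simp: marked_def)
    have PQ: "P w (?s p q) \<longleftrightarrow> base w p = base w q \<and> base w p \<notin> E"
      "Q w (?s p q) \<longleftrightarrow> base w p \<in> E \<and> base w q \<in> E"
      if "0 \<le> p" "p \<le> len w" "0 \<le> q" "q \<le> len w" for p q
    proof -
      have p: "pt w (?s p q) k = p" "pt w (?s p q) k1 = q"
        using w that ne by (auto intro: pt_single)
      have "base w p \<in> {1..5}" if "base w p \<noteq> 0"
      proof -
        have "nat p < ?N" using that by (auto simp: base_def split: if_splits)
        then have "w ! nat p \<in> {1..5}" using w(1) nth_mem unfolding inp_def by blast
        then show ?thesis using that by (auto simp: base_def split: if_splits)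
      qed
      moreover have "base w p \<noteq> 0" if "base w p \<notin> E" using that assms(3) by metis
      ultimately show "P w (?s p q) \<longleftrightarrow> base w p = base w q \<and> base w p \<notin> E"
        unfolding P_def p by (simp del: atLeastAtMost_iff) metis
      show "Q w (?s p q) \<longleftrightarrow> base w p \<in> E \<and> base w q \<in> E" unfolding Q_def p ..
    qed
    \<comment> \<open>The loop stops at the first difference or at the end of a token. The tokens
      agree iff both pointers then stand at an end, which is what \<open>Q\<close> tests.\<close>
    have loop: "\<exists>p' q'. exec w ?L ((?s p q)(k2 := flag (P w (?s p q))), 0)
        (n * (?t (?N) + 2) + 1) (?s p' q', 0) \<and>
        0 \<le> p' \<and> p' \<le> len w \<and> 0 \<le> q' \<and> q' \<le> len w \<and>
        (token E w p = token E w q \<longleftrightarrow> Q w (?s p' q'))"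
      if "n = nat (len w - p)" "0 \<le> p" "p \<le> len w" "0 \<le> q" "q \<le> len w" for n p q
      using that
    proof (induction n arbitrary: p q)
      case (0 p q)
      then have p: "p = len w" by simp
      have bp: "base w p \<in> E" using p w(1) assms(3) base_eq_0[of w p] by simp
      then have nP: "\<not> P w (?s p q)" using PQ(1)[of p q] 0 by blast
      have "exec w ?L ((?s p q)(k2 := flag (P w (?s p q))), 0) 1 (?s p q, 0)"
        by (simp only: nP flag_simps upd) (rule exec_While_False, simp add: em ne[symmetric])
      then have "exec w ?L ((?s p q)(k2 := flag (P w (?s p q))), 0)
         (0 * (?t (?N) + 2) + 1) (?s p q, 0)" by (simp only: mult_0 add_0)
      moreover have "token E w p = token E w q \<longleftrightarrow> Q w (?s p q)"
        using PQ(2)[of p q] token_end[OF w(1) assms(3), of p] token_end[OF w(1) assms(3), of q] 0 bp by auto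
      ultimately show ?case using 0 by blast
    next
      case (Suc n p q)
      show ?case
      proof (cases "P w (?s p q)")
        case False
        have "exec w ?L ((?s p q)(k2 := flag (P w (?s p q))), 0) 1 (?s p q, 0)"
          by (simp only: False flag_simps upd) (rule exec_While_False, simp add: em ne[symmetric])
        then have "exec w ?L ((?s p q)(k2 := flag (P w (?s p q))), 0)
           (Suc n * (?t (?N) + 2) + 1) (?s p q, 0)" by (rule exec_mono) simp
        moreover have "token E w p = token E w q \<longleftrightarrow> Q w (?s p q)"
        proof -
          have "base w p \<noteq> base w q \<or> base w p \<in> E" using False PQ(1)[of p q] Suc.prems by blast
          moreover have Qe: "Q w (?s p q) \<longleftrightarrow> base w p \<in> E \<and> base w q \<in> E"
            using PQ(2)[of p q] Suc.prems by blast
          moreover note token_end[OF w(1) assms(3) Suc.prems(2,3)] token_end[OF w(1) assms(3) Suc.prems(4,5)]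
            token_Cons[OF w(1) assms(3) Suc.prems(2,3)] token_Cons[OF w(1) assms(3) Suc.prems(4,5)]
          ultimately show ?thesis by (metis list.inject)
        qed
        ultimately show ?thesis using Suc.prems by blast
      next
        case True
        then have b: "base w p = base w q" "base w p \<notin> E" using PQ(1)[of p q] Suc.prems by auto
        have tp: "p < len w" "token E w p = base w p # token E w (p + 1)"
          "q < len w" "token E w q = base w q # token E w (q + 1)"
          using token_Cons[OF w(1) assms(3), of p] token_Cons[OF w(1) assms(3), of q] b Suc.prems by auto
        let ?u = "(?s p q)(k2 := {0})"
        have 1: "exec w (Clr k2) (?u, 0) 1 (?s p q, 0)"
          using exec_prim(4)[of w k2 ?u 0] by (simp add: upd)
        have 2: "exec w (advance k) (?s p q, 0) (6 * ?N + 20) (?s (p + 1) q, 0)"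
          using exec_advance[of w p "?s p q" k] w tp Suc.prems ne by (simp add: fun_upd_twist)
        have 3: "exec w (advance k1) (?s (p + 1) q, 0) (6 * ?N + 20) (?s (p + 1) (q + 1), 0)"
          using exec_advance[of w q "?s (p + 1) q" k1] w tp Suc.prems ne by simp
        have 4: "exec w cP (?s (p + 1) (q + 1), 0) (bP (?N))
            ((?s (p + 1) (q + 1))(k2 := flag (P w (?s (p + 1) (q + 1)))), 0)"
          using tp Suc.prems by (intro cP(2) w mk) auto
        obtain p' q' where IH: "exec w ?L ((?s (p + 1) (q + 1))(k2 := flag (P w (?s (p + 1) (q + 1)))), 0)
          (n * (?t (?N) + 2) + 1) (?s p' q', 0)"
          "0 \<le> p'" "p' \<le> len w" "0 \<le> q'" "q' \<le> len w"
          "token E w (p + 1) = token E w (q + 1) \<longleftrightarrow> Q w (?s p' q')"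
        proof -
          have "n = nat (len w - (p + 1))" "0 \<le> p + 1" "p + 1 \<le> len w" "0 \<le> q + 1" "q + 1 \<le> len w"
            using Suc.prems tp by auto
          from Suc.IH[OF this] show ?thesis using that by blast
        qed
        have f: "flag (P w (?s p q)) = {0}" using True by simp
        have "exec w ?L (?u, 0) (?t (?N) + (n * (?t (?N) + 2) + 1) + 2) (?s p' q', 0)"
          by (rule exec_While_True[OF _ exec_Seq[OF 1 exec_Seq[OF 2 exec_Seq[OF 3 4]]] IH(1)]) simp
        then have "exec w ?L (?u, 0) (Suc n * (?t (?N) + 2) + 1) (?s p' q', 0)"
          by (rule exec_mono) simp
        moreover have "token E w p = token E w q \<longleftrightarrow> Q w (?s p' q')" using IH(6) tp b by simp
        ultimately show ?thesis unfolding f using IH by blast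
      qed
    qed
    let ?p = "f w \<sigma> 0" and ?q = "g w \<sigma> 0"
    let ?r = "token E w ?p = token E w ?q"
    have 1: "exec w (Seq c (Seq (Put k) home)) (\<sigma>, 0) (b1 (?N)) (\<sigma>(k := {?p}), 0)"
      "0 \<le> ?p" "?p \<le> len w"
      using b1(2)[OF w(1), of \<sigma> k] em by auto
    \<comment> \<open>\<open>d\<close> runs when track \<open>k\<close> already carries the first
      pointer; by the hypothesis on \<open>g\<close> it still reaches the position meant for the
      original tracks.\<close>
    have "exec w (Seq d (Seq (Put k1) home)) (\<sigma>(k := {?p}), 0) (b2 (?N))
        (\<sigma>(k := {?p}, k1 := {g w (\<sigma>(k := {?p})) 0}), 0) \<and> 0 \<le> g w (\<sigma>(k := {?p})) 0 \<and> g w (\<sigma>(k := {?p})) 0 \<le> len w"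
      by (rule b2(2)) (use w em ne in auto)
    then have 2: "exec w (Seq d (Seq (Put k1) home)) (\<sigma>(k := {?p}), 0) (b2 (?N)) (?s ?p ?q, 0)"
      "0 \<le> ?q" "?q \<le> len w" unfolding g by auto
    have 3: "exec w cP (?s ?p ?q, 0) (bP (?N)) ((?s ?p ?q)(k2 := flag (P w (?s ?p ?q))), 0)"
      using 1 2 by (intro cP(2) w mk)
    obtain p' q' where l: "exec w ?L ((?s ?p ?q)(k2 := flag (P w (?s ?p ?q))), 0)
        (nat (len w - ?p) * (?t (?N) + 2) + 1) (?s p' q', 0)"
        "0 \<le> p'" "p' \<le> len w" "0 \<le> q'" "q' \<le> len w" "?r \<longleftrightarrow> Q w (?s p' q')"
      using loop[OF refl 1(2,3) 2(2,3)] by blast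
    have 4: "exec w ?L ((?s ?p ?q)(k2 := flag (P w (?s ?p ?q))), 0)
        ((?N + 1) * (?t (?N) + 2) + 1) (?s p' q', 0)"
      by (rule exec_mono[OF l(1)]) (intro add_le_mono mult_le_mono, use 1 in auto)
    have 5: "exec w cQ (?s p' q', 0) (bQ (?N)) ((?s p' q')(k2 := flag ?r), 0)"
      unfolding l(6) using l by (intro cQ(2) w mk)
    have 6: "exec w (discard k) ((?s p' q')(k2 := flag ?r), 0) (6 * ?N + 20)
        (\<sigma>(k1 := {q'}, k2 := flag ?r), 0)"
    proof -
      have "((?s p' q')(k2 := flag ?r))(k := {}) = \<sigma>(k1 := {q'}, k2 := flag ?r)"
        using ne em by (auto simp: fun_eq_iff)
      then show ?thesis using exec_discard[of w p' "(?s p' q')(k2 := flag ?r)" k] w l ne by simp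
    qed
    have 7: "exec w (discard k1) (\<sigma>(k1 := {q'}, k2 := flag ?r), 0) (6 * ?N + 20) (\<sigma>(k2 := flag ?r), 0)"
    proof -
      have "(\<sigma>(k1 := {q'}, k2 := flag ?r))(k1 := {}) = \<sigma>(k2 := flag ?r)"
        using ne em by (auto simp: fun_eq_iff)
      then show ?thesis using exec_discard[of w q' "\<sigma>(k1 := {q'}, k2 := flag ?r)" k1] w l ne by simp
    qed
    have 8: "exec w (move_flag k2 k) (\<sigma>(k2 := flag ?r), 0) 4 (\<sigma>(k := flag ?r), 0)"
      using em ne by (intro exec_move_flag) auto
    show "exec w (Seq (Seq c (Seq (Put k) home)) (Seq (Seq d (Seq (Put k1) home)) (Seq cP (Seq ?L
       (Seq cQ (Seq (discard k) (Seq (discard k1) (move_flag k2 k)))))))) (\<sigma>, 0)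
       (b1 (?N) + (b2 (?N) + (bP (?N) + (((?N + 1) * (?t (?N) + 2) + 1) + (bQ (?N) +
       ((6 * ?N + 20) + ((6 * ?N + 20) + 4 + 1) + 1) + 1) + 1) + 1) + 1) + 1) (\<sigma>(k := flag ?r), 0)"
      by (rule exec_Seq[OF 1(1) exec_Seq[OF 2(1) exec_Seq[OF 3 exec_Seq[OF 4 exec_Seq[OF 5
          exec_Seq[OF 6 exec_Seq[OF 7 8]]]]]]])
  qed
qed

subsection \<open>Encoded databases\<close>

declare bin.simps [simp del]

lemma bin_0: "bin 0 = []"
  by (simp add: bin.simps)

lemma bin_pos: "n \<noteq> 0 \<Longrightarrow> bin n = (n mod 2 + 1) # bin (n div 2)"
  by (subst bin.simps) simp

lemma set_bin: "set (bin n) \<subseteq> {1, 2}"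
proof (induction n rule: bin.induct)
  case (1 n)
  then show ?case by (cases "n = 0") (auto simp: bin_0 bin_pos)
qed

lemma bin_inject: "bin m = bin n \<longleftrightarrow> m = n"
proof
  show "bin m = bin n \<Longrightarrow> m = n"
  proof (induction m arbitrary: n rule: bin.induct)
    case (1 m)
    show ?case
    proof (cases "m = 0 \<or> n = 0")
      case True
      then show ?thesis using 1(2) by (cases "m = 0"; cases "n = 0") (auto simp: bin_0 bin_pos)
    next
      case False
      then have "m mod 2 = n mod 2" "bin (m div 2) = bin (n div 2)"
        using 1(2) by (auto simp: bin_pos)
      then show ?thesis using 1(1)[of "n div 2"] False by (metis div_mult_mod_eq)
    qed
  qed
qed simp

text \<open>What follows a field inside a fact, and then the rest \<open>B\<close> of the word.
  Every field, the predicate included, is thus a \<open>bin\<close> followed by a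
  \<open>sep\<close>, one pattern for all inductions. Since \<open>bin 0\<close> is empty, only
  separators reveal the fields.\<close>

definition sep :: "nat list \<Rightarrow> nat list \<Rightarrow> nat list" where
  "sep cs B = concat (map (\<lambda>c. 3 # bin c) cs) @ 4 # B"

lemma sep_simps: "sep [] B = 4 # B" "sep (c # cs) B = 3 # bin c @ sep cs B"
  by (simp_all add: sep_def)

lemma enc_fact_sep: "enc_fact f @ B = bin (fst f) @ sep (snd f) B"
  by (simp add: enc_fact_def sep_def)

lemma sep_Cons: "\<exists>a r. sep cs B = a # r \<and> a \<in> {3, 4}"
  by (cases cs) (auto simp: sep_simps)

lemma bin_no_sep: "a \<in> set (bin n) \<Longrightarrow> a \<noteq> 0 \<and> a \<noteq> 3 \<and> a \<noteq> 4 \<and> a \<noteq> 5"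
  using set_bin by fastforce

lemma takeWhile_bin_sep:
  assumes "3 \<in> E" "4 \<in> E" "1 \<notin> E" "2 \<notin> E"
  shows "takeWhile (\<lambda>a. a \<notin> E) (bin c @ sep cs B) = bin c"
    and "dropWhile (\<lambda>a. a \<notin> E) (bin c @ sep cs B) = sep cs B"
proof -
  have "\<forall>a\<in>set (bin c). a \<notin> E" using set_bin assms by fastforce
  then show "takeWhile (\<lambda>a. a \<notin> E) (bin c @ sep cs B) = bin c"
    "dropWhile (\<lambda>a. a \<notin> E) (bin c @ sep cs B) = sep cs B"
    using sep_Cons[of cs B] assms by (auto simp: takeWhile_append dropWhile_append)
qed

text \<open>Unique readability: digits are 1 and 2, so the first 3 or 4 ends the first field, and
  which of the two it is tells whether another field follows.\<close>

lemma sep_inject: "bin c @ sep cs B = bin c' @ sep cs' B' \<Longrightarrow> c = c' \<and> cs = cs'"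
proof (induction cs arbitrary: c c' cs')
  case Nil
  have "bin c = bin c'" "sep [] B = sep cs' B'"
    using takeWhile_bin_sep[of "{3, 4}" c "[]" B] takeWhile_bin_sep[of "{3, 4}" c' cs' B'] Nil by simp_all
  then show ?case by (cases cs') (auto simp: bin_inject sep_simps)
next
  case (Cons d ds c c' cs')
  note IH = Cons.IH
  have "bin c = bin c'" "sep (d # ds) B = sep cs' B'"
    using takeWhile_bin_sep[of "{3, 4}" c "d # ds" B] takeWhile_bin_sep[of "{3, 4}" c' cs' B'] Cons(2) by simp_all
  then have c: "c = c'" by (simp add: bin_inject)
  show ?case
  proof (cases cs')
    case Nil
    then show ?thesis using \<open>sep (d # ds) B = _\<close> by (simp add: sep_simps)
  next
    case (Cons d' ds')
    then have "bin d @ sep ds B = bin d' @ sep ds' B'"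
      using \<open>sep (d # ds) B = _\<close> by (simp add: sep_simps)
    then have "d = d' \<and> ds = ds'" by (rule IH)
    then show ?thesis using c Cons by simp
  qed
qed

section \<open>Walking through the fields of a fact\<close>

lemma base_suf: "0 \<le> h \<Longrightarrow> suf w h = a # r \<Longrightarrow> base w h = a \<and> h < len w"
  unfolding suf_def base_def
  by (metis drop_all hd_drop_conv_nth list.discI list.sel(1) nat_less_iff not_le)

lemma suf_sweep:
  assumes "inp w" "0 \<le> h" "h \<le> len w"
  shows "suf w (sweep w (\<lambda>i. base w i \<in> S) h) = dropWhile (\<lambda>a. a \<notin> S) (suf w h)"
proof -
  have "suf w (sweep w (\<lambda>i. base w i \<in> S) h) = dropWhile (\<lambda>a. a \<notin> S) (suf w h)"
    if "n = nat (len w - h)" "0 \<le> h" "h \<le> len w" for n h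
    using that
  proof (induction n arbitrary: h)
    case 0
    then have h: "h = len w" by simp
    then have "base w h = 0" using assms(1) by (simp add: base_eq_0)
    then show ?case using h sweep_here[of "\<lambda>i. base w i \<in> S" h w] by (simp add: suf_end)
  next
    case (Suc n)
    have c: "suf w h = base w h # suf w (h + 1)" using Suc.prems by (intro suf_Cons) auto
    show ?case
    proof (cases "base w h \<in> S")
      case True
      then show ?thesis using sweep_here[of "\<lambda>i. base w i \<in> S" h w] c by simp
    next
      case False
      have "base w h \<noteq> 0" using Suc.prems assms(1) by (simp add: base_eq_0)
      then have "sweep w (\<lambda>i. base w i \<in> S) h = sweep w (\<lambda>i. base w i \<in> S) (h + 1)"
        using False Suc.prems assms(1) by (intro sweep_next)
      then show ?thesis using Suc.IH[of "h + 1"] Suc.prems c False by simp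
    qed
  qed
  then show ?thesis using assms by blast
qed

lemma sweep_range:
  assumes "inp w" "0 \<le> h" "h \<le> len w"
  shows "h \<le> sweep w st h" "sweep w st h \<le> len w"
  using sweep_cases[OF assms, of st] by metis+

text \<open>Leads from a field to the beginning of the next. Behind the last field the result is
  \<open>len w\<close>, where further hops stay, so a missing field shows up as a blank.\<close>

definition hop :: "nat list \<Rightarrow> int \<Rightarrow> int" where
  "hop w h = (let h' = sweep w (\<lambda>i. base w i \<in> {3, 4}) h in if base w h' = 3 then h' + 1 else len w)"

lemma nav_hop: "nav (Seq (goR (\<lambda>a B. a \<in> {3, 4})) (chk 3)) (\<lambda>w \<sigma>. hop w)"
  using nav_Seq[OF nav_goR[of "\<lambda>a B. a \<in> {3, 4}"] nav_chk[of 3]]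
  unfolding hop_def Let_def by simp

lemma hop_range:
  assumes "inp w" "0 \<le> h" "h \<le> len w"
  shows "0 \<le> hop w h \<and> hop w h \<le> len w"
  using nav_hop assms unfolding nav_def by blast

lemma hops_range:
  assumes "inp w" "0 \<le> h" "h \<le> len w"
  shows "0 \<le> (hop w ^^ j) h \<and> (hop w ^^ j) h \<le> len w"
  using assms by (induction j) (auto simp: hop_range)

lemma suf_hop:
  assumes w: "inp w" "0 \<le> h" "h \<le> len w" and s: "suf w h = bin c @ sep cs B"
  shows "cs = [] \<Longrightarrow> hop w h = len w" "cs = d # ds \<Longrightarrow> suf w (hop w h) = bin d @ sep ds B"
proof -
  let ?h = "sweep w (\<lambda>i. base w i \<in> {3, 4}) h"
  have s': "suf w ?h = sep cs B"
    using suf_sweep[OF w, of "{3, 4}"] s takeWhile_bin_sep(2)[of "{3, 4}" c cs B] by simp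
  have h: "0 \<le> ?h" using sweep_range[OF w] w by (metis order_trans)
  show "hop w h = len w" if "cs = []"
    using base_suf[OF h] s' that by (simp add: sep_simps hop_def)
  show "suf w (hop w h) = bin d @ sep ds B" if "cs = d # ds"
  proof -
    have b: "base w ?h = 3" "?h < len w" using base_suf[OF h] s' that by (auto simp: sep_simps)
    then have "suf w ?h = 3 # suf w (?h + 1)" using suf_Cons[OF h] by simp
    then show ?thesis using s' that b by (simp add: sep_simps hop_def)
  qed
qed

lemma hop_end: "inp w \<Longrightarrow> hop w (len w) = len w"
  using sweep_here[of "\<lambda>i. base w i \<in> {3, 4}" "len w" w] base_eq_0[of w "len w"]
  by (simp add: hop_def Let_def)

lemma suf_hops:
  assumes w: "inp w" "0 \<le> h" "h \<le> len w" and s: "suf w h = bin c @ sep cs B"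
  shows "j \<le> length cs \<Longrightarrow> suf w ((hop w ^^ j) h) = bin ((c # cs) ! j) @ sep (drop j cs) B"
    and "length cs < j \<Longrightarrow> (hop w ^^ j) h = len w"
proof -
  have 1: "suf w ((hop w ^^ j) h) = bin ((c # cs) ! j) @ sep (drop j cs) B" if "j \<le> length cs" for j
    using that
  proof (induction j)
    case (Suc j)
    have "drop j cs = cs ! j # drop (Suc j) cs" using Suc.prems by (simp add: Cons_nth_drop_Suc)
    then show ?case using suf_hop(2)[OF w(1) _ _ Suc.IH] hops_range[OF w, of j] Suc.prems by simp
  qed (use s in simp)
  then show "j \<le> length cs \<Longrightarrow> suf w ((hop w ^^ j) h) = bin ((c # cs) ! j) @ sep (drop j cs) B" .
  have "(hop w ^^ (Suc (length cs) + i)) h = len w" for i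
  proof (induction i)
    case 0
    show ?case using suf_hop(1)[OF w(1) _ _ 1] hops_range[OF w] by simp
  qed (simp add: hop_end w)
  then show "length cs < j \<Longrightarrow> (hop w ^^ j) h = len w" using less_imp_Suc_add by (metis add_Suc)
qed

text \<open>The condition on \<open>A\<close> excludes proper suffixes: after removal of leading
  digits of its predicate, the code of a fact may be the code of another fact.\<close>

definition at :: "nat list \<Rightarrow> int \<Rightarrow> fact \<Rightarrow> bool" where
  "at w p f \<longleftrightarrow> (\<exists>A B. w = A @ enc_fact f @ B \<and> (A = [] \<or> last A \<in> {4, 5}) \<and>
     p = int (length A + length (enc_fact f)) - 1)"

definition good :: "nat list \<Rightarrow> bool" where
  "good w \<longleftrightarrow> (\<exists>xs ys. w = enc_input xs ys)"

lemma set_enc_fact: "set (butlast (enc_fact f)) \<subseteq> {1, 2, 3}" "last (enc_fact f) = 4" "enc_fact f \<noteq> []"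
proof -
  have "set (bin (fst f)) \<union> (\<Union>c\<in>set (snd f). set (3 # bin c)) \<subseteq> {1, 2, 3}"
    using set_bin by fastforce
  then show "set (butlast (enc_fact f)) \<subseteq> {1, 2, 3}"
    by (simp add: enc_fact_def butlast_append)
qed (simp_all add: enc_fact_def)

lemma enc_fact_butlast: "enc_fact f = butlast (enc_fact f) @ [4]"
  using set_enc_fact(2,3)[of f] append_butlast_last_id[of "enc_fact f"] by simp

lemma set_enc_db: "set (enc_db xs) \<subseteq> {1..4}"
proof -
  have "set (enc_fact f) \<subseteq> {1..4}" for f
    using set_enc_fact(1)[of f] by (subst enc_fact_butlast) auto
  then show ?thesis by (auto simp: enc_db_def)
qed

lemma inp_enc: "inp (enc_input xs ys)"
  using set_enc_db[of xs] set_enc_db[of ys] by (fastforce simp: inp_def enc_input_def)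

lemma good_inp: "good w \<Longrightarrow> inp w"
  using inp_enc by (auto simp: good_def)

lemma base_append: "0 \<le> p \<Longrightarrow> base (A @ u) (len A + p) = base u p"
  by (auto simp: base_def nth_append nat_add_distrib)

lemma base_append1: "p < len A \<Longrightarrow> base (A @ u) p = base A p"
  by (auto simp: base_def nth_append)

lemma at_base: "at w p f \<Longrightarrow> base w p = 4"
proof -
  assume "at w p f"
  then obtain A B where w: "w = (A @ butlast (enc_fact f)) @ 4 # B"
    and p: "p = len (A @ butlast (enc_fact f)) + 0"
  proof -
    obtain A B where "w = A @ (butlast (enc_fact f) @ [4]) @ B"
      "p = int (length A + length (butlast (enc_fact f) @ [4])) - 1"
      using \<open>at w p f\<close> enc_fact_butlast[of f] unfolding at_def by metis
    then show ?thesis using that[of A B] by simp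
  qed
  show ?thesis unfolding w p by (subst base_append) (simp_all add: base_def)
qed

lemma at_start:
  assumes "at w p f" "inp w"
  obtains B where "suf w (lsweep w {0, 4, 5} p) = bin (fst f) @ sep (snd f) B"
    "0 \<le> lsweep w {0, 4, 5} p" "lsweep w {0, 4, 5} p \<le> len w"
proof -
  obtain A B where w: "w = A @ enc_fact f @ B" and A: "A = [] \<or> last A \<in> {4, 5}"
    and p: "p = int (length A + length (enc_fact f)) - 1"
    using assms(1) unfolding at_def by blast
  have l: "0 < length (enc_fact f)" using set_enc_fact(3) by simp
  have "lsweep w {0, 4, 5} p = len A"
  proof (rule lsweep_eqI)
    show "len A \<le> p" using p l by simp
    show "base w (len A - 1) \<in> {0, 4, 5}"
    proof (cases "A = []")
      case False
      then have "base w (len A - 1) = last A"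
        by (cases A rule: rev_cases) (auto simp: w base_def nth_append)
      then show ?thesis using A False by simp
    qed (simp add: base_def)
    fix i assume i: "len A \<le> i" "i < p"
    define n where "n = nat (i - len A)"
    have n: "i = len A + int n" "n < length (butlast (enc_fact f))" using i p by (auto simp: n_def)
    have "base w i = butlast (enc_fact f) ! n"
      unfolding w n(1) using n(2) by (subst base_append) (auto simp: base_def nth_append nth_butlast)
    then show "base w i \<notin> {0, 4, 5}" using set_enc_fact(1)[of f] nth_mem[OF n(2)] by auto
  qed
  moreover have "suf w (len A) = bin (fst f) @ sep (snd f) B"
    by (simp add: suf_def w enc_fact_sep)
  ultimately show ?thesis using that w by simp
qed

definition fat :: "nat list \<Rightarrow> int \<Rightarrow> fact" where
  "fat w p = (THE f. at w p f)"

text \<open>The position determines the beginning of the code, by walking back to the previous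
  terminator, and unique readability then determines the fact.\<close>

lemma fat_eqI: "at w p f \<Longrightarrow> inp w \<Longrightarrow> fat w p = f"
  unfolding fat_def
proof (rule the_equality)
  fix f' assume a: "at w p f" "inp w" "at w p f'"
  obtain B where "suf w (lsweep w {0, 4, 5} p) = bin (fst f) @ sep (snd f) B" using at_start[OF a(1,2)] .
  moreover obtain B' where "suf w (lsweep w {0, 4, 5} p) = bin (fst f') @ sep (snd f') B'"
    using at_start[OF a(3,2)] .
  ultimately show "f' = f" using sep_inject[of "fst f"] by (metis prod.expand)
qed

text \<open>Inside the code of a fact, 4 occurs only as the last symbol. So the induction only has
  to find the fact whose code contains \<open>p\<close>.\<close>

lemma at_in_db:
  assumes "w = A @ enc_db xs @ B" "A = [] \<or> last A \<in> {4, 5}"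
    "len A \<le> p" "p < len (A @ enc_db xs)" "base w p = 4"
  shows "\<exists>f\<in>set xs. at w p f"
  using assms
proof (induction xs arbitrary: A)
  case (Cons f xs)
  show ?case
  proof (cases "p < len (A @ enc_fact f)")
    case True
    have w: "w = A @ enc_fact f @ enc_db xs @ B" using Cons.prems(1) by (simp add: enc_db_def)
    have "p = int (length A + length (enc_fact f)) - 1"
    proof (rule ccontr)
      assume ne: "\<not> ?thesis"
      define n where "n = nat (p - len A)"
      have n: "p = len A + int n" "n < length (butlast (enc_fact f))"
        using ne True Cons.prems(3) by (auto simp: n_def)
      have "base w p = butlast (enc_fact f) ! n"
        unfolding w n(1) using n(2) by (subst base_append) (auto simp: base_def nth_append nth_butlast)
      then show False using set_enc_fact(1)[of f] nth_mem[OF n(2)] Cons.prems(5) by auto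
    qed
    then show ?thesis using w Cons.prems(2) unfolding at_def by auto
  next
    case False
    have "\<exists>f\<in>set xs. at w p f"
      using Cons.prems False set_enc_fact(2,3)[of f] by (intro Cons.IH[of "A @ enc_fact f"]) (auto simp: enc_db_def)
    then show ?thesis by auto
  qed
qed (simp add: enc_db_def)

lemma at_of_db:
  assumes "w = A @ enc_db xs @ B" "A = [] \<or> last A \<in> {4, 5}" "f \<in> set xs"
  shows "\<exists>p. len A \<le> p \<and> p < len (A @ enc_db xs) \<and> at w p f"
proof -
  obtain us vs where xs: "xs = us @ f # vs" using assms(3) split_list by metis
  have "w = (A @ enc_db us) @ enc_fact f @ (enc_db vs @ B)" using assms(1) by (simp add: xs enc_db_def)
  moreover have "A @ enc_db us = [] \<or> last (A @ enc_db us) \<in> {4, 5}"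
  proof (cases us rule: rev_cases)
    case (snoc us' u)
    then show ?thesis using set_enc_fact(2,3)[of u] by (simp add: enc_db_def)
  qed (use assms(2) in \<open>simp add: enc_db_def\<close>)
  ultimately have "at w (int (length (A @ enc_db us) + length (enc_fact f)) - 1) f" unfolding at_def by blast
  moreover have "0 < length (enc_fact f)" using set_enc_fact(3) by simp
  ultimately show ?thesis
    by (intro exI[of _ "int (length (A @ enc_db us) + length (enc_fact f)) - 1"] conjI)
       (auto simp: xs enc_db_def simp del: length_greater_0_conv)
qed

text \<open>A fact is addressed by the position of the symbol 4 that terminates it.\<close>
definition facts :: "nat list \<Rightarrow> int set" where "facts w = {p. base w p = 4}"

text \<open>The separator 5 occurs exactly once in an encoding, so a sweep to the right tells to
  which database a fact belongs.\<close>

definition left_facts :: "nat list \<Rightarrow> int set" where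
  "left_facts w = {p \<in> facts w. base w (sweep w (\<lambda>i. base w i \<in> {5}) p) = 5}"

definition right_facts :: "nat list \<Rightarrow> int set" where
  "right_facts w = {p \<in> facts w. base w (sweep w (\<lambda>i. base w i \<in> {5}) p) \<noteq> 5}"

lemma facts_range: "p \<in> facts w \<Longrightarrow> 0 \<le> p \<and> p < len w"
  by (auto simp: facts_def base_def split: if_splits)

lemma base_enc_input_5: "base (enc_input xs ys) p = 5 \<longleftrightarrow> p = len (enc_db xs)"
proof -
  have ne: "base (enc_db zs) q \<noteq> 5" for zs q
  proof (cases "0 \<le> q \<and> q < len (enc_db zs)")
    case True
    then have "enc_db zs ! nat q \<in> {1..4}" using set_enc_db[of zs] nth_mem[of "nat q" "enc_db zs"]
      by (metis nat_less_iff subsetD)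
    then show ?thesis using True by (auto simp: base_def)
  qed (auto simp: base_def)
  consider "p < len (enc_db xs)" | "p = len (enc_db xs)" | "len (enc_db xs) < p" by linarith
  then show ?thesis
  proof cases
    case 1
    then show ?thesis using ne by (simp add: enc_input_def base_append1)
  next
    case 2
    then show ?thesis using base_append[of 0 "enc_db xs"] by (simp add: enc_input_def base_def)
  next
    case 3
    have "base ((enc_db xs @ [5]) @ enc_db ys) (len (enc_db xs @ [5]) + (p - len (enc_db xs @ [5])))
       = base (enc_db ys) (p - len (enc_db xs @ [5]))" using 3 by (intro base_append) simp
    then show ?thesis using ne 3 by (simp add: enc_input_def)
  qed
qed

lemma left_facts_iff:
  assumes "w = enc_input xs ys"
  shows "p \<in> left_facts w \<longleftrightarrow> p \<in> facts w \<and> p < len (enc_db xs)"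
proof -
  have "base w (sweep w (\<lambda>i. base w i \<in> {5}) p) = 5 \<longleftrightarrow> p < len (enc_db xs)" if "p \<in> facts w"
  proof -
    have p: "0 \<le> p" "p \<le> len w" "base w p = 4" using that facts_range[OF that] by (auto simp: facts_def)
    have inp: "inp w" using inp_enc assms by simp
    obtain q where q: "sweep w (\<lambda>i. base w i \<in> {5}) p = q" "p \<le> q" "q \<le> len w"
      "base w q \<in> {5} \<or> base w q = 0" "\<And>i. p \<le> i \<Longrightarrow> i < q \<Longrightarrow> base w i \<notin> {5} \<and> base w i \<noteq> 0"
      using sweep_cases[OF inp p(1,2), of "\<lambda>i. base w i \<in> {5}"] by blast
    have lt: "len (enc_db xs) < len w" by (simp add: assms enc_input_def)
    have b5: "base w i = 5 \<longleftrightarrow> i = len (enc_db xs)" for i using base_enc_input_5 assms by simp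
    have "p \<noteq> len (enc_db xs)" using b5[of p] p(3) by auto
    show ?thesis
    proof
      assume "base w (sweep w (\<lambda>i. base w i \<in> {5}) p) = 5"
      then show "p < len (enc_db xs)" using q b5 \<open>p \<noteq> _\<close> by auto
    next
      assume l: "p < len (enc_db xs)"
      have "q \<le> len (enc_db xs)" using q(5)[of "len (enc_db xs)"] b5 l by fastforce
      then have "base w q \<noteq> 0" using base_eq_0[OF inp, of q] q p lt by auto
      then show "base w (sweep w (\<lambda>i. base w i \<in> {5}) p) = 5" using q by auto
    qed
  qed
  then show ?thesis by (auto simp: left_facts_def)
qed

lemma fat_left: "w = enc_input xs ys \<Longrightarrow> fat w ` left_facts w = set xs"
proof -
  assume w: "w = enc_input xs ys"
  have w': "w = [] @ enc_db xs @ (5 # enc_db ys)" and inp: "inp w"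
    using inp_enc by (simp_all add: w enc_input_def)
  show ?thesis
  proof (intro equalityI subsetI)
    fix f assume "f \<in> fat w ` left_facts w"
    then obtain p where p: "p \<in> left_facts w" "f = fat w p" by blast
    then have "p < len (enc_db xs)" "0 \<le> p" "base w p = 4"
      using left_facts_iff[OF w] facts_range[of p w] by (auto simp: facts_def)
    then obtain f' where "f' \<in> set xs" "at w p f'" using at_in_db[OF w', of p] by auto
    then show "f \<in> set xs" using p fat_eqI inp by metis
  next
    fix f assume "f \<in> set xs"
    then obtain p where p: "p < len (enc_db xs)" "at w p f" using at_of_db[OF w', of f] by auto
    then have "p \<in> left_facts w" using left_facts_iff[OF w] at_base[OF p(2)] by (simp add: facts_def)
    moreover have "fat w p = f" using p(2) inp by (rule fat_eqI)
    ultimately show "f \<in> fat w ` left_facts w" by blast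
  qed
qed

lemma right_facts_iff:
  assumes "w = enc_input xs ys"
  shows "p \<in> right_facts w \<longleftrightarrow> p \<in> facts w \<and> len (enc_db xs @ [5]) \<le> p"
proof -
  have "p \<in> right_facts w \<longleftrightarrow> p \<in> facts w \<and> \<not> p < len (enc_db xs)"
    using left_facts_iff[OF assms, of p] by (auto simp: left_facts_def right_facts_def)
  moreover have "p \<noteq> len (enc_db xs)" if "p \<in> facts w"
    using that base_enc_input_5[of xs ys p] assms by (auto simp: facts_def)
  ultimately show ?thesis by fastforce
qed

lemma fat_right: "w = enc_input xs ys \<Longrightarrow> fat w ` right_facts w = set ys"
proof -
  assume w: "w = enc_input xs ys"
  have w': "w = (enc_db xs @ [5]) @ enc_db ys @ []" and inp: "inp w"
    using inp_enc by (simp_all add: w enc_input_def)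
  have A: "enc_db xs @ [5] = [] \<or> last (enc_db xs @ [5]) \<in> {4, 5}" by simp
  have l: "len w = len ((enc_db xs @ [5]) @ enc_db ys)" by (simp add: w')
  show ?thesis
  proof (intro equalityI subsetI)
    fix f assume "f \<in> fat w ` right_facts w"
    then obtain p where p: "p \<in> right_facts w" "f = fat w p" by blast
    then have "len (enc_db xs @ [5]) \<le> p" "p < len w" "base w p = 4"
      using right_facts_iff[OF w, of p] facts_range[of p w] by (auto simp: facts_def)
    then obtain f' where "f' \<in> set ys" "at w p f'" using at_in_db[OF w' A, of p] l by auto
    then show "f \<in> set ys" using p fat_eqI inp by metis
  next
    fix f assume "f \<in> set ys"
    then obtain p where p: "len (enc_db xs @ [5]) \<le> p" "at w p f" using at_of_db[OF w' A] by blast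
    then have "p \<in> right_facts w" using right_facts_iff[OF w] at_base[OF p(2)] by (simp add: facts_def)
    moreover have "fat w p = f" using p(2) inp by (rule fat_eqI)
    ultimately show "f \<in> fat w ` right_facts w" by blast
  qed
qed

lemma facts_at:
  assumes "good w" "p \<in> facts w"
  shows "at w p (fat w p)"
proof -
  obtain xs ys where w: "w = enc_input xs ys" using assms(1) by (auto simp: good_def)
  have inp: "inp w" using good_inp assms(1) .
  have p: "0 \<le> p" "p < len w" "base w p = 4" using assms(2) facts_range by (auto simp: facts_def)
  have "\<exists>f. at w p f"
  proof (cases "p < len (enc_db xs)")
    case True
    have "w = [] @ enc_db xs @ (5 # enc_db ys)" by (simp add: w enc_input_def)
    then show ?thesis using at_in_db[of w "[]" xs _ p] True p by auto
  next
    case False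
    have "w = (enc_db xs @ [5]) @ enc_db ys @ []" by (simp add: w enc_input_def)
    moreover have "len (enc_db xs @ [5]) \<le> p"
      using False p base_enc_input_5[of xs ys p] w by fastforce
    ultimately show ?thesis using at_in_db[of w "enc_db xs @ [5]" ys "[]" p] p by auto
  qed
  then show ?thesis using fat_eqI inp by metis
qed

subsection \<open>Decidable properties of encoded databases\<close>

text \<open>The witness \<open>P'\<close> is decided on all input words, while agreement with
  \<open>P\<close> is required only where positions can be decoded into facts. Polynomial time thus
  does not depend on the input being well formed.\<close>

definition dec :: "nat \<Rightarrow> (nat list \<Rightarrow> tracks \<Rightarrow> bool) \<Rightarrow> bool" where
  "dec k P \<longleftrightarrow> (\<exists>P'. tdec k P' \<and> (\<forall>w \<sigma>. good w \<longrightarrow> marked w k \<sigma> \<longrightarrow> P' w \<sigma> = P w \<sigma>))"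

lemma dec_tdec: "tdec k P \<Longrightarrow> dec k P"
  unfolding dec_def by blast

lemma dec_cong:
  assumes "dec k P" "\<And>w \<sigma>. good w \<Longrightarrow> marked w k \<sigma> \<Longrightarrow> P w \<sigma> = Q w \<sigma>"
  shows "dec k Q"
  using assms unfolding dec_def by metis

lemma dec_not: "dec k P \<Longrightarrow> dec k (\<lambda>w \<sigma>. \<not> P w \<sigma>)"
  unfolding dec_def by (metis tdec_not)

lemma dec_and:
  assumes "dec k P" "dec k Q" shows "dec k (\<lambda>w \<sigma>. P w \<sigma> \<and> Q w \<sigma>)"
proof -
  obtain P' Q' where "tdec k P'" "\<forall>w \<sigma>. good w \<longrightarrow> marked w k \<sigma> \<longrightarrow> P' w \<sigma> = P w \<sigma>"
    "tdec k Q'" "\<forall>w \<sigma>. good w \<longrightarrow> marked w k \<sigma> \<longrightarrow> Q' w \<sigma> = Q w \<sigma>"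
    using assms unfolding dec_def by blast
  then show ?thesis unfolding dec_def by (intro exI[of _ "\<lambda>w \<sigma>. P' w \<sigma> \<and> Q' w \<sigma>"]) (simp add: tdec_and)
qed

lemma dec_or: "dec k P \<Longrightarrow> dec k Q \<Longrightarrow> dec k (\<lambda>w \<sigma>. P w \<sigma> \<or> Q w \<sigma>)"
  using dec_not[OF dec_and[OF dec_not dec_not]] by simp

lemma dec_const: "dec k (\<lambda>w \<sigma>. b)"
  using dec_tdec[OF tdec_False] dec_not[OF dec_tdec[OF tdec_False]] by (cases b) simp_all

lemma dec_iff_const: "dec k P \<Longrightarrow> dec k (\<lambda>w \<sigma>. b \<longleftrightarrow> P w \<sigma>)"
  by (cases b) (simp_all add: dec_not)

lemma dec_ball:
  "finite A \<Longrightarrow> (\<And>a. a \<in> A \<Longrightarrow> dec k (P a)) \<Longrightarrow> dec k (\<lambda>w \<sigma>. \<forall>a\<in>A. P a w \<sigma>)"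
proof (induction rule: finite_induct)
  case (insert a A)
  then show ?case using dec_and[of k "P a" "\<lambda>w \<sigma>. \<forall>a\<in>A. P a w \<sigma>"] by simp
qed (simp add: dec_const)

lemma dec_bex:
  assumes "finite A" "\<And>a. a \<in> A \<Longrightarrow> dec k (P a)"
  shows "dec k (\<lambda>w \<sigma>. \<exists>a\<in>A. P a w \<sigma>)"
  using dec_not[OF dec_ball[of A k "\<lambda>a w \<sigma>. \<not> P a w \<sigma>"]] assms dec_not by simp

lemma pt_upd: "good w \<Longrightarrow> p \<in> facts w \<Longrightarrow> pt w (\<sigma>(k := {p})) k = p"
  using facts_range[of p w] good_inp[of w] by (intro pt_single) auto

lemma dec_sym: "dec k (\<lambda>w \<sigma>. pt w \<sigma> x \<in> facts w)"
  using dec_tdec[OF tdec_sym[of k x "{4}"]] by (simp add: facts_def)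

lemma dec_ex:
  assumes "dec (Suc k) P"
  shows "dec k (\<lambda>w \<sigma>. \<exists>p\<in>facts w. P w (\<sigma>(k := {p})))"
proof -
  \<comment> \<open>\<open>tdec_ex\<close> quantifies over all cells; the added conjunct restricts
    this to facts.\<close>
  have "dec (Suc k) (\<lambda>w \<sigma>. pt w \<sigma> k \<in> facts w \<and> P w \<sigma>)" by (intro dec_and dec_sym assms)
  then obtain P' where P': "tdec (Suc k) P'"
    "\<And>w \<sigma>. good w \<Longrightarrow> marked w (Suc k) \<sigma> \<Longrightarrow> P' w \<sigma> = (pt w \<sigma> k \<in> facts w \<and> P w \<sigma>)"
    unfolding dec_def by blast
  show ?thesis
  proof (rule dec_cong[OF dec_tdec[OF tdec_ex[OF P'(1)]]])
    fix w \<sigma> assume w: "good w" "marked w k \<sigma>"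
    have "P' w (\<sigma>(k := {p})) \<longleftrightarrow> p \<in> facts w \<and> P w (\<sigma>(k := {p}))" if "0 \<le> p" "p \<le> len w" for p
      using P'(2)[OF w(1) marked_upd[OF w(2)], of "{p}"] that pt_single[OF good_inp[OF w(1)] that]
      by simp
    moreover have "0 \<le> p \<and> p \<le> len w" if "p \<in> facts w" for p using facts_range[OF that] by simp
    ultimately show "(\<exists>p\<ge>0. p \<le> len w \<and> P' w (\<sigma>(k := {p}))) = (\<exists>p\<in>facts w. P w (\<sigma>(k := {p})))"
      by blast
  qed
qed

lemma dec_all:
  assumes "dec (Suc k) P"
  shows "dec k (\<lambda>w \<sigma>. \<forall>p\<in>facts w. P w (\<sigma>(k := {p})))"
  using dec_not[OF dec_ex[OF dec_not[OF assms]]] by simp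

lemma first_cong: "(\<And>p. 0 \<le> p \<Longrightarrow> p \<le> len w \<Longrightarrow> P p = Q p) \<Longrightarrow> first w P = first w Q"
  unfolding first_def by (intro Collect_cong conj_cong refl all_cong1) auto

text \<open>Only sets reached from the empty set, and candidates outside of them, are ever
  consulted.\<close>

lemma stab_grow_cong:
  assumes "\<And>X p. X \<subseteq> {0..len w} \<Longrightarrow> 0 \<le> p \<Longrightarrow> p \<le> len w \<Longrightarrow> p \<notin> X \<Longrightarrow> R X p = R' X p"
  shows "stab (grow w R) = stab (grow w R')"
proof -
  have g: "grow w R X = grow w R' X" if "X \<subseteq> {0..len w}" for X
    using first_cong[of w "\<lambda>p. p \<notin> X \<and> R X p" "\<lambda>p. p \<notin> X \<and> R' X p"] assms[OF that] by (auto simp: grow_def)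
  have i: "(grow w R ^^ m) {} = (grow w R' ^^ m) {}" for m
    by (induction m) (simp_all add: g grow_iter_subset)
  have "grow w R ((grow w R ^^ m) {}) = grow w R' ((grow w R' ^^ m) {})" for m
    using i[of m] g[OF grow_iter_subset] by simp
  then show ?thesis unfolding stab_def i by simp
qed

lemma dec_fix:
  assumes "dec (Suc (Suc k)) P" "dec (Suc k) Q"
  shows "dec k (\<lambda>w \<sigma>. Q w (\<sigma>(k := stab (grow w (\<lambda>X p. p \<in> facts w \<and> P w (\<sigma>(k := X, Suc k := {p})))))))"
proof -
  have "dec (Suc (Suc k)) (\<lambda>w \<sigma>. pt w \<sigma> (Suc k) \<in> facts w \<and> P w \<sigma>)" by (intro dec_and dec_sym assms)
  then obtain P' where P': "tdec (Suc (Suc k)) P'"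
    "\<And>w \<sigma>. good w \<Longrightarrow> marked w (Suc (Suc k)) \<sigma> \<Longrightarrow> P' w \<sigma> = (pt w \<sigma> (Suc k) \<in> facts w \<and> P w \<sigma>)"
    unfolding dec_def by blast
  obtain Q' where Q': "tdec (Suc k) Q'"
    "\<And>w \<sigma>. good w \<Longrightarrow> marked w (Suc k) \<sigma> \<Longrightarrow> Q' w \<sigma> = Q w \<sigma>"
    using assms(2) unfolding dec_def by blast
  \<comment> \<open>\<open>tdec_fix\<close> demands a rule that rejects old elements. The extra
    conjunct achieves this without changing \<open>grow\<close>, which discards old elements
    anyway.\<close>
  define P2 where "P2 w \<sigma> \<longleftrightarrow> P' w \<sigma> \<and> \<not> pt w \<sigma> (Suc k) \<in> \<sigma> k" for w \<sigma>
  have "tdec (Suc (Suc k)) P2"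
    unfolding P2_def by (intro tdec_and tdec_not tdec_track P')
  moreover have "\<not> P2 w (\<sigma>(Suc k := {p}))" if "inp w" "\<sigma> k \<subseteq> {0..len w}" "p \<in> \<sigma> k" for w \<sigma> p
    using pt_single[of w p "\<sigma>(Suc k := {p})" "Suc k"] that by (auto simp: P2_def)
  ultimately have t: "tdec k (\<lambda>w \<sigma>. Q' w (\<sigma>(k := stab (grow w (\<lambda>X p. P2 w (\<sigma>(k := X, Suc k := {p})))))))"
    using Q'(1) by (intro tdec_fix)
  show ?thesis
  proof (rule dec_cong[OF dec_tdec[OF t]])
    fix w \<sigma> assume w: "good w" "marked w k \<sigma>"
    have "stab (grow w (\<lambda>X p. P2 w (\<sigma>(k := X, Suc k := {p})))) =
        stab (grow w (\<lambda>X p. p \<in> facts w \<and> P w (\<sigma>(k := X, Suc k := {p}))))"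
    proof (rule stab_grow_cong)
      fix X p assume X: "X \<subseteq> {0..len w}" "0 \<le> p" "p \<le> len w" "p \<notin> X"
      have m: "marked w (Suc (Suc k)) (\<sigma>(k := X, Suc k := {p}))"
        using X by (intro marked_upd w) auto
      have "pt w (\<sigma>(k := X, Suc k := {p})) (Suc k) = p"
        using X by (intro pt_single good_inp w) auto
      then show "P2 w (\<sigma>(k := X, Suc k := {p})) = (p \<in> facts w \<and> P w (\<sigma>(k := X, Suc k := {p})))"
        using P'(2)[OF w(1) m] X(4) by (simp add: P2_def)
    qed
    moreover have "stab (grow w R) \<subseteq> {0..len w}" for R
      using stab_grow grow_iter_subset by metis
    ultimately show "Q' w (\<sigma>(k := stab (grow w (\<lambda>X p. P2 w (\<sigma>(k := X, Suc k := {p})))))) =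
      Q w (\<sigma>(k := stab (grow w (\<lambda>X p. p \<in> facts w \<and> P w (\<sigma>(k := X, Suc k := {p}))))))"
      using Q'(2)[OF w(1) marked_upd[OF w(2)]] by simp
  qed
qed

lemma stab_grow_closed:
  assumes "0 \<le> p" "p \<le> len w" "R (stab (grow w R)) p"
  shows "p \<in> stab (grow w R)"
proof (rule ccontr)
  let ?X = "stab (grow w R)"
  assume n: "p \<notin> ?X"
  have "grow w R ?X = ?X" using stab_grow by metis
  then have "first w (\<lambda>p. p \<notin> ?X \<and> R ?X p) \<subseteq> ?X" by (auto simp: grow_def)
  then have "first w (\<lambda>p. p \<notin> ?X \<and> R ?X p) = {}" by (auto simp: first_def)
  then show False using assms n first_cases[of w "\<lambda>p. p \<notin> ?X \<and> R ?X p"] by (metis insert_not_empty)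
qed

text \<open>A round inserts at most one element, so invariants need to survive single insertions
  only.\<close>

lemma stab_grow_induct:
  assumes "I {}" "\<And>X p. I X \<Longrightarrow> p \<notin> X \<Longrightarrow> R X p \<Longrightarrow> I (insert p X)"
  shows "I (stab (grow w R))"
proof -
  have "I ((grow w R ^^ m) {})" for m
  proof (induction m)
    case (Suc m)
    let ?X = "(grow w R ^^ m) {}"
    show ?case
    proof (cases rule: first_cases[of w "\<lambda>p. p \<notin> ?X \<and> R ?X p"])
      case (2 p)
      then have "grow w R ?X = insert p ?X" unfolding grow_def by (simp only: 2(1) Un_insert_right Un_empty_right)
      then show ?thesis using assms(2)[OF Suc, of p] 2(4) by simp
    next
      case 1
      then have "grow w R ?X = ?X" unfolding grow_def by (simp only: 1(1) Un_empty_right)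
      then show ?thesis using Suc by simp
    qed
  qed (simp add: assms)
  then show ?thesis using stab_grow by metis
qed

subsection \<open>Fields of facts\<close>

definition fact_fields :: "fact \<Rightarrow> nat list" where "fact_fields f = fst f # snd f"

definition fpos :: "nat list \<Rightarrow> int \<Rightarrow> nat \<Rightarrow> int" where
  "fpos w p j = (hop w ^^ j) (lsweep w {0, 4, 5} p)"

text \<open>Go to the pointer, walk back to the beginning of its fact, then hop \<open>j\<close>
  times; there is a separate program for each \<open>j\<close>.\<close>

lemma nav_fpos: "\<exists>c. nav c (\<lambda>w \<sigma> h. fpos w (sweep w (\<lambda>i. i \<in> \<sigma> x) h) j)"
proof (induction j)
  case 0
  show ?case using nav_Seq[OF nav_goto[of x] nav_goL[of "{0, 4, 5}"]] by (auto simp: fpos_def)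
next
  case (Suc j)
  then obtain c where "nav c (\<lambda>w \<sigma> h. fpos w (sweep w (\<lambda>i. i \<in> \<sigma> x) h) j)" by blast
  from nav_Seq[OF this nav_hop] show ?case by (auto simp: fpos_def)
qed

lemma fpos_props:
  assumes "good w" "p \<in> facts w"
  shows "0 \<le> fpos w p j" "fpos w p j \<le> len w"
    "j \<le> length (snd (fat w p)) \<Longrightarrow>
      \<exists>B. suf w (fpos w p j) = bin (fact_fields (fat w p) ! j) @ sep (drop j (snd (fat w p))) B"
    "length (snd (fat w p)) < j \<Longrightarrow> fpos w p j = len w"
proof -
  have inp: "inp w" using good_inp assms(1) .
  obtain B where B: "suf w (lsweep w {0, 4, 5} p) = bin (fst (fat w p)) @ sep (snd (fat w p)) B"
    "0 \<le> lsweep w {0, 4, 5} p" "lsweep w {0, 4, 5} p \<le> len w"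
    using at_start[OF facts_at[OF assms] inp] .
  show "0 \<le> fpos w p j" "fpos w p j \<le> len w"
    using hops_range[OF inp B(2,3)] by (auto simp: fpos_def)
  show "j \<le> length (snd (fat w p)) \<Longrightarrow>
      \<exists>B. suf w (fpos w p j) = bin (fact_fields (fat w p) ! j) @ sep (drop j (snd (fat w p))) B"
    using suf_hops(1)[OF inp B(2,3,1), of j] by (auto simp: fpos_def fact_fields_def)
  show "length (snd (fat w p)) < j \<Longrightarrow> fpos w p j = len w"
    using suf_hops(2)[OF inp B(2,3,1), of j] by (simp add: fpos_def)
qed

text \<open>Even an empty field shows a nonblank symbol, namely its separator. A field is the last
  one iff the next separator is 4.\<close>

lemma fpos_base:
  assumes "good w" "p \<in> facts w"
  shows "base w (fpos w p j) \<noteq> 0 \<longleftrightarrow> j \<le> length (snd (fat w p))"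
    and "base w (sweep w (\<lambda>i. base w i \<in> {3, 4}) (fpos w p j)) = 4 \<longleftrightarrow> length (snd (fat w p)) = j"
proof -
  have inp: "inp w" using good_inp assms(1) .
  note r = fpos_props(1,2)[OF assms, of j]
  have "(base w (fpos w p j) \<noteq> 0 \<longleftrightarrow> j \<le> length (snd (fat w p))) \<and>
    (base w (sweep w (\<lambda>i. base w i \<in> {3, 4}) (fpos w p j)) = 4 \<longleftrightarrow> length (snd (fat w p)) = j)"
  proof (cases "j \<le> length (snd (fat w p))")
    case True
    then obtain B where B: "suf w (fpos w p j) = bin (fact_fields (fat w p) ! j) @ sep (drop j (snd (fat w p))) B"
      using fpos_props(3)[OF assms] by blast
    then have "suf w (fpos w p j) \<noteq> []" using sep_Cons[of "drop j (snd (fat w p))" B] by auto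
    then have "fpos w p j \<noteq> len w" using suf_end by metis
    then have 1: "base w (fpos w p j) \<noteq> 0" using r base_eq_0[OF inp] by simp
    let ?h = "sweep w (\<lambda>i. base w i \<in> {3, 4}) (fpos w p j)"
    have "suf w ?h = sep (drop j (snd (fat w p))) B"
      using suf_sweep[OF inp r, of "{3, 4}"] B takeWhile_bin_sep(2)[of "{3, 4}"] by simp
    moreover have "0 \<le> ?h" using sweep_range(1)[OF inp r] r by (metis order_trans)
    ultimately have "base w ?h = 4 \<longleftrightarrow> drop j (snd (fat w p)) = []"
      using base_suf[of ?h w] by (cases "drop j (snd (fat w p))") (auto simp: sep_simps)
    then show ?thesis using 1 True by auto
  next
    case False
    then have "fpos w p j = len w" using fpos_props(4)[OF assms] by simp
    then show ?thesis using False sweep_here[of "\<lambda>i. base w i \<in> {3, 4}" "len w" w] base_eq_0[OF inp, of "len w"]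
      by auto
  qed
  then show "base w (fpos w p j) \<noteq> 0 \<longleftrightarrow> j \<le> length (snd (fat w p))"
    "base w (sweep w (\<lambda>i. base w i \<in> {3, 4}) (fpos w p j)) = 4 \<longleftrightarrow> length (snd (fat w p)) = j" by auto
qed

lemma token_fpos:
  assumes "good w" "p \<in> facts w" "j \<le> length (snd (fat w p))"
  shows "token {0, 3, 4} w (fpos w p j) = bin (fact_fields (fat w p) ! j)"
  using fpos_props(3)[OF assms] takeWhile_bin_sep(1)[of "{0, 3, 4}"] by (auto simp: token_def)

text \<open>Stands for a value by the place where it is written: a field number and the track whose
  pointer selects the fact. Only constants fixed in advance appear literally.\<close>

datatype ref = Cst nat | Fld nat nat

fun rval :: "nat list \<Rightarrow> tracks \<Rightarrow> ref \<Rightarrow> nat" where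
  "rval w \<sigma> (Cst c) = c"
| "rval w \<sigma> (Fld x j) = fact_fields (fat w (pt w \<sigma> x)) ! j"

text \<open>Outside of these conditions \<open>rval\<close> is an unspecified number that no program
  can inspect, so validity is always tested together with values.\<close>

fun rok :: "nat list \<Rightarrow> tracks \<Rightarrow> ref \<Rightarrow> bool" where
  "rok w \<sigma> (Cst c) \<longleftrightarrow> True"
| "rok w \<sigma> (Fld x j) \<longleftrightarrow> pt w \<sigma> x \<in> facts w \<and> j \<le> length (snd (fat w (pt w \<sigma> x)))"

fun rtracks :: "ref \<Rightarrow> nat set" where
  "rtracks (Cst c) = {}"
| "rtracks (Fld x j) = {x}"

lemma rval_cong: "(\<And>x. x \<in> rtracks r \<Longrightarrow> \<sigma> x = \<sigma>' x) \<Longrightarrow> rval w \<sigma> r = rval w \<sigma>' r \<and> rok w \<sigma> r = rok w \<sigma>' r"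
  by (cases r) (auto simp: pt_def)

lemma dec_rok: "dec k (\<lambda>w \<sigma>. rok w \<sigma> r)"
proof (cases r)
  case (Fld x j)
  obtain c where "nav c (\<lambda>w \<sigma> h. fpos w (sweep w (\<lambda>i. i \<in> \<sigma> x) h) j)" using nav_fpos by blast
  from tdec_nav[OF this, of k "\<lambda>a B. a \<noteq> 0"]
  have "dec k (\<lambda>w \<sigma>. pt w \<sigma> x \<in> facts w \<and> base w (fpos w (pt w \<sigma> x) j) \<noteq> 0)"
    unfolding pt_def[symmetric] by (intro dec_and dec_sym dec_tdec)
  then show ?thesis by (rule dec_cong) (use fpos_base(1) Fld in auto)
qed (simp add: dec_const)

lemma dec_arity: "dec k (\<lambda>w \<sigma>. pt w \<sigma> x \<in> facts w \<and> length (snd (fat w (pt w \<sigma> x))) = n)"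
proof -
  obtain c where c: "nav c (\<lambda>w \<sigma> h. fpos w (sweep w (\<lambda>i. i \<in> \<sigma> x) h) n)" using nav_fpos by blast
  from tdec_nav[OF nav_Seq[OF c nav_goR[of "\<lambda>a B. a \<in> {3, 4}"]], of k "\<lambda>a B. a = 4"]
  have "dec k (\<lambda>w \<sigma>. pt w \<sigma> x \<in> facts w \<and>
      base w (sweep w (\<lambda>i. base w i \<in> {3, 4}) (fpos w (pt w \<sigma> x) n)) = 4)"
    unfolding pt_def[symmetric] by (intro dec_and dec_sym dec_tdec)
  then show ?thesis by (rule dec_cong) (use fpos_base(2) in auto)
qed

section \<open>Comparing fields with constants, fields and facts\<close>

fun chks :: "nat list \<Rightarrow> nat list \<Rightarrow> int \<Rightarrow> int" where
  "chks w [] h = h"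
| "chks w (b # bs) h = chks w bs (if base w h = b then h + 1 else len w)"

lemma nav_Skip: "nav Skip (\<lambda>w \<sigma> h. h)"
  unfolding nav_def using polyb_const[of 0] exec_Skip by auto

lemma nav_chks: "0 \<notin> set bs \<Longrightarrow> \<exists>c. nav c (\<lambda>w \<sigma>. chks w bs)"
proof (induction bs)
  case Nil
  then show ?case using nav_Skip by (auto intro!: exI[of _ Skip])
next
  case (Cons b bs)
  then obtain c where "nav c (\<lambda>w \<sigma>. chks w bs)" by auto
  from nav_Seq[OF nav_chk[of b] this] Cons.prems show ?case by auto
qed

lemma chks_end: "inp w \<Longrightarrow> 0 \<notin> set bs \<Longrightarrow> chks w bs (len w) = len w"
  using base_eq_0[of w "len w"] by (induction bs) auto

text \<open>A field that is shorter or differs makes a check fail and the head ends on the blank; a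
  longer field leaves it on a digit. Only an exact match ends on a separator.\<close>

lemma chks_bin:
  assumes "inp w" "set bs \<subseteq> {1, 2}" "0 \<le> h" "h \<le> len w" "suf w h = us @ sep cs B" "set us \<subseteq> {1, 2}"
  shows "base w (chks w bs h) \<in> {3, 4} \<longleftrightarrow> us = bs"
  using assms
proof (induction bs arbitrary: h us)
  case Nil
  obtain a r where a: "sep cs B = a # r" "a \<in> {3, 4}" using sep_Cons by blast
  show ?case
  proof (cases us)
    case Nil
    then show ?thesis using a Nil.prems base_suf[of h w a r] by simp
  next
    case (Cons u us')
    then show ?thesis using Nil.prems base_suf[of h w u "us' @ sep cs B"] by auto
  qed
next
  case (Cons b bs)
  have b0: "base w (len w) = 0" using base_eq_0[OF Cons.prems(1)] by simp
  have bs0: "0 \<notin> set bs" using Cons.prems(2) by auto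
  obtain a r where a: "sep cs B = a # r" "a \<in> {3, 4}" using sep_Cons by blast
  show ?case
  proof (cases us)
    case Nil
    then have "base w h = a" using base_suf[of h w a r] a Cons.prems by simp
    then have "base w h \<noteq> b" using a Cons.prems(2) by auto
    then show ?thesis using Nil chks_end[OF Cons.prems(1) bs0] b0 by simp
  next
    case (Cons u us')
    then have u: "base w h = u" "h < len w" using base_suf[of h w u "us' @ sep cs B"] Cons.prems by auto
    show ?thesis
    proof (cases "u = b")
      case True
      have "suf w (h + 1) = us' @ sep cs B"
        using suf_Cons[of h w] u Cons.prems \<open>us = u # us'\<close> by simp
      then show ?thesis using Cons.IH[of "h + 1" us'] Cons.prems u \<open>us = u # us'\<close> True by simp
    next
      case False
      then show ?thesis using u chks_end[OF Cons.prems(1) bs0] b0 \<open>us = u # us'\<close> by simp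
    qed
  qed
qed

text \<open>The constant is fixed before the input, so its digits can be built into the
  program.\<close>

lemma dec_field_const: "dec k (\<lambda>w \<sigma>. rok w \<sigma> (Fld x j) \<and> rval w \<sigma> (Fld x j) = c)"
proof -
  obtain d where d: "nav d (\<lambda>w \<sigma> h. fpos w (sweep w (\<lambda>i. i \<in> \<sigma> x) h) j)" using nav_fpos by blast
  have "0 \<notin> set (bin c)" using bin_no_sep by blast
  then obtain e where e: "nav e (\<lambda>w \<sigma>. chks w (bin c))" using nav_chks by blast
  from tdec_nav[OF nav_Seq[OF d e], of k "\<lambda>a B. a \<in> {3, 4}"]
  have "dec k (\<lambda>w \<sigma>. rok w \<sigma> (Fld x j) \<and> base w (chks w (bin c) (fpos w (pt w \<sigma> x) j)) \<in> {3, 4})"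
    unfolding pt_def[symmetric] by (intro dec_and dec_rok dec_tdec)
  then show ?thesis
  proof (rule dec_cong)
    fix w \<sigma> assume w: "good w" "marked w k \<sigma>"
    show "(rok w \<sigma> (Fld x j) \<and> base w (chks w (bin c) (fpos w (pt w \<sigma> x) j)) \<in> {3, 4}) =
      (rok w \<sigma> (Fld x j) \<and> rval w \<sigma> (Fld x j) = c)"
    proof (cases "rok w \<sigma> (Fld x j)")
      case True
      then have p: "pt w \<sigma> x \<in> facts w" "j \<le> length (snd (fat w (pt w \<sigma> x)))" by simp_all
      obtain B where "suf w (fpos w (pt w \<sigma> x) j) = bin (fact_fields (fat w (pt w \<sigma> x)) ! j) @
          sep (drop j (snd (fat w (pt w \<sigma> x)))) B"
        using fpos_props(3)[OF w(1) p] by blast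
      then have "base w (chks w (bin c) (fpos w (pt w \<sigma> x) j)) \<in> {3, 4} \<longleftrightarrow>
          bin (fact_fields (fat w (pt w \<sigma> x)) ! j) = bin c"
        using fpos_props(1,2)[OF w(1) p(1)] by (intro chks_bin good_inp w set_bin)
      then show ?thesis by (simp add: bin_inject)
    next
      case False
      then show ?thesis by (simp only: simp_thms)
    qed
  qed
qed

text \<open>The bound on \<open>y\<close> keeps the second navigation independent of track
  \<open>k\<close>, on which the comparison puts its first pointer.\<close>

lemma dec_field_eq:
  assumes "y < k"
  shows "dec k (\<lambda>w \<sigma>. rok w \<sigma> (Fld x i) \<and> rok w \<sigma> (Fld y j) \<and> rval w \<sigma> (Fld x i) = rval w \<sigma> (Fld y j))"
proof -
  obtain c where c: "nav c (\<lambda>w \<sigma> h. fpos w (sweep w (\<lambda>i. i \<in> \<sigma> x) h) i)" using nav_fpos by blast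
  obtain d where d: "nav d (\<lambda>w \<sigma> h. fpos w (sweep w (\<lambda>i. i \<in> \<sigma> y) h) j)" using nav_fpos by blast
  have "tdec k (\<lambda>w \<sigma>. token {0, 3, 4} w (fpos w (pt w \<sigma> x) i) = token {0, 3, 4} w (fpos w (pt w \<sigma> y) j))"
    unfolding pt_def by (intro tdec_token_eq[OF c d]) (use assms in auto)
  then have "dec k (\<lambda>w \<sigma>. rok w \<sigma> (Fld x i) \<and> rok w \<sigma> (Fld y j) \<and>
     token {0, 3, 4} w (fpos w (pt w \<sigma> x) i) = token {0, 3, 4} w (fpos w (pt w \<sigma> y) j))"
    by (intro dec_and dec_rok dec_tdec)
  then show ?thesis by (rule dec_cong) (auto simp: token_fpos bin_inject)
qed

lemma dec_eq:
  assumes "rtracks r \<subseteq> {..<k}" "rtracks r' \<subseteq> {..<k}"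
  shows "dec k (\<lambda>w \<sigma>. rok w \<sigma> r \<and> rok w \<sigma> r' \<and> rval w \<sigma> r = rval w \<sigma> r')"
proof (cases r; cases r')
  fix c x j assume "r = Cst c" "r' = Fld x j"
  then show ?thesis using dec_field_const[of k x j c] by (auto elim: dec_cong)
next
  fix c x j assume "r = Fld x j" "r' = Cst c"
  then show ?thesis using dec_field_const[of k x j c] by (auto elim: dec_cong)
next
  fix x i y j assume "r = Fld x i" "r' = Fld y j"
  then show ?thesis using dec_field_eq[of y k x i j] assms by simp
qed (simp add: dec_const)

lemma dec_neq:
  assumes "rtracks r \<subseteq> {..<k}" "rtracks r' \<subseteq> {..<k}"
  shows "dec k (\<lambda>w \<sigma>. rok w \<sigma> r \<and> rok w \<sigma> r' \<and> rval w \<sigma> r \<noteq> rval w \<sigma> r')"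
proof -
  have "dec k (\<lambda>w \<sigma>. rok w \<sigma> r \<and> rok w \<sigma> r' \<and> \<not> (rok w \<sigma> r \<and> rok w \<sigma> r' \<and> rval w \<sigma> r = rval w \<sigma> r'))"
    by (intro dec_and dec_not dec_rok dec_eq assms)
  then show ?thesis by (rule dec_cong) auto
qed

text \<open>Without 3 among the stop symbols, a token is the whole code of a fact up to its 4. One
  comparison therefore covers facts of every arity, and unique readability gives equality.\<close>

lemma dec_same_fact:
  assumes "y < k"
  shows "dec k (\<lambda>w \<sigma>. pt w \<sigma> x \<in> facts w \<and> pt w \<sigma> y \<in> facts w \<and> fat w (pt w \<sigma> x) = fat w (pt w \<sigma> y))"
proof -
  obtain c where c: "nav c (\<lambda>w \<sigma> h. fpos w (sweep w (\<lambda>i. i \<in> \<sigma> x) h) 0)" using nav_fpos by blast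
  obtain d where d: "nav d (\<lambda>w \<sigma> h. fpos w (sweep w (\<lambda>i. i \<in> \<sigma> y) h) 0)" using nav_fpos by blast
  have "tdec k (\<lambda>w \<sigma>. token {0, 4} w (fpos w (pt w \<sigma> x) 0) = token {0, 4} w (fpos w (pt w \<sigma> y) 0))"
    unfolding pt_def by (intro tdec_token_eq[OF c d]) (use assms in auto)
  then have "dec k (\<lambda>w \<sigma>. pt w \<sigma> x \<in> facts w \<and> pt w \<sigma> y \<in> facts w \<and>
     token {0, 4} w (fpos w (pt w \<sigma> x) 0) = token {0, 4} w (fpos w (pt w \<sigma> y) 0))"
    by (intro dec_and dec_sym dec_tdec)
  then show ?thesis
  proof (rule dec_cong)
    fix w \<sigma> assume w: "good w" "marked w k \<sigma>"
    have tok: "token {0, 4} w (fpos w p 0) = butlast (enc_fact (fat w p))" if p: "p \<in> facts w" for p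
    proof -
      obtain B where "suf w (fpos w p 0) = enc_fact (fat w p) @ B"
        using fpos_props(3)[OF w(1) p, of 0] by (auto simp: fact_fields_def enc_fact_sep)
      then have "suf w (fpos w p 0) = butlast (enc_fact (fat w p)) @ 4 # B"
        using enc_fact_butlast[of "fat w p"] by (metis append.assoc append_Cons append_Nil)
      moreover have "\<forall>a\<in>set (butlast (enc_fact (fat w p))). a \<notin> {0, 4}"
        using set_enc_fact(1)[of "fat w p"] by fastforce
      ultimately show ?thesis by (simp add: token_def takeWhile_append)
    qed
    have "f = f'" if "butlast (enc_fact f) = butlast (enc_fact f')" for f f'
    proof -
      have "enc_fact f = enc_fact f'" using that enc_fact_butlast by metis
      then show ?thesis using sep_inject[of "fst f" "snd f" "[]" "fst f'" "snd f'" "[]"]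
          enc_fact_sep[of f "[]"] enc_fact_sep[of f' "[]"] by (metis prod.expand)
    qed
    then show "(pt w \<sigma> x \<in> facts w \<and> pt w \<sigma> y \<in> facts w \<and>
     token {0, 4} w (fpos w (pt w \<sigma> x) 0) = token {0, 4} w (fpos w (pt w \<sigma> y) 0)) =
     (pt w \<sigma> x \<in> facts w \<and> pt w \<sigma> y \<in> facts w \<and> fat w (pt w \<sigma> x) = fat w (pt w \<sigma> y))"
      using tok by metis
  qed
qed

subsection \<open>Matching conjunctions\<close>

text \<open>Such sets depend on the tracks below \<open>K\<close> only. Pointers placed on later
  tracks do not change them, so membership can be tested under further quantifiers.\<close>

definition decset :: "nat \<Rightarrow> (nat list \<Rightarrow> tracks \<Rightarrow> int set) \<Rightarrow> bool" where
  "decset K E \<longleftrightarrow> (\<forall>k x. K \<le> k \<longrightarrow> x < k \<longrightarrow> dec k (\<lambda>w \<sigma>. pt w \<sigma> x \<in> E w \<sigma>)) \<and>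
     (\<forall>w \<sigma> \<sigma>'. (\<forall>i<K. \<sigma> i = \<sigma>' i) \<longrightarrow> E w \<sigma> = E w \<sigma>') \<and> (\<forall>w \<sigma>. E w \<sigma> \<subseteq> facts w)"

lemma decset_mem: "decset K E \<Longrightarrow> K \<le> k \<Longrightarrow> x < k \<Longrightarrow> dec k (\<lambda>w \<sigma>. pt w \<sigma> x \<in> E w \<sigma>)"
  by (simp add: decset_def)

lemma decset_cong: "decset K E \<Longrightarrow> K \<le> k \<Longrightarrow> (\<And>i. i < k \<Longrightarrow> \<sigma> i = \<sigma>' i) \<Longrightarrow> E w \<sigma> = E w \<sigma>'"
  unfolding decset_def by (metis less_le_trans)

lemma decset_facts: "decset K E \<Longrightarrow> E w \<sigma> \<subseteq> facts w"
  by (simp add: decset_def)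

lemma dec_left: "dec k (\<lambda>w \<sigma>. pt w \<sigma> x \<in> left_facts w)"
proof -
  from tdec_nav[OF nav_Seq[OF nav_goto[of x] nav_goR[of "\<lambda>a B. a \<in> {5}"]], of k "\<lambda>a B. a = 5"]
  have "dec k (\<lambda>w \<sigma>. pt w \<sigma> x \<in> facts w \<and> base w (sweep w (\<lambda>i. base w i \<in> {5}) (pt w \<sigma> x)) = 5)"
    unfolding pt_def[symmetric] by (intro dec_and dec_sym dec_tdec)
  then show ?thesis by (simp add: left_facts_def)
qed

lemma decset_left: "decset K (\<lambda>w \<sigma>. left_facts w)"
  by (auto simp: decset_def dec_left left_facts_def[symmetric]) (simp add: left_facts_def)

lemma decset_right: "decset K (\<lambda>w \<sigma>. right_facts w)"
proof -
  have "dec k (\<lambda>w \<sigma>. pt w \<sigma> x \<in> facts w \<and> \<not> pt w \<sigma> x \<in> left_facts w)" for k x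
    by (intro dec_and dec_not dec_sym dec_left)
  then have "dec k (\<lambda>w \<sigma>. pt w \<sigma> x \<in> right_facts w)" for k x
    by (rule dec_cong) (auto simp: left_facts_def right_facts_def)
  then show ?thesis by (auto simp: decset_def) (simp add: right_facts_def)
qed

lemma decset_track: "y < K \<Longrightarrow> decset K (\<lambda>w \<sigma>. facts w \<inter> \<sigma> y)"
  using dec_and[OF dec_sym dec_tdec[OF tdec_track]] by (auto simp: decset_def)

lemma decset_diff: "y < K \<Longrightarrow> decset K (\<lambda>w \<sigma>. left_facts w - \<sigma> y)"
  using dec_and[OF dec_left dec_not[OF dec_tdec[OF tdec_track]]]
  by (auto simp: decset_def) (simp add: left_facts_def)

lemma pt_other: "x \<noteq> k \<Longrightarrow> pt w (\<sigma>(k := X)) x = pt w \<sigma> x"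
  by (simp add: pt_def)

lemma dec_subset:
  assumes "decset K E" "decset K F" "K \<le> k"
  shows "dec k (\<lambda>w \<sigma>. fat w ` E w \<sigma> \<subseteq> fat w ` F w \<sigma>)"
proof -
  have "dec (Suc k) (\<lambda>w \<sigma>. \<not> pt w \<sigma> k \<in> E w \<sigma> \<or>
    (\<exists>q\<in>facts w. pt w (\<sigma>(Suc k := {q})) (Suc k) \<in> F w (\<sigma>(Suc k := {q})) \<and>
      pt w (\<sigma>(Suc k := {q})) k \<in> facts w \<and> pt w (\<sigma>(Suc k := {q})) (Suc k) \<in> facts w \<and>
      fat w (pt w (\<sigma>(Suc k := {q})) k) = fat w (pt w (\<sigma>(Suc k := {q})) (Suc k))))"
    using assms by (intro dec_or dec_not dec_ex dec_and decset_mem dec_same_fact) auto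
  from dec_all[OF this] show ?thesis
  proof (rule dec_cong)
    fix w \<sigma> assume w: "good w" "marked w k \<sigma>"
    have E: "E w (\<sigma>(k := {p})) = E w \<sigma>" "F w (\<sigma>(k := {p}, Suc k := {q})) = F w \<sigma>" for p q
      by (rule decset_cong[OF assms(1,3)], simp) (rule decset_cong[OF assms(2,3)], simp)
    have "E w \<sigma> \<subseteq> facts w" "F w \<sigma> \<subseteq> facts w" using decset_facts assms by blast+
    then have "fat w ` E w \<sigma> \<subseteq> fat w ` F w \<sigma> \<longleftrightarrow>
      (\<forall>p\<in>facts w. p \<notin> E w \<sigma> \<or> (\<exists>q\<in>facts w. q \<in> F w \<sigma> \<and> p \<in> facts w \<and> q \<in> facts w \<and> fat w p = fat w q))"
      by blast
    then show "(\<forall>p\<in>facts w. \<not> pt w (\<sigma>(k := {p})) k \<in> E w (\<sigma>(k := {p})) \<or>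
      (\<exists>q\<in>facts w. pt w (\<sigma>(k := {p}, Suc k := {q})) (Suc k) \<in> F w (\<sigma>(k := {p}, Suc k := {q})) \<and>
      pt w (\<sigma>(k := {p}, Suc k := {q})) k \<in> facts w \<and> pt w (\<sigma>(k := {p}, Suc k := {q})) (Suc k) \<in> facts w \<and>
      fat w (pt w (\<sigma>(k := {p}, Suc k := {q})) k) = fat w (pt w (\<sigma>(k := {p}, Suc k := {q})) (Suc k)))) =
      (fat w ` E w \<sigma> \<subseteq> fat w ` F w \<sigma>)"
      by (simp add: E pt_upd[OF w(1)] pt_other cong: ball_cong bex_cong)
  qed
qed

fun upds :: "tracks \<Rightarrow> nat \<Rightarrow> int list \<Rightarrow> tracks" where
  "upds \<sigma> k [] = \<sigma>"
| "upds \<sigma> k (p # ps) = upds (\<sigma>(k := {p})) (Suc k) ps"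

lemma upds_apply: "upds \<sigma> k ps i = (if k \<le> i \<and> i < k + length ps then {ps ! (i - k)} else \<sigma> i)"
proof (induction ps arbitrary: \<sigma> k)
  case (Cons p ps)
  then show ?case by (cases "i = k") (auto simp: nth_Cons')
qed auto

lemma dec_exs:
  "dec (k + n) P \<Longrightarrow> dec k (\<lambda>w \<sigma>. \<exists>ps. length ps = n \<and> set ps \<subseteq> facts w \<and> P w (upds \<sigma> k ps))"
proof (induction n arbitrary: k)
  case (Suc n)
  then have "dec (Suc k) (\<lambda>w \<sigma>. \<exists>ps. length ps = n \<and> set ps \<subseteq> facts w \<and> P w (upds \<sigma> (Suc k) ps))" by simp
  from dec_ex[OF this] show ?case
  proof (rule dec_cong)
    fix w and \<sigma> :: tracks
    show "(\<exists>p\<in>facts w. \<exists>ps. length ps = n \<and> set ps \<subseteq> facts w \<and> P w (upds (\<sigma>(k := {p})) (Suc k) ps)) =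
       (\<exists>ps. length ps = Suc n \<and> set ps \<subseteq> facts w \<and> P w (upds \<sigma> k ps))" (is "?L = ?R")
    proof
      assume ?L
      then obtain p ps where "p \<in> facts w" "length ps = n" "set ps \<subseteq> facts w"
        "P w (upds (\<sigma>(k := {p})) (Suc k) ps)" by blast
      then show ?R by (intro exI[of _ "p # ps"]) simp
    next
      assume ?R
      then obtain p ps where "length ps = n" "set (p # ps) \<subseteq> facts w" "P w (upds \<sigma> k (p # ps))"
        by (metis length_Suc_conv)
      then show ?L by auto
    qed
  qed
qed simp

fun apred :: "lit \<Rightarrow> nat" where
  "apred (Atom p ts) = p"
| "apred (Neq t t') = 0"

fun aargs :: "lit \<Rightarrow> trm list" where
  "aargs (Atom p ts) = ts"
| "aargs (Neq t t') = []"

abbreviation latoms :: "conj \<Rightarrow> lit list" where "latoms \<gamma> \<equiv> filter is_atom \<gamma>"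

definition occurs :: "conj \<Rightarrow> nat \<Rightarrow> nat \<times> nat \<Rightarrow> bool" where
  "occurs \<gamma> v = (\<lambda>(i, j). i < length (latoms \<gamma>) \<and> j < length (aargs (latoms \<gamma> ! i)) \<and>
     aargs (latoms \<gamma> ! i) ! j = Var v)"

lemma occurs_ex: "v \<in> atom_vars \<gamma> \<Longrightarrow> \<exists>ij. occurs \<gamma> v ij"
proof -
  assume "v \<in> atom_vars \<gamma>"
  then obtain l where l: "l \<in> set (latoms \<gamma>)" "v \<in> lvars l" by (auto simp: atom_vars_def)
  then have "is_atom l" by simp
  then obtain p ts where a: "l = Atom p ts" by (cases l) simp_all
  then obtain t where t: "t \<in> set ts" "v \<in> tvars t" using l by auto
  have "t = Var v" using t(2) by (cases t) simp_all
  then have "Var v \<in> set (aargs l)" using a t(1) by simp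
  then obtain i j where "i < length (latoms \<gamma>)" "latoms \<gamma> ! i = l" "j < length (aargs l)" "aargs l ! j = Var v"
    using l(1) by (metis in_set_conv_nth)
  then show ?thesis by (intro exI[of _ "(i, j)"]) (simp add: occurs_def)
qed

text \<open>The pointer on track \<open>k + i\<close> ranges over the facts matching the \<open>i\<close>-th atom; every variable
  is read off at one of its occurrences (field 0 of a fact is its predicate).\<close>
definition home_ref :: "conj \<Rightarrow> nat \<Rightarrow> nat set \<Rightarrow> (nat \<Rightarrow> ref) \<Rightarrow> nat \<Rightarrow> ref" where
  "home_ref \<gamma> k Y oref v = (if v \<in> Y \<and> (\<exists>ij. occurs \<gamma> v ij)
     then (let (i, j) = (SOME ij. occurs \<gamma> v ij) in Fld (k + i) (Suc j)) else oref v)"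

lemma home_ref_new:
  assumes "v \<in> Y" "v \<in> atom_vars \<gamma>"
  obtains i j where "occurs \<gamma> v (i, j)" "home_ref \<gamma> k Y oref v = Fld (k + i) (Suc j)"
proof -
  have ex: "\<exists>ij. occurs \<gamma> v ij" using occurs_ex assms by blast
  then have "occurs \<gamma> v (SOME ij. occurs \<gamma> v ij)" by (rule someI_ex)
  moreover obtain i j where ij: "(SOME ij. occurs \<gamma> v ij) = (i, j)" by (rule prod.exhaust)
  ultimately have "occurs \<gamma> v (i, j)" by (simp only: ij)
  moreover have "home_ref \<gamma> k Y oref v = Fld (k + i) (Suc j)"
    using ex assms(1) unfolding home_ref_def ij by simp
  ultimately show ?thesis by (rule that)
qed

lemma home_ref_old: "v \<notin> Y \<Longrightarrow> home_ref \<gamma> k Y oref v = oref v"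
  by (simp add: home_ref_def)

lemma home_ref_tracks:
  assumes "rtracks (oref v) \<subseteq> {..<k}"
  shows "rtracks (home_ref \<gamma> k Y oref v) \<subseteq> {..<k + length (latoms \<gamma>)}"
proof (cases "v \<in> Y \<and> (\<exists>ij. occurs \<gamma> v ij)")
  case True
  then have "occurs \<gamma> v (SOME ij. occurs \<gamma> v ij)" by (metis someI_ex)
  then show ?thesis using True by (auto simp: home_ref_def occurs_def split: prod.splits)
next
  case False
  then show ?thesis using assms by (auto simp: home_ref_def)
qed

fun tref :: "(nat \<Rightarrow> ref) \<Rightarrow> trm \<Rightarrow> ref" where
  "tref h (Const c) = Cst c"
| "tref h (Var v) = h v"

lemma rval_tref: "rval w \<sigma> (tref h t) = teval (\<lambda>v. rval w \<sigma> (h v)) t"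
  by (cases t) auto

lemma tref_tracks: "(\<And>v. rtracks (h v) \<subseteq> A) \<Longrightarrow> rtracks (tref h t) \<subseteq> A"
  by (cases t) auto

definition req :: "nat list \<Rightarrow> tracks \<Rightarrow> ref \<Rightarrow> ref \<Rightarrow> bool" where
  "req w \<sigma> r r' \<longleftrightarrow> rok w \<sigma> r \<and> rok w \<sigma> r' \<and> rval w \<sigma> r = rval w \<sigma> r'"

definition rneq :: "nat list \<Rightarrow> tracks \<Rightarrow> ref \<Rightarrow> ref \<Rightarrow> bool" where
  "rneq w \<sigma> r r' \<longleftrightarrow> rok w \<sigma> r \<and> rok w \<sigma> r' \<and> rval w \<sigma> r \<noteq> rval w \<sigma> r'"

text \<open>Constants, first occurrences and repeated variables are treated alike: each argument is
  compared with the one reference that stands for its term. The arity test makes this comparison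
  cover the entire fact.\<close>

definition matched :: "conj \<Rightarrow> nat \<Rightarrow> (nat \<Rightarrow> ref) \<Rightarrow> (nat list \<Rightarrow> tracks \<Rightarrow> int set) \<Rightarrow> nat list \<Rightarrow> tracks \<Rightarrow> bool" where
  "matched \<gamma> k h E w \<sigma> \<longleftrightarrow>
     (\<forall>i\<in>{..<length (latoms \<gamma>)}. pt w \<sigma> (k + i) \<in> E w \<sigma> \<and>
       (pt w \<sigma> (k + i) \<in> facts w \<and> length (snd (fat w (pt w \<sigma> (k + i)))) = length (aargs (latoms \<gamma> ! i))) \<and>
       req w \<sigma> (Fld (k + i) 0) (Cst (apred (latoms \<gamma> ! i))) \<and>
       (\<forall>j\<in>{..<length (aargs (latoms \<gamma> ! i))}. req w \<sigma> (Fld (k + i) (Suc j)) (tref h (aargs (latoms \<gamma> ! i) ! j)))) \<and>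
     (\<forall>l\<in>set \<gamma>. case l of Atom p ts \<Rightarrow> True | Neq t t' \<Rightarrow> rneq w \<sigma> (tref h t) (tref h t'))"

lemma dec_matched:
  assumes "decset K E" "K \<le> k" "\<And>v. rtracks (h v) \<subseteq> {..<k + length (latoms \<gamma>)}"
  shows "dec (k + length (latoms \<gamma>)) (matched \<gamma> k h E)"
proof -
  let ?n = "k + length (latoms \<gamma>)"
  have t: "rtracks (tref h t) \<subseteq> {..<?n}" for t using tref_tracks assms(3) by blast
  have "dec ?n (\<lambda>w \<sigma>. case l of Atom p ts \<Rightarrow> True | Neq t t' \<Rightarrow> rneq w \<sigma> (tref h t) (tref h t'))" for l
    by (cases l) (auto simp: rneq_def intro!: dec_const dec_neq t)
  then show ?thesis
    unfolding matched_def[abs_def] req_def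
    by (intro dec_and dec_ball dec_arity dec_eq decset_mem[OF assms(1)] t) (use assms(2) in auto)
qed

lemma matched_atomD:
  assumes "matched \<gamma> k h E w \<sigma>" "i < length (latoms \<gamma>)" "latoms \<gamma> ! i = Atom p ts"
  shows "pt w \<sigma> (k + i) \<in> E w \<sigma>" "length (snd (fat w (pt w \<sigma> (k + i)))) = length ts"
    "req w \<sigma> (Fld (k + i) 0) (Cst p)"
    "\<And>j. j < length ts \<Longrightarrow> req w \<sigma> (Fld (k + i) (Suc j)) (tref h (ts ! j))"
  using conjunct1[OF assms(1)[unfolded matched_def], THEN bspec, of i] assms(2,3) by auto

lemma matched_neqD:
  "matched \<gamma> k h E w \<sigma> \<Longrightarrow> Neq t t' \<in> set \<gamma> \<Longrightarrow> rneq w \<sigma> (tref h t) (tref h t')"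
  unfolding matched_def by (drule conjunct2, drule (1) bspec) simp

lemma matched_holds:
  assumes "matched \<gamma> k h E w \<sigma>" "fat w ` E w \<sigma> \<subseteq> D"
  shows "conj_holds D (\<lambda>v. rval w \<sigma> (h v)) \<gamma>"
  unfolding conj_holds_def
proof
  fix l assume l: "l \<in> set \<gamma>"
  let ?\<nu> = "\<lambda>v. rval w \<sigma> (h v)"
  show "lit_holds D ?\<nu> l"
  proof (cases l)
    case (Atom p ts)
    then have "l \<in> set (latoms \<gamma>)" using l by simp
    then obtain i where i: "i < length (latoms \<gamma>)" "latoms \<gamma> ! i = Atom p ts"
      using Atom by (metis in_set_conv_nth)
    let ?f = "fat w (pt w \<sigma> (k + i))"
    have f: "pt w \<sigma> (k + i) \<in> E w \<sigma>" "length (snd ?f) = length ts" "fst ?f = p"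
      "\<And>j. j < length ts \<Longrightarrow> snd ?f ! j = rval w \<sigma> (tref h (ts ! j))"
      using matched_atomD[OF assms(1) i] by (auto simp: req_def fact_fields_def)
    have "snd ?f = map (teval ?\<nu>) ts"
      using f(2,4) by (intro nth_equalityI) (auto simp: rval_tref)
    then have "?f = (p, map (teval ?\<nu>) ts)" using f(3) by (metis prod.collapse)
    then have "(p, map (teval ?\<nu>) ts) \<in> D" using f(1) assms(2) by (metis image_eqI subsetD)
    then show ?thesis using Atom by simp
  next
    case (Neq t t')
    then show ?thesis using matched_neqD[OF assms(1)] l by (auto simp: rneq_def rval_tref)
  qed
qed

lemma teval_cong: "(\<And>v. v \<in> tvars t \<Longrightarrow> \<nu> v = \<nu>' v) \<Longrightarrow> teval \<nu> t = teval \<nu>' t"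
  by (cases t) auto

text \<open>Quantification over valuations becomes quantification over one fact for each atom.
  Variables in \<open>Y\<close> are read off the matching facts, which is possible because they
  occur in atoms; the others keep their references \<open>oref\<close> from an outer scope.
  \<open>Q\<close> is the condition still to be tested under the same valuation, so a head can be
  nested inside its body.\<close>

lemma dec_match:
  fixes oref Y \<gamma> k
  defines "h \<equiv> home_ref \<gamma> k Y oref"
  assumes E: "decset K E" "K \<le> k" and oref: "\<And>v. rtracks (oref v) \<subseteq> {..<k}"
    and Y: "cvars \<gamma> \<inter> Y \<subseteq> atom_vars \<gamma>"
    and Q: "dec (k + length (latoms \<gamma>)) (\<lambda>w \<sigma>. (\<forall>v\<in>cvars \<gamma>. rok w \<sigma> (h v)) \<and> Q w \<sigma> (\<lambda>v. rval w \<sigma> (h v)))"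
    and Q_cong: "\<And>w \<sigma> \<sigma>' \<nu> \<nu>'. (\<And>i. i < k \<Longrightarrow> \<sigma> i = \<sigma>' i) \<Longrightarrow> (\<And>v. v \<in> cvars \<gamma> \<Longrightarrow> \<nu> v = \<nu>' v) \<Longrightarrow>
      Q w \<sigma> \<nu> = Q w \<sigma>' \<nu>'"
  shows "dec k (\<lambda>w \<sigma>. (\<forall>v\<in>cvars \<gamma> - Y. rok w \<sigma> (oref v)) \<and>
    (\<exists>\<nu>. (\<forall>v. v \<notin> Y \<longrightarrow> \<nu> v = rval w \<sigma> (oref v)) \<and> conj_holds (fat w ` E w \<sigma>) \<nu> \<gamma> \<and> Q w \<sigma> \<nu>))"
proof -
  let ?n = "length (latoms \<gamma>)"
  have ht: "rtracks (h v) \<subseteq> {..<k + ?n}" for v unfolding h_def using home_ref_tracks oref by blast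
  have "dec (k + ?n) (\<lambda>w \<sigma>. matched \<gamma> k h E w \<sigma> \<and> ((\<forall>v\<in>cvars \<gamma>. rok w \<sigma> (h v)) \<and> Q w \<sigma> (\<lambda>v. rval w \<sigma> (h v))))"
    by (rule dec_and[OF dec_matched[OF E ht] Q])
  from dec_exs[OF this] show ?thesis
  proof (rule dec_cong)
    fix w \<sigma> assume w: "good w" "marked w k \<sigma>"
    let ?u = "upds \<sigma> k"
    have old: "?u ps i = \<sigma> i" if "i < k" for ps i using that by (simp add: upds_apply)
    have E_eq: "E w (?u ps) = E w \<sigma>" for ps by (rule decset_cong[OF E]) (rule old)
    have oref_eq: "rval w (?u ps) (oref v) = rval w \<sigma> (oref v) \<and> rok w (?u ps) (oref v) = rok w \<sigma> (oref v)" for ps v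
    proof (rule rval_cong)
      fix x assume "x \<in> rtracks (oref v)"
      then have "x < k" using oref[of v] by blast
      then show "?u ps x = \<sigma> x" by (rule old)
    qed
    show "(\<exists>ps. length ps = ?n \<and> set ps \<subseteq> facts w \<and> matched \<gamma> k h E w (?u ps) \<and>
        (\<forall>v\<in>cvars \<gamma>. rok w (?u ps) (h v)) \<and> Q w (?u ps) (\<lambda>v. rval w (?u ps) (h v))) =
      ((\<forall>v\<in>cvars \<gamma> - Y. rok w \<sigma> (oref v)) \<and>
       (\<exists>\<nu>. (\<forall>v. v \<notin> Y \<longrightarrow> \<nu> v = rval w \<sigma> (oref v)) \<and> conj_holds (fat w ` E w \<sigma>) \<nu> \<gamma> \<and> Q w \<sigma> \<nu>))"
      (is "?L = ?R")
    proof
      assume ?L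
      then obtain ps where ps: "matched \<gamma> k h E w (?u ps)" "\<forall>v\<in>cvars \<gamma>. rok w (?u ps) (h v)"
        "Q w (?u ps) (\<lambda>v. rval w (?u ps) (h v))" by blast
      let ?\<nu> = "\<lambda>v. rval w (?u ps) (h v)"
      have hv: "h v = oref v" if "v \<notin> Y" for v using that by (simp add: h_def home_ref_old)
      have "\<forall>v\<in>cvars \<gamma> - Y. rok w \<sigma> (oref v)" using ps(2) hv oref_eq by (metis DiffE)
      moreover have "\<forall>v. v \<notin> Y \<longrightarrow> ?\<nu> v = rval w \<sigma> (oref v)" using hv oref_eq by simp
      moreover have "conj_holds (fat w ` E w \<sigma>) ?\<nu> \<gamma>"
        using matched_holds[OF ps(1)] E_eq by simp
      moreover have "Q w \<sigma> ?\<nu>"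
        using ps(3) Q_cong[of "?u ps" \<sigma> ?\<nu> ?\<nu> w] old by blast
      ultimately show ?R by (intro conjI exI[of _ ?\<nu>])
    next
      assume ?R
      then obtain \<nu> where roks: "\<And>v. v \<in> cvars \<gamma> - Y \<Longrightarrow> rok w \<sigma> (oref v)"
        and \<nu>: "\<And>v. v \<notin> Y \<Longrightarrow> \<nu> v = rval w \<sigma> (oref v)"
        and holds: "conj_holds (fat w ` E w \<sigma>) \<nu> \<gamma>" and q: "Q w \<sigma> \<nu>" by blast
      have "\<exists>p\<in>E w \<sigma>. fat w p = (apred (latoms \<gamma> ! i), map (teval \<nu>) (aargs (latoms \<gamma> ! i)))"
        if "i < ?n" for i
      proof -
        have l: "latoms \<gamma> ! i \<in> set \<gamma>" "is_atom (latoms \<gamma> ! i)" using nth_mem[OF that] by auto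
        then have "lit_holds (fat w ` E w \<sigma>) \<nu> (latoms \<gamma> ! i)" using holds by (simp add: conj_holds_def)
        then show ?thesis using l(2) by (cases "latoms \<gamma> ! i") auto
      qed
      \<comment> \<open>\<open>g i\<close> is a position of the fact to which \<nu> maps the
        \<open>i\<close>-th atom.\<close>
      then obtain g where g: "\<And>i. i < ?n \<Longrightarrow> g i \<in> E w \<sigma>"
        "\<And>i. i < ?n \<Longrightarrow> fat w (g i) = (apred (latoms \<gamma> ! i), map (teval \<nu>) (aargs (latoms \<gamma> ! i)))"
        by metis
      define ps where "ps = map g [0..<?n]"
      have gf: "g i \<in> facts w" if "i < ?n" for i using g(1)[OF that] decset_facts[OF E(1)] by blast
      have pti: "pt w (?u ps) (k + i) = g i" if "i < ?n" for i
      proof -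
        have "?u ps (k + i) = {g i}" using that by (simp add: upds_apply ps_def)
        then show ?thesis using facts_range[OF gf[OF that]] by (intro pt_single good_inp w) auto
      qed
      \<comment> \<open>The valuation read off the facts agrees with \<nu> on the variables of
        \<gamma>. Elsewhere they may differ, which \<open>Q_cong\<close> permits.\<close>
      have key: "rok w (?u ps) (h v) \<and> rval w (?u ps) (h v) = \<nu> v" if v: "v \<in> cvars \<gamma>" for v
      proof (cases "v \<in> Y")
        case True
        then have "v \<in> atom_vars \<gamma>" using v Y by blast
        then obtain i j where "occurs \<gamma> v (i, j)" "h v = Fld (k + i) (Suc j)"
          using home_ref_new[OF True] unfolding h_def by metis
        then show ?thesis using g(2) gf pti by (auto simp: occurs_def fact_fields_def)
      next
        case False
        then show ?thesis using v roks \<nu> oref_eq by (simp add: h_def home_ref_old)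
      qed
      have keyt: "rok w (?u ps) (tref h t) \<and> rval w (?u ps) (tref h t) = teval \<nu> t"
        if "tvars t \<subseteq> cvars \<gamma>" for t
        using that key by (cases t) auto
      have sub: "lvars l \<subseteq> cvars \<gamma>" if "l \<in> set \<gamma>" for l using that by (auto simp: cvars_def)
      have m: "matched \<gamma> k h E w (?u ps)"
        unfolding matched_def
      proof (intro conjI ballI)
        fix i assume "i \<in> {..<?n}"
        then have i: "i < ?n" by simp
        show "pt w (?u ps) (k + i) \<in> E w (?u ps)" using g(1) pti i E_eq by simp
        show "pt w (?u ps) (k + i) \<in> facts w" using gf pti i by simp
        show "length (snd (fat w (pt w (?u ps) (k + i)))) = length (aargs (latoms \<gamma> ! i))"
          using g(2) pti i by simp
        show "req w (?u ps) (Fld (k + i) 0) (Cst (apred (latoms \<gamma> ! i)))"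
          using g(2) gf pti i by (simp add: req_def fact_fields_def)
        fix j assume "j \<in> {..<length (aargs (latoms \<gamma> ! i))}"
        then have j: "j < length (aargs (latoms \<gamma> ! i))" by simp
        have l: "latoms \<gamma> ! i \<in> set \<gamma>" using nth_mem[OF i] by auto
        have "tvars (aargs (latoms \<gamma> ! i) ! j) \<subseteq> lvars (latoms \<gamma> ! i)"
          using j by (cases "latoms \<gamma> ! i") (auto dest: nth_mem)
        then have "tvars (aargs (latoms \<gamma> ! i) ! j) \<subseteq> cvars \<gamma>" using sub[OF l] by blast
        from keyt[OF this] show "req w (?u ps) (Fld (k + i) (Suc j)) (tref h (aargs (latoms \<gamma> ! i) ! j))"
          using g(2) gf pti i j by (simp add: req_def fact_fields_def)
      next
        fix l assume l: "l \<in> set \<gamma>"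
        show "case l of Atom p ts \<Rightarrow> True | Neq t t' \<Rightarrow> rneq w (?u ps) (tref h t) (tref h t')"
        proof (cases l)
          case (Neq t t')
          then have "tvars t \<subseteq> cvars \<gamma>" "tvars t' \<subseteq> cvars \<gamma>" using sub[OF l] by auto
          moreover have "teval \<nu> t \<noteq> teval \<nu> t'" using holds l Neq by (fastforce simp: conj_holds_def)
          ultimately show ?thesis using keyt Neq by (simp add: rneq_def)
        qed simp
      qed
      have "Q w (?u ps) (\<lambda>v. rval w (?u ps) (h v))"
        using q Q_cong[of \<sigma> "?u ps" \<nu> "\<lambda>v. rval w (?u ps) (h v)" w] old key by simp
      moreover have "length ps = ?n" "set ps \<subseteq> facts w" using gf by (auto simp: ps_def)
      moreover have "\<forall>v\<in>cvars \<gamma>. rok w (?u ps) (h v)" using key by simp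
      ultimately show ?L using m by (intro exI[of _ ps] conjI)
    qed
  qed
qed

lemma conj_holds_cong:
  assumes "\<And>v. v \<in> cvars \<gamma> \<Longrightarrow> \<nu> v = \<nu>' v"
  shows "conj_holds D \<nu> \<gamma> = conj_holds D \<nu>' \<gamma>"
proof -
  have "lit_holds D \<nu> l = lit_holds D \<nu>' l" if "l \<in> set \<gamma>" for l
  proof -
    have v: "v \<in> lvars l \<Longrightarrow> \<nu> v = \<nu>' v" for v using assms that by (auto simp: cvars_def)
    show ?thesis
    proof (cases l)
      case (Atom p ts)
      have "map (teval \<nu>) ts = map (teval \<nu>') ts"
        using v Atom by (intro map_cong refl teval_cong) auto
      then show ?thesis unfolding Atom by (simp only: lit_holds.simps)
    next
      case (Neq t t')
      then show ?thesis using v teval_cong[of t \<nu> \<nu>'] teval_cong[of t' \<nu> \<nu>'] by simp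
    qed
  qed
  then show ?thesis by (simp add: conj_holds_def)
qed

lemma cq_holds_cong:
  assumes "\<And>v. v \<in> cq_free_vars q \<Longrightarrow> \<nu> v = \<nu>' v"
  shows "cq_holds D \<nu> q = cq_holds D \<nu>' q"
proof -
  have "cq_holds D \<nu>' q" if "cq_holds D \<nu> q" "\<And>v. v \<in> cq_free_vars q \<Longrightarrow> \<nu> v = \<nu>' v" for \<nu> \<nu>'
  proof -
    obtain \<mu> where \<mu>: "\<And>x. x \<notin> set (fst q) \<Longrightarrow> \<mu> x = \<nu> x" "conj_holds D \<mu> (snd q)"
      using \<open>cq_holds D \<nu> q\<close> by (auto simp: cq_holds_def)
    let ?\<mu> = "\<lambda>x. if x \<in> set (fst q) then \<mu> x else \<nu>' x"
    have "conj_holds D ?\<mu> (snd q)"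
      using \<mu> that(2) by (subst conj_holds_cong[of _ _ \<mu>]) (auto simp: cq_free_vars_def)
    then show ?thesis by (auto simp: cq_holds_def intro!: exI[of _ ?\<mu>])
  qed
  then show ?thesis using assms by metis
qed

lemma finite_cvars: "finite (cvars \<gamma>)"
proof -
  have "finite (tvars t)" for t by (cases t) auto
  then have "finite (lvars l)" for l by (cases l) auto
  then show ?thesis by (simp add: cvars_def)
qed

text \<open>Body and head are evaluated in two different sets, and \<open>c\<close> fixes the truth
  value of the head: \<open>False\<close> gives a violation, \<open>True\<close> a derivation step
  with the derived atom as head.\<close>

lemma dec_dep:
  assumes E: "decset K E" "decset K F" "K \<le> k"
    and b: "cvars \<gamma> \<subseteq> atom_vars \<gamma>"
    and q: "\<And>q. q \<in> set qs \<Longrightarrow> set (fst q) \<subseteq> atom_vars (snd q)" "\<And>q. q \<in> set qs \<Longrightarrow> cq_free_vars q \<subseteq> cvars \<gamma>"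
  shows "dec k (\<lambda>w \<sigma>. \<exists>\<nu>. conj_holds (fat w ` E w \<sigma>) \<nu> \<gamma> \<and>
    (c \<longleftrightarrow> (\<exists>q\<in>set qs. cq_holds (fat w ` F w \<sigma>) \<nu> q)))"
proof -
  \<comment> \<open>All body variables are new here; \<open>Cst 0\<close> is a placeholder for
    variables without an occurrence.\<close>
  let ?h = "home_ref \<gamma> k UNIV (\<lambda>_. Cst 0)"
  let ?n = "k + length (latoms \<gamma>)"
  have ht: "rtracks (?h v) \<subseteq> {..<?n}" for v by (rule home_ref_tracks) simp
  have "dec ?n (\<lambda>w \<sigma>. (\<forall>v\<in>cvars (snd q) - set (fst q). rok w \<sigma> (?h v)) \<and>
    cq_holds (fat w ` F w \<sigma>) (\<lambda>v. rval w \<sigma> (?h v)) q)" if "q \<in> set qs" for q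
  proof -
    \<comment> \<open>The head binds its quantified variables only; free ones are read at their
      references in the body.\<close>
    let ?h' = "home_ref (snd q) ?n (set (fst q)) ?h"
    have "dec (?n + length (latoms (snd q))) (\<lambda>w \<sigma>. (\<forall>v\<in>cvars (snd q). rok w \<sigma> (?h' v)) \<and> True)"
      by (intro dec_and dec_ball dec_rok dec_const finite_cvars)
    from dec_match[of K F ?n ?h "snd q" "set (fst q)" "\<lambda>_ _ _. True", OF E(2) _ ht _ this]
    show ?thesis using q(1)[OF that] E(3) by (auto simp: cq_holds_def)
  qed
  from dec_bex[OF finite_set this]
  have "dec ?n (\<lambda>w \<sigma>. (\<forall>v\<in>cvars \<gamma>. rok w \<sigma> (?h v)) \<and> (c \<longleftrightarrow> (\<exists>q\<in>set qs.
    (\<forall>v\<in>cvars (snd q) - set (fst q). rok w \<sigma> (?h v)) \<and> cq_holds (fat w ` F w \<sigma>) (\<lambda>v. rval w \<sigma> (?h v)) q)))"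
    by (rule dec_and[OF dec_ball[OF finite_cvars dec_rok] dec_iff_const])
  then have d: "dec ?n (\<lambda>w \<sigma>. (\<forall>v\<in>cvars \<gamma>. rok w \<sigma> (?h v)) \<and> (c \<longleftrightarrow> (\<exists>q\<in>set qs.
    cq_holds (fat w ` F w \<sigma>) (\<lambda>v. rval w \<sigma> (?h v)) q)))"
  proof (rule dec_cong)
    fix w \<sigma>
    have "(\<forall>v\<in>cvars (snd q) - set (fst q). rok w \<sigma> (?h v))"
      if "\<forall>v\<in>cvars \<gamma>. rok w \<sigma> (?h v)" "q \<in> set qs" for q
      using that(1) q(2)[OF that(2)] unfolding cq_free_vars_def by blast
    then show "((\<forall>v\<in>cvars \<gamma>. rok w \<sigma> (?h v)) \<and> (c \<longleftrightarrow> (\<exists>q\<in>set qs.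
      (\<forall>v\<in>cvars (snd q) - set (fst q). rok w \<sigma> (?h v)) \<and> cq_holds (fat w ` F w \<sigma>) (\<lambda>v. rval w \<sigma> (?h v)) q))) =
      ((\<forall>v\<in>cvars \<gamma>. rok w \<sigma> (?h v)) \<and> (c \<longleftrightarrow> (\<exists>q\<in>set qs.
      cq_holds (fat w ` F w \<sigma>) (\<lambda>v. rval w \<sigma> (?h v)) q)))"
      by blast
  qed
  have "dec k (\<lambda>w \<sigma>. (\<forall>v\<in>cvars \<gamma> - UNIV. rok w \<sigma> (Cst 0)) \<and>
    (\<exists>\<nu>. (\<forall>v. v \<notin> UNIV \<longrightarrow> \<nu> v = rval w \<sigma> (Cst 0)) \<and> conj_holds (fat w ` E w \<sigma>) \<nu> \<gamma> \<and>
     (c \<longleftrightarrow> (\<exists>q\<in>set qs. cq_holds (fat w ` F w \<sigma>) \<nu> q))))"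
  proof (rule dec_match[where E = E and K = K and oref = "\<lambda>_. Cst 0" and Y = UNIV and
      Q = "\<lambda>w \<sigma> \<nu>. c \<longleftrightarrow> (\<exists>q\<in>set qs. cq_holds (fat w ` F w \<sigma>) \<nu> q)"])
    fix w and \<sigma> \<sigma>' :: tracks and \<nu> \<nu>' :: "nat \<Rightarrow> nat"
    assume *: "\<And>i. i < k \<Longrightarrow> \<sigma> i = \<sigma>' i" "\<And>v. v \<in> cvars \<gamma> \<Longrightarrow> \<nu> v = \<nu>' v"
    have "F w \<sigma> = F w \<sigma>'" by (rule decset_cong[OF E(2,3)]) (rule *(1))
    moreover have "cq_holds D \<nu> q = cq_holds D \<nu>' q" if "q \<in> set qs" for D q
      using q(2)[OF that] *(2) by (intro cq_holds_cong) auto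
    ultimately show "(c \<longleftrightarrow> (\<exists>q\<in>set qs. cq_holds (fat w ` F w \<sigma>) \<nu> q)) = (c \<longleftrightarrow> (\<exists>q\<in>set qs. cq_holds (fat w ` F w \<sigma>') \<nu>' q))"
      by simp
  qed (use b d E in auto)
  then show ?thesis by simp
qed

subsection \<open>Repairs\<close>

lemma lit_holds_mono: "lit_holds D \<nu> l \<Longrightarrow> D \<subseteq> D' \<Longrightarrow> lit_holds D' \<nu> l"
  by (cases l) auto

lemma conj_holds_mono: "conj_holds D \<nu> \<gamma> \<Longrightarrow> D \<subseteq> D' \<Longrightarrow> conj_holds D' \<nu> \<gamma>"
  unfolding conj_holds_def using lit_holds_mono by blast

lemma cq_holds_mono: "cq_holds D \<nu> q \<Longrightarrow> D \<subseteq> D' \<Longrightarrow> cq_holds D' \<nu> q"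
  unfolding cq_holds_def using conj_holds_mono by blast

text \<open>Two databases, because the body will be matched in a single fact while the head is
  evaluated among all remaining facts.\<close>

definition violated :: "db \<Rightarrow> db \<Rightarrow> dep \<Rightarrow> bool" where
  "violated C D d \<longleftrightarrow> (\<exists>\<nu>. conj_holds C \<nu> (body d) \<and> \<not> (\<exists>q\<in>set (head d). cq_holds D \<nu> q))"

lemma consistent_violated: "consistent \<Sigma> D \<longleftrightarrow> (\<forall>d\<in>\<Sigma>. \<not> violated D D d)"
  by (auto simp: consistent_def satisfies_def violated_def)

text \<open>Inequalities do not depend on the database, so the image of the only atom suffices to
  match the body.\<close>

lemma linear_body:
  assumes "linear d" "conj_holds D \<nu> (body d)"
  shows "\<exists>f\<in>D. conj_holds {f} \<nu> (body d)"
proof -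
  obtain l where l: "filter is_atom (body d) = [l]"
    using assms(1) by (auto simp: linear_def length_Suc_conv)
  then have "l \<in> set (filter is_atom (body d))" by simp
  then have "l \<in> set (body d)" "is_atom l" by simp_all
  from this(2) obtain p ts where a: "l = Atom p ts" by (cases l) simp_all
  let ?f = "(p, map (teval \<nu>) ts)"
  have "?f \<in> D" using assms(2) \<open>l \<in> set (body d)\<close> a by (force simp: conj_holds_def)
  moreover have "lit_holds {?f} \<nu> l'" if l': "l' \<in> set (body d)" for l'
  proof (cases l')
    case (Atom p' ts')
    then have "l' \<in> set (filter is_atom (body d))" using l' by simp
    then have "l' = l" using l by simp
    then show ?thesis using a by simp
  next
    case (Neq t t')
    then show ?thesis using assms(2) l' by (force simp: conj_holds_def)
  qed
  ultimately show ?thesis unfolding conj_holds_def by blast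
qed

context
  fixes S :: "nat set" and ar :: "nat \<Rightarrow> nat" and \<Sigma> :: "dep set"
  assumes fin: "finite \<Sigma>" and wf: "\<And>d. d \<in> \<Sigma> \<Longrightarrow> dep_wf S ar d"
begin

lemma dec_violated:
  assumes "decset K E" "decset K F" "K \<le> k" "d \<in> \<Sigma>"
  shows "dec k (\<lambda>w \<sigma>. violated (fat w ` E w \<sigma>) (fat w ` F w \<sigma>) d)"
  unfolding violated_def
  using dec_dep[of K E F k "body d" "head d" False] assms wf[OF assms(4)]
  by (auto simp: dep_wf_def cq_wf_def)

lemma dec_consistent:
  assumes "decset K E" "K \<le> k"
  shows "dec k (\<lambda>w \<sigma>. consistent \<Sigma> (fat w ` E w \<sigma>))"
  unfolding consistent_violated using assms by (intro dec_ball dec_not dec_violated fin)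

text \<open>\<open>X\<close> holds the positions discarded so far. Heads are monotone, so a head
  that fails among the remaining facts fails in all their subsets, and discarding is never
  regretted.\<close>

definition discard_rule :: "nat list \<Rightarrow> int set \<Rightarrow> int \<Rightarrow> bool" where
  "discard_rule w X p \<longleftrightarrow> p \<in> facts w \<and> p \<in> left_facts w \<and>
     (\<exists>d\<in>\<Sigma>. violated {fat w p} (fat w ` (left_facts w - X)) d)"

lemma dec_linear:
  "dec 0 (\<lambda>w \<sigma>. fat w ` (left_facts w - stab (grow w (discard_rule w))) = fat w ` right_facts w)"
proof -
  let ?E = "\<lambda>w \<sigma>. left_facts w - \<sigma> (0 :: nat)"
  \<comment> \<open>The mark on track \<open>Suc 0\<close> makes the candidate available as a
    database with a single fact.\<close>
  define P where "P w \<sigma> \<longleftrightarrow> pt w \<sigma> (Suc 0) \<in> left_facts w \<and>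
      (\<exists>d\<in>\<Sigma>. violated (fat w ` (facts w \<inter> \<sigma> (Suc 0))) (fat w ` ?E w \<sigma>) d)" for w \<sigma>
  have P: "dec (Suc (Suc 0)) P"
    unfolding P_def[abs_def]
    by (intro dec_and dec_left dec_bex fin dec_violated[where K = "Suc (Suc 0)"] decset_track decset_diff) auto
  have Q: "dec (Suc 0) (\<lambda>w \<sigma>. fat w ` ?E w \<sigma> \<subseteq> fat w ` right_facts w \<and> fat w ` right_facts w \<subseteq> fat w ` ?E w \<sigma>)"
    by (intro dec_and dec_subset[where K = "Suc 0"] decset_diff decset_right) auto
  from dec_fix[OF P Q] show ?thesis
  proof (rule dec_cong)
    fix w \<sigma> assume w: "good w" "marked w 0 \<sigma>"
    have "(p \<in> facts w \<and> P w (\<sigma>(0 := X, Suc 0 := {p}))) = discard_rule w X p" for X p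
    proof (cases "p \<in> facts w")
      case True
      then have "facts w \<inter> {p} = {p}" by blast
      then show ?thesis using pt_upd[OF w(1) True] True by (simp add: P_def discard_rule_def)
    qed (simp add: discard_rule_def)
    then have R: "(\<lambda>X p. p \<in> facts w \<and> P w (\<sigma>(0 := X, Suc 0 := {p}))) = discard_rule w"
      by (simp add: fun_eq_iff)
    show "(fat w ` ?E w (\<sigma>(0 := stab (grow w (\<lambda>X p. p \<in> facts w \<and> P w (\<sigma>(0 := X, Suc 0 := {p}))))))
        \<subseteq> fat w ` right_facts w \<and> fat w ` right_facts w \<subseteq>
        fat w ` ?E w (\<sigma>(0 := stab (grow w (\<lambda>X p. p \<in> facts w \<and> P w (\<sigma>(0 := X, Suc 0 := {p}))))))) =
      (fat w ` (left_facts w - stab (grow w (discard_rule w))) = fat w ` right_facts w)"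
      unfolding R by auto
  qed
qed

lemma linear_repair:
  assumes lin: "\<And>d. d \<in> \<Sigma> \<Longrightarrow> linear d" and w: "w = enc_input xs ys"
  shows "fat w ` (left_facts w - stab (grow w (discard_rule w))) = fat w ` right_facts w \<longleftrightarrow>
    is_repair \<Sigma> (set xs) (set ys)"
proof -
  let ?Y = "stab (grow w (discard_rule w))"
  let ?G = "fat w ` (left_facts w - ?Y)"
  have xs: "fat w ` left_facts w = set xs" using fat_left[OF w] .
  have facts: "left_facts w \<subseteq> facts w" by (auto simp: left_facts_def)
  have sub: "?G \<subseteq> set xs" using xs by blast
  \<comment> \<open>By linearity a violation comes from a single remaining fact, which the rule
    would still discard, contrary to the fixed point.\<close>
  have "\<not> violated ?G ?G d" if d: "d \<in> \<Sigma>" for d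
  proof
    assume "violated ?G ?G d"
    then obtain \<nu> where \<nu>: "conj_holds ?G \<nu> (body d)" "\<not> (\<exists>q\<in>set (head d). cq_holds ?G \<nu> q)"
      unfolding violated_def by blast
    obtain f where f: "f \<in> ?G" "conj_holds {f} \<nu> (body d)"
      using linear_body[OF lin[OF d] \<nu>(1)] by blast
    then obtain p where p: "p \<in> left_facts w" "p \<notin> ?Y" "f = fat w p" by blast
    then have "discard_rule w ?Y p"
      using f \<nu>(2) d facts unfolding discard_rule_def violated_def by blast
    then have "p \<in> ?Y" using facts_range p facts by (intro stab_grow_closed) fastforce+
    then show False using p by blast
  qed
  then have cons: "consistent \<Sigma> ?G" by (simp add: consistent_violated)
  have greatest: "C \<subseteq> ?G" if C: "C \<subseteq> set xs" "consistent \<Sigma> C" for C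
  proof -
    have avoid: "C \<subseteq> fat w ` (left_facts w - X)" if X: "\<forall>p\<in>X. fat w p \<notin> C" for X
    proof
      fix c assume "c \<in> C"
      then obtain p where "p \<in> left_facts w" "c = fat w p" using C(1) xs by blast
      then show "c \<in> fat w ` (left_facts w - X)" using X \<open>c \<in> C\<close> by blast
    qed
    have "\<forall>p\<in>?Y. fat w p \<notin> C"
    proof (rule stab_grow_induct)
      fix X p assume X: "\<forall>p\<in>X. fat w p \<notin> C" and p: "discard_rule w X p"
      then obtain d where d: "d \<in> \<Sigma>" "violated {fat w p} (fat w ` (left_facts w - X)) d"
        unfolding discard_rule_def by blast
      then obtain \<nu> where \<nu>: "conj_holds {fat w p} \<nu> (body d)"
        "\<not> (\<exists>q\<in>set (head d). cq_holds (fat w ` (left_facts w - X)) \<nu> q)"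
        unfolding violated_def by blast
      \<comment> \<open>By the invariant \<open>C\<close> lies inside the remaining facts, so a head
        holding in \<open>C\<close> would hold there too.\<close>
      have no: "\<not> (\<exists>q\<in>set (head d). cq_holds C \<nu> q)" using \<nu>(2) cq_holds_mono avoid[OF X] by blast
      have "fat w p \<notin> C"
      proof
        assume "fat w p \<in> C"
        then have "conj_holds C \<nu> (body d)" using \<nu>(1) by (auto elim: conj_holds_mono)
        then show False using no C(2) d(1) unfolding consistent_violated violated_def by blast
      qed
      then show "\<forall>p\<in>insert p X. fat w p \<notin> C" using X by blast
    qed simp
    then show ?thesis by (rule avoid)
  qed
  have "?G = set ys \<longleftrightarrow> is_repair \<Sigma> (set xs) (set ys)"
  proof
    assume G: "?G = set ys"
    have "\<not> consistent \<Sigma> E" if "set ys \<subset> E" "E \<subseteq> set xs" for E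
    proof
      assume "consistent \<Sigma> E"
      with that(2) have "E \<subseteq> set ys" unfolding G[symmetric] by (rule greatest)
      then show False using that(1) by blast
    qed
    then show "is_repair \<Sigma> (set xs) (set ys)" using sub cons unfolding is_repair_def G by blast
  next
    assume r: "is_repair \<Sigma> (set xs) (set ys)"
    then have "set ys \<subseteq> ?G" by (intro greatest) (simp_all add: is_repair_def)
    moreover have "\<not> set ys \<subset> ?G" using r sub cons by (auto simp: is_repair_def)
    ultimately show "?G = set ys" by (metis psubsetI)
  qed
  then show ?thesis using fat_right[OF w] by simp
qed

section \<open>Full dependencies\<close>

text \<open>Only facts of the given database are derived; a derivable fact outside of it shows up as an
  inconsistency of the closure.\<close>
definition derive_rule :: "nat list \<Rightarrow> int \<Rightarrow> int set \<Rightarrow> int \<Rightarrow> bool" where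
  "derive_rule w f X p \<longleftrightarrow> p \<in> facts w \<and> p \<in> left_facts w \<and>
     (fat w p \<in> fat w ` right_facts w \<or> fat w p = fat w f \<or>
      (\<exists>d\<in>\<Sigma>. \<exists>l\<in>set (latoms (snd (hd (head d)))). \<exists>\<nu>.
         conj_holds (fat w ` (facts w \<inter> X)) \<nu> (body d) \<and> lit_holds {fat w p} \<nu> l))"

lemma dec_derive:
  assumes full: "\<And>d. d \<in> \<Sigma> \<Longrightarrow> full d" and d: "d \<in> \<Sigma>" "l \<in> set (latoms (snd (hd (head d))))"
    and E: "decset K E" "decset K F" "K \<le> k"
  shows "dec k (\<lambda>w \<sigma>. \<exists>\<nu>. conj_holds (fat w ` E w \<sigma>) \<nu> (body d) \<and> lit_holds (fat w ` F w \<sigma>) \<nu> l)"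
proof -
  obtain \<gamma> where g: "head d = [([], \<gamma>)]" "cvars \<gamma> \<subseteq> cvars (body d)"
    using full[OF d(1)] by (auto simp: full_def)
  have "l \<in> set \<gamma>" using d(2) g(1) by simp
  then have "lvars l \<subseteq> cvars (body d)" using g(2) by (auto simp: cvars_def)
  then have "dec k (\<lambda>w \<sigma>. \<exists>\<nu>. conj_holds (fat w ` E w \<sigma>) \<nu> (body d) \<and>
      (True \<longleftrightarrow> (\<exists>q\<in>set [([], [l])]. cq_holds (fat w ` F w \<sigma>) \<nu> q)))"
    using wf[OF d(1)] by (intro dec_dep[OF E]) (auto simp: dep_wf_def cq_free_vars_def cvars_def)
  moreover have "cq_holds D \<nu> ([], [l]) \<longleftrightarrow> lit_holds D \<nu> l" for D \<nu>
    by (auto simp: cq_holds_def conj_holds_def fun_eq_iff[symmetric])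
  ultimately show ?thesis by simp
qed

lemma dec_full:
  assumes full: "\<And>d. d \<in> \<Sigma> \<Longrightarrow> full d"
  shows "dec 0 (\<lambda>w \<sigma>. (fat w ` right_facts w \<subseteq> fat w ` left_facts w \<and> consistent \<Sigma> (fat w ` right_facts w)) \<and>
    (\<forall>f\<in>facts w. (f \<notin> left_facts w \<or> fat w f \<in> fat w ` right_facts w) \<or>
      \<not> consistent \<Sigma> (fat w ` (facts w \<inter> stab (grow w (derive_rule w f))))))"
proof -
  let ?p = "Suc (Suc 0)"
  \<comment> \<open>Track 0 points to the tested fact, track 1 collects its closure, and track 2
    points to the candidate. Equality of two facts is expressed as inclusion of singletons.\<close>
  define P where "P w \<sigma> \<longleftrightarrow> pt w \<sigma> ?p \<in> left_facts w \<and>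
      (fat w ` (facts w \<inter> \<sigma> ?p) \<subseteq> fat w ` right_facts w \<or>
       fat w ` (facts w \<inter> \<sigma> ?p) \<subseteq> fat w ` (facts w \<inter> \<sigma> 0) \<or>
       (\<exists>d\<in>\<Sigma>. \<exists>l\<in>set (latoms (snd (hd (head d)))). \<exists>\<nu>.
         conj_holds (fat w ` (facts w \<inter> \<sigma> (Suc 0))) \<nu> (body d) \<and> lit_holds (fat w ` (facts w \<inter> \<sigma> ?p)) \<nu> l))"
    for w \<sigma>
  have P: "dec (Suc ?p) P"
    unfolding P_def[abs_def]
    using full by (intro dec_and dec_or dec_left dec_bex fin finite_set dec_subset[where K = "Suc ?p"]
        dec_derive[where K = "Suc ?p"] decset_track decset_right) auto
  have Q: "dec ?p (\<lambda>w \<sigma>. \<not> consistent \<Sigma> (fat w ` (facts w \<inter> \<sigma> (Suc 0))))"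
    by (intro dec_not dec_consistent[where K = ?p] decset_track) auto
  have F: "dec (Suc 0) (\<lambda>w \<sigma>. \<not> pt w \<sigma> 0 \<in> left_facts w \<or> fat w ` (facts w \<inter> \<sigma> 0) \<subseteq> fat w ` right_facts w)"
    by (intro dec_or dec_not dec_left dec_subset[where K = "Suc 0"] decset_track decset_right) auto
  have R: "dec 0 (\<lambda>w \<sigma>. fat w ` right_facts w \<subseteq> fat w ` left_facts w \<and> consistent \<Sigma> (fat w ` right_facts w))"
    by (intro dec_and dec_subset[where K = 0] dec_consistent[where K = 0] decset_right decset_left) auto
  from dec_all[OF dec_or[OF F dec_fix[OF P Q]]]
  have "dec 0 (\<lambda>w \<sigma>. \<forall>f\<in>facts w. (f \<notin> left_facts w \<or> fat w f \<in> fat w ` right_facts w) \<or>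
      \<not> consistent \<Sigma> (fat w ` (facts w \<inter> stab (grow w (derive_rule w f)))))"
  proof (rule dec_cong, intro ball_cong refl)
    fix w \<sigma> f assume w: "good w" "marked w 0 \<sigma>" and f: "f \<in> facts w"
    have F: "facts w \<inter> {f} = {f}" using f by blast
    have "(p \<in> facts w \<and> P w (\<sigma>(0 := {f}, Suc 0 := X, ?p := {p}))) = derive_rule w f X p" for X p
    proof (cases "p \<in> facts w")
      case True
      then have "facts w \<inter> {p} = {p}" by blast
      then show ?thesis using pt_upd[OF w(1) True] True F by (simp add: P_def derive_rule_def)
    qed (simp add: derive_rule_def)
    then have R: "(\<lambda>X p. p \<in> facts w \<and> P w (\<sigma>(0 := {f}, Suc 0 := X, ?p := {p}))) = derive_rule w f"
      by (simp add: fun_eq_iff)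
    show "((\<not> pt w (\<sigma>(0 := {f})) 0 \<in> left_facts w \<or>
          fat w ` (facts w \<inter> (\<sigma>(0 := {f})) 0) \<subseteq> fat w ` right_facts w) \<or>
        \<not> consistent \<Sigma> (fat w ` (facts w \<inter> (\<sigma>(0 := {f}, Suc 0 := stab (grow w (\<lambda>X p. p \<in> facts w \<and>
          P w (\<sigma>(0 := {f}, Suc 0 := X, ?p := {p})))))) (Suc 0)))) =
      ((f \<notin> left_facts w \<or> fat w f \<in> fat w ` right_facts w) \<or>
        \<not> consistent \<Sigma> (fat w ` (facts w \<inter> stab (grow w (derive_rule w f)))))"
      unfolding R using pt_upd[OF w(1) f] F by simp
  qed
  from dec_and[OF R this] show ?thesis .
qed

text \<open>Write \<open>C f\<close> for the closure. If a consistent \<open>E\<close> inside the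
  first database contains the second one and the fact at \<open>f\<close>, then it contains
  \<open>C f\<close>; every head atom required by \<open>C f\<close> lies in \<open>E\<close>, hence
  is listed and gets marked, so \<open>C f\<close> is consistent. Conversely, for a new fact a
  consistent \<open>C f\<close> is itself a proper extension that a repair must not have.\<close>

lemma full_repair:
  assumes full: "\<And>d. d \<in> \<Sigma> \<Longrightarrow> full d" and w: "w = enc_input xs ys"
  shows "((fat w ` right_facts w \<subseteq> fat w ` left_facts w \<and> consistent \<Sigma> (fat w ` right_facts w)) \<and>
    (\<forall>f\<in>facts w. (f \<notin> left_facts w \<or> fat w f \<in> fat w ` right_facts w) \<or>
      \<not> consistent \<Sigma> (fat w ` (facts w \<inter> stab (grow w (derive_rule w f)))))) \<longleftrightarrow>
    is_repair \<Sigma> (set xs) (set ys)"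
proof -
  have xs: "fat w ` left_facts w = set xs" and ys: "fat w ` right_facts w = set ys"
    using fat_left[OF w] fat_right[OF w] by simp_all
  have lf: "left_facts w \<subseteq> facts w" by (auto simp: left_facts_def)
  define C where "C f = fat w ` (facts w \<inter> stab (grow w (derive_rule w f)))" for f
  have C_sub: "C f \<subseteq> set xs" for f
  proof -
    have "stab (grow w (derive_rule w f)) \<subseteq> left_facts w"
      by (rule stab_grow_induct) (auto simp: derive_rule_def)
    then show ?thesis using xs by (auto simp: C_def)
  qed
  have closed: "fat w p \<in> C f" if "derive_rule w f (stab (grow w (derive_rule w f))) p" for f p
  proof -
    have p: "p \<in> facts w" using that by (simp add: derive_rule_def)
    then have "p \<in> stab (grow w (derive_rule w f))"
      using facts_range[OF p] that by (intro stab_grow_closed) auto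
    then show ?thesis using p by (auto simp: C_def)
  qed
  have C_f: "fat w f \<in> C f" if "f \<in> left_facts w" for f
    using that lf by (intro closed) (auto simp: derive_rule_def)
  have C_ys: "set ys \<subseteq> C f" if "set ys \<subseteq> set xs" for f
  proof
    fix y assume y: "y \<in> set ys"
    then have "y \<in> fat w ` left_facts w" using that unfolding xs by (rule subsetD[rotated])
    then obtain p where p: "p \<in> left_facts w" "y = fat w p" by (rule imageE)
    then have "derive_rule w f (stab (grow w (derive_rule w f))) p"
      using lf y unfolding derive_rule_def ys by blast
    then show "y \<in> C f" unfolding p(2) by (rule closed)
  qed
  have least: "C f \<subseteq> E" if E: "set ys \<subseteq> E" "fat w f \<in> E" "E \<subseteq> set xs" "consistent \<Sigma> E" for f E
  proof -
    have "\<forall>p\<in>stab (grow w (derive_rule w f)). fat w p \<in> E"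
    proof (rule stab_grow_induct)
      fix X p assume X: "\<forall>p\<in>X. fat w p \<in> E" and p: "derive_rule w f X p"
      have "fat w p \<in> E"
      proof (cases "fat w p \<in> fat w ` right_facts w \<or> fat w p = fat w f")
        case True
        then show ?thesis using E ys by auto
      next
        case False
        then obtain d l \<nu> where d: "d \<in> \<Sigma>" "l \<in> set (latoms (snd (hd (head d))))"
          "conj_holds (fat w ` (facts w \<inter> X)) \<nu> (body d)" "lit_holds {fat w p} \<nu> l"
          using p unfolding derive_rule_def by blast
        obtain \<gamma> where g: "head d = [([], \<gamma>)]" using full[OF d(1)] by (auto simp: full_def)
        have "conj_holds E \<nu> (body d)" using d(3) X by (auto elim!: conj_holds_mono)
        then have "cq_holds E \<nu> ([], \<gamma>)" using E(4) d(1) g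
          by (auto simp: consistent_def satisfies_def)
        then have "conj_holds E \<nu> \<gamma>" by (auto simp: cq_holds_def fun_eq_iff[symmetric])
        then have "lit_holds E \<nu> l" using d(2) g by (simp add: conj_holds_def)
        moreover have "is_atom l" using d(2) by simp
        ultimately show ?thesis using d(4) by (cases l) auto
      qed
      then show "\<forall>p\<in>insert p X. fat w p \<in> E" using X by blast
    qed simp
    then show ?thesis by (auto simp: C_def)
  qed
  have extends: "consistent \<Sigma> (C f)"
    if E: "set ys \<subseteq> E" "fat w f \<in> E" "E \<subseteq> set xs" "consistent \<Sigma> E" for f E
    unfolding consistent_def satisfies_def
  proof (intro ballI allI impI)
    fix d \<nu> assume d: "d \<in> \<Sigma>" and b: "conj_holds (C f) \<nu> (body d)"
    obtain \<gamma> where g: "head d = [([], \<gamma>)]" using full[OF d] by (auto simp: full_def)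
    have "conj_holds E \<nu> (body d)" using b least[OF E] by (rule conj_holds_mono)
    then have "cq_holds E \<nu> ([], \<gamma>)" using E(4) d g by (auto simp: consistent_def satisfies_def)
    then have h: "conj_holds E \<nu> \<gamma>" by (auto simp: cq_holds_def fun_eq_iff[symmetric])
    have "lit_holds (C f) \<nu> l" if l: "l \<in> set \<gamma>" for l
    proof (cases l)
      case (Atom p ts)
      let ?g = "(p, map (teval \<nu>) ts)"
      have "?g \<in> E" using h l Atom by (force simp: conj_holds_def)
      \<comment> \<open>\<open>E\<close> is part of the first database, so the head fact has a
        position there and the rule can add it.\<close>
      then obtain q where q: "q \<in> left_facts w" "?g = fat w q" using E(3) xs by blast
      have la: "l \<in> set (latoms (snd (hd (head d))))" using l g Atom by simp
      have "lit_holds {fat w q} \<nu> l" using Atom q(2) by simp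
      then have "derive_rule w f (stab (grow w (derive_rule w f))) q"
        using q(1) lf d la b unfolding derive_rule_def C_def by blast
      then show ?thesis using closed q(2) Atom by simp
    next
      case (Neq t t')
      then show ?thesis using h l by (force simp: conj_holds_def)
    qed
    then have "conj_holds (C f) \<nu> \<gamma>" by (simp add: conj_holds_def)
    then show "\<exists>q\<in>set (head d). cq_holds (C f) \<nu> q" using g by (auto simp: cq_holds_def)
  qed
  have "(\<forall>f\<in>facts w. (f \<notin> left_facts w \<or> fat w f \<in> set ys) \<or> \<not> consistent \<Sigma> (C f)) \<longleftrightarrow>
    (\<forall>E. set ys \<subset> E \<and> E \<subseteq> set xs \<longrightarrow> \<not> consistent \<Sigma> E)" if sub: "set ys \<subseteq> set xs"
  proof
    assume a: "\<forall>f\<in>facts w. (f \<notin> left_facts w \<or> fat w f \<in> set ys) \<or> \<not> consistent \<Sigma> (C f)"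
    show "\<forall>E. set ys \<subset> E \<and> E \<subseteq> set xs \<longrightarrow> \<not> consistent \<Sigma> E"
    proof (intro allI impI notI)
      fix E assume E: "set ys \<subset> E \<and> E \<subseteq> set xs" "consistent \<Sigma> E"
      \<comment> \<open>Single facts are enough: a consistent proper extension contains a new fact,
        and the closure generated by that fact is already consistent.\<close>
      then obtain e where e: "e \<in> E" "e \<notin> set ys" by blast
      then obtain f where f: "f \<in> left_facts w" "e = fat w f" using E(1) xs by blast
      then have "consistent \<Sigma> (C f)" using E e by (intro extends[of E]) auto
      then show False using a f e lf by blast
    qed
  next
    assume a: "\<forall>E. set ys \<subset> E \<and> E \<subseteq> set xs \<longrightarrow> \<not> consistent \<Sigma> E"
    have "\<not> consistent \<Sigma> (C f)" if "f \<in> left_facts w" "fat w f \<notin> set ys" for f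
      using a C_sub[of f] C_f[OF that(1)] C_ys[OF sub, of f] that(2) by blast
    then show "\<forall>f\<in>facts w. (f \<notin> left_facts w \<or> fat w f \<in> set ys) \<or> \<not> consistent \<Sigma> (C f)" by blast
  qed
  then show ?thesis unfolding xs ys C_def[symmetric] is_repair_def by blast
qed

end

text \<open>There are no parameter tracks, so the verdict is left on track 0 of the home cell, which
  is the mark that \<open>tm_of\<close> inspects when the program ends.\<close>

lemma dec_ptime:
  assumes "dec 0 P" "\<And>xs ys. P (enc_input xs ys) (\<lambda>_. {}) \<longleftrightarrow> is_repair \<Sigma> (set xs) (set ys)"
  shows "repair_checking_in_ptime S ar \<Sigma>"
proof -
  obtain P' where P': "tdec 0 P'" "\<And>w \<sigma>. good w \<Longrightarrow> marked w 0 \<sigma> \<Longrightarrow> P' w \<sigma> = P w \<sigma>"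
    using assms(1) unfolding dec_def by blast
  obtain c b where b: "polyb b" and c: "\<And>w \<sigma>. inp w \<Longrightarrow> marked w 0 \<sigma> \<Longrightarrow>
      exec w c (\<sigma>, 0) (b (length w)) (\<sigma>(0 := flag (P' w \<sigma>)), 0)"
    using P'(1) unfolding tdec_def solves_def by blast
  let ?e = "\<lambda>_. {}"
  have m: "marked w 0 ?e" for w by (simp add: marked_def)
  have "\<exists>\<sigma>' h'. exec w c (?e, 0) (b (length w)) (\<sigma>', h') \<and> (h' \<in> \<sigma>' 0 \<longleftrightarrow> P' w ?e)"
    if "set w \<subseteq> {1..5}" for w
    using c[of w ?e, OF _ m] that
    by (intro exI[of _ "?e(0 := flag (P' w ?e))"] exI[of _ "0 :: int"]) (simp add: inp_def)
  from program_to_tm[OF this] obtain M where M: "wf_tm M"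
    "\<And>w. set w \<subseteq> {1..5} \<Longrightarrow> \<exists>t \<le> b (length w) + 1. fst (tm_run M t w) \<in> {1, 2}"
    "\<And>w. set w \<subseteq> {1..5} \<Longrightarrow> tm_accepts M w \<longleftrightarrow> P' w ?e" by blast
  have "polyb (\<lambda>n. b n + 1)" by (intro polyb_intros b)
  then obtain C k where C: "\<And>n. b n + 1 \<le> C * (n + 1) ^ k" unfolding polyb_def by blast
  have "tm_accepts M (enc_input xs ys) \<longleftrightarrow> is_repair \<Sigma> (set xs) (set ys)" for xs ys
  proof -
    have "good (enc_input xs ys)" by (auto simp: good_def)
    then show ?thesis
      using M(3)[of "enc_input xs ys"] inp_enc[of xs ys] P'(2)[OF _ m] assms(2) by (simp add: inp_def)
  qed
  moreover have "\<exists>t \<le> C * (length w + 1) ^ k. fst (tm_run M t w) \<in> {1, 2}" if "set w \<subseteq> {1..5}" for w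
    using M(2)[OF that] C[of "length w"] order_trans by blast
  ultimately show ?thesis using M(1) unfolding repair_checking_in_ptime_def by blast
qed

theorem theorem4:
  fixes S :: "nat set" and ar :: "nat \<Rightarrow> nat" and \<Sigma> :: "dep set"
  assumes "signature S ar"
    and "finite \<Sigma>"
    and "\<forall>d \<in> \<Sigma>. dep_wf S ar d"
    and "(\<forall>d \<in> \<Sigma>. linear d) \<or> (\<forall>d \<in> \<Sigma>. full d)"
  shows "repair_checking_in_ptime S ar \<Sigma>"
proof -
  have fin: "finite \<Sigma>" and wf: "\<And>d. d \<in> \<Sigma> \<Longrightarrow> dep_wf S ar d" using assms(2,3) by auto
  show ?thesis using assms(4)
  proof
    assume "\<forall>d\<in>\<Sigma>. linear d"
    then have lin: "\<And>d. d \<in> \<Sigma> \<Longrightarrow> linear d" by blast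
    show ?thesis
      by (rule dec_ptime[OF dec_linear[OF fin wf]]) (assumption, rule linear_repair[OF fin wf lin refl])
  next
    assume "\<forall>d\<in>\<Sigma>. full d"
    then have full: "\<And>d. d \<in> \<Sigma> \<Longrightarrow> full d" by blast
    show ?thesis
      by (rule dec_ptime[OF dec_full[OF fin wf full]]) (assumption, assumption, rule full_repair[OF fin wf full refl])
  qed
qed

end
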